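(* Let $\pi\in(0,1/2)$ be fixed and write $\bar r=\bar r_{\mathrm{asym}}(\pi)$. (a) (Maximum likelihood estimation) There is a constant $C>0$ not depending on $n$ such that for all $n\ge 2$, $$\sup_{\boldsymbol\eta\in H}\ \mathbb E_{\boldsymbol\eta}\big[\psi_{\bar r}(\hat{\boldsymbol\eta}_n,\boldsymbol\eta)\big]\ \le\ C\left(\frac{\log n}{n}\right)^{\frac{1}{2\bar r}},$$ where the expectation is taken with respect to the product distribution of an i.i.d. sample $Y_1,\dots,Y_n$ from the density $g(\cdot,\boldsymbol\eta)$, and $\hat{\boldsymbol\eta}_n$ is the maximum likelihood estimator over $H$. (b) (Minimax lower bound) Let $v_0\in\operatorname{int}(\Omega)$, $\boldsymbol\eta_0=(0,v_0,v_0)$, and for $\kappa>0$ let $$H(\kappa)=\big\{\boldsymbol\eta\in H:\ \psi_{\bar r}^{\bar r}(\boldsymbol\eta,\boldsymbol\eta_0)\le\kappa\big\},$$ where $\psi_{\bar r}^{\bar r}$ denotes the $\bar r$-th power of $\psi_{\bar r}$. Then there exist constants $c_1>0$ and $C'>0$, not depending on $n$, such that for all $n\ge1$, $$\inf_{\tilde{\boldsymbol\eta}_n}\ \sup_{\boldsymbol\eta\in H(c_1n^{-1/2})}\ \mathbb E_{\boldsymbol\eta}\big[\psi_{\bar r}(\tilde{\boldsymbol\eta}_n,\boldsymbol\eta)\big]\ \ge\ C'\left(\frac1n\right)^{\frac{1}{2\bar r}},$$ where the infimum is over all ($H$-valued) estimators $\tilde{\boldsymbol\eta}_n$ based on an i.i.d.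 sample $Y_1,\dots,Y_n$ from $g(\cdot,\boldsymbol\eta)$.
   Context: Fix compact sets $\Theta\subset\mathbb R$ and $\Omega\subset(0,\infty)$ with $0\in\operatorname{int}(\Theta)$. For $\theta\in\mathbb R$, $v>0$ let $f(x,\theta,v)=\frac{1}{\sqrt{2\pi_0 v}}\exp\big(-\frac{(x-\theta)^2}{2v}\big)$, $x\in\mathbb R$, be the Gaussian density with mean $\theta$ and variance $v$ (here $\pi_0=3.14159\ldots$). The symbol $\pi$ denotes a known, fixed mixing proportion, and $c=\pi/(1-\pi)$. Let $H=\Theta\times\Omega^2$. For $\boldsymbol\eta=(\theta,v_1,v_2)\in H$ define the mixture density $$g(x,\boldsymbol\eta)=\pi f(x,-\theta,v_1)+(1-\pi)f(x,c\theta,v_2),\qquad x\in\mathbb R.$$ Given an i.i.d. sample $Y_1,\dots,Y_n$ from $g(\cdot,\boldsymbol\eta)$, the maximum likelihood estimator $\hat{\boldsymbol\eta}_n$ is a maximizer over $\boldsymbol\eta'\in H$ of $\ell_n(\boldsymbol\eta')=\sum_{i=1}^n\log g(Y_i,\boldsymbol\eta')$ (which exists by compactness of $H$). Loss function: for $r\ge1$ and $\boldsymbol\eta^{(i)}=(\theta^{(i)},v_1^{(i)},v_2^{(i)})\in H$, $i=1,2$, $$\psi_r(\boldsymbol\eta^{(1)},\boldsymbol\eta^{(2)})=\Big(|\theta^{(1)}-\theta^{(2)}|^r+|v_1^{(1)}-v_1^{(2)}|^{r/2}+|v_2^{(1)}-v_2^{(2)}|^{r/2}\Big)^{1/r}.$$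 Asymmetric order: $\bar r_{\mathrm{asym}}(\pi)$ is the smallest positive integer $r$ such that the system of polynomial equations $$(1-\pi)\sum_{\alpha_1,\alpha_2,\beta_1,\beta_2}\frac{1}{2^{\alpha_2+\beta_2}}\frac{c^{\alpha_1}(c+1)^{\beta_1}(-x_1)^{\alpha_1}x_2^{\beta_1}y_2^{\alpha_2}y_3^{\beta_2}}{\alpha_1!\alpha_2!\beta_1!\beta_2!}+\pi\sum_{\alpha_1,\alpha_2}\frac{1}{2^{\alpha_2}}\frac{x_1^{\alpha_1}y_1^{\alpha_2}}{\alpha_1!\alpha_2!}=0,\qquad \ell=1,\dots,r,$$ has no non-trivial solution $(x_1,x_2,y_1,y_2,y_3)\in\mathbb R^5$. For each $\ell$, the first sum is over nonnegative integers $\alpha_1,\alpha_2,\beta_1,\beta_2$ with $\alpha_1+\beta_1+2\alpha_2+2\beta_2=\ell$, $1\le\alpha_1+\alpha_2\le r$ and $0\le\beta_1+\beta_2\le r-(\alpha_1+\alpha_2)$; the second sum is over nonnegative integers $\alpha_1,\alpha_2$ with $\alpha_1+2\alpha_2=\ell$ and $1\le\alpha_1+\alpha_2\le r$. A solution is non-trivial if at least one of $x_1,y_1,y_2$ is nonzero. (Convention $0^0=1$.) *)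

theory Defs
  imports "HOL-Probability.Probability"
begin

text \<open>
  Throughout, \<open>p\<close> is the mixing proportion (written \<open>\<pi>\<close> in the mathematical text, not to be
  confused with the library constant \<open>pi\<close>), and a parameter \<open>\<eta> = (\<theta>, v\<^sub>1, v\<^sub>2)\<close> is a triple of reals.
\<close>

type_synonym param = "real \<times> real \<times> real"

definition odds :: "real \<Rightarrow> real" where
  "odds p = p / (1 - p)"

text \<open>The library's \<open>normal_density\<close> is parametrised by the standard deviation.\<close>

definition gauss :: "real \<Rightarrow> real \<Rightarrow> real \<Rightarrow> real" where
  "gauss x \<theta> v = normal_density \<theta> (sqrt v) x"

definition mix_density :: "real \<Rightarrow> real \<Rightarrow> param \<Rightarrow> real" where
  "mix_density p x = (\<lambda>(\<theta>, v1, v2).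
     p * gauss x (- \<theta>) v1 + (1 - p) * gauss x (odds p * \<theta>) v2)"

definition param_space :: "real set \<Rightarrow> real set \<Rightarrow> param set" where
  "param_space \<Theta> \<Omega> = \<Theta> \<times> \<Omega> \<times> \<Omega>"

text \<open>A sample of size \<open>n\<close> is a function on \<open>{..<n}\<close>, undefined outside that set.\<close>

definition sample_space :: "nat \<Rightarrow> (nat \<Rightarrow> real) measure" where
  "sample_space n = (\<Pi>\<^sub>M i\<in>{..<n}. borel)"

definition sample_law :: "real \<Rightarrow> nat \<Rightarrow> param \<Rightarrow> (nat \<Rightarrow> real) measure" where
  "sample_law p n \<eta> = (\<Pi>\<^sub>M i\<in>{..<n}. density lborel (\<lambda>x. ennreal (mix_density p x \<eta>)))"

definition estimators :: "param set \<Rightarrow> nat \<Rightarrow> ((nat \<Rightarrow> real) \<Rightarrow> param) set" where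
  "estimators H n = sample_space n \<rightarrow>\<^sub>M restrict_space borel H"

definition log_lik :: "real \<Rightarrow> nat \<Rightarrow> (nat \<Rightarrow> real) \<Rightarrow> param \<Rightarrow> real" where
  "log_lik p n y \<eta> = (\<Sum>i<n. ln (mix_density p (y i) \<eta>))"

text \<open>
  The maximiser need not be unique; an MLE is any measurable choice of a maximiser.
\<close>

definition is_mle :: "real \<Rightarrow> param set \<Rightarrow> nat \<Rightarrow> ((nat \<Rightarrow> real) \<Rightarrow> param) \<Rightarrow> bool" where
  "is_mle p H n T \<longleftrightarrow> T \<in> estimators H n \<and>
     (\<forall>y \<in> space (sample_space n). is_arg_max (log_lik p n y) (\<lambda>\<eta>'. \<eta>' \<in> H) (T y))"

definition psi_loss :: "real \<Rightarrow> param \<Rightarrow> param \<Rightarrow> real" where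
  "psi_loss r = (\<lambda>(\<theta>, v1, v2) (\<theta>', v1', v2').
     (\<bar>\<theta> - \<theta>'\<bar> powr r + \<bar>v1 - v1'\<bar> powr (r / 2) + \<bar>v2 - v2'\<bar> powr (r / 2)) powr (1 / r))"

definition risk :: "real \<Rightarrow> real \<Rightarrow> nat \<Rightarrow> ((nat \<Rightarrow> real) \<Rightarrow> param) \<Rightarrow> param \<Rightarrow> ennreal" where
  "risk p r n T \<eta> = (\<integral>\<^sup>+ y. ennreal (psi_loss r (T y) \<eta>) \<partial>sample_law p n \<eta>)"

text \<open>The left-hand side of the \<open>l\<close>-th equation of the system of order \<open>r\<close>.\<close>

definition asym_poly ::
  "real \<Rightarrow> nat \<Rightarrow> nat \<Rightarrow> real \<Rightarrow> real \<Rightarrow> real \<Rightarrow> real \<Rightarrow> real \<Rightarrow> real" where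
  "asym_poly p r l x1 x2 y1 y2 y3 =
     (1 - p) *
       (\<Sum>(a1, a2, b1, b2) \<in> {(a1, a2, b1, b2).
            a1 + b1 + 2 * a2 + 2 * b2 = l \<and> 1 \<le> a1 + a2 \<and> a1 + a2 \<le> r \<and>
            b1 + b2 \<le> r - (a1 + a2)}.
          1 / 2 ^ (a2 + b2) *
          (odds p ^ a1 * (odds p + 1) ^ b1 * (- x1) ^ a1 * x2 ^ b1 * y2 ^ a2 * y3 ^ b2) /
          (fact a1 * fact a2 * fact b1 * fact b2)) +
     p *
       (\<Sum>(a1, a2) \<in> {(a1, a2). a1 + 2 * a2 = l \<and> 1 \<le> a1 + a2 \<and> a1 + a2 \<le> r}.
          1 / 2 ^ a2 * (x1 ^ a1 * y1 ^ a2) / (fact a1 * fact a2))"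

definition asym_nontrivial_solution ::
  "real \<Rightarrow> nat \<Rightarrow> real \<Rightarrow> real \<Rightarrow> real \<Rightarrow> real \<Rightarrow> real \<Rightarrow> bool" where
  "asym_nontrivial_solution p r x1 x2 y1 y2 y3 \<longleftrightarrow>
     (\<forall>l \<in> {1..r}. asym_poly p r l x1 x2 y1 y2 y3 = 0) \<and> (x1 \<noteq> 0 \<or> y1 \<noteq> 0 \<or> y2 \<noteq> 0)"

definition r_asym :: "real \<Rightarrow> nat" where
  "r_asym p = (LEAST r. 1 \<le> r \<and>
     \<not> (\<exists>x1 x2 y1 y2 y3. asym_nontrivial_solution p r x1 x2 y1 y2 y3))"

definition local_params :: "param set \<Rightarrow> nat \<Rightarrow> param \<Rightarrow> real \<Rightarrow> param set" where
  "local_params H r \<eta>0 \<kappa> = {\<eta> \<in> H. psi_loss (real r) \<eta> \<eta>0 ^ r \<le> \<kappa>}"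

end

theory Submission
  imports Defs
begin

text \<open>
  Why the theorem is true. Put \<open>s = \<theta> / (1 - p)\<close>, \<open>L = 2 p - 1\<close> and
  \<open>D = v\<^sub>2 - v\<^sub>1 + L s\<^sup>2 / 3\<close>. The density with parameter \<open>\<eta>\<close> is centred, and it is the convolution of
  \<open>N(0, v\<^sub>1)\<close> with a two-point mixture whose second component has the extra variance \<open>v\<^sub>2 - v\<^sub>1\<close>
  (formally, if that is negative); hence
  its cumulants of order at least three are \<open>p (1 - p)\<close> times universal polynomials in \<open>s\<close> and \<open>D\<close>,
  homogeneous if \<open>s\<close> has weight one and \<open>D\<close> weight two. Two facts about these polynomials carry
  everything. The cumulants of orders three to six determine \<open>(s, D)\<close> (\<open>cumulants_inj\<close>); and those of
  orders three and four already form a local diffeomorphism away from the origin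
  (\<open>cum_det_diag_pos\<close>).

  The polynomial system of order \<open>r\<close> says that two centred mixtures have equal moments up to order
  \<open>r\<close> (\<open>asym_system_iff_moments\<close>). Injectivity therefore excludes non-trivial solutions for \<open>r = 6\<close>.
  For \<open>r \<le> 5\<close> there are some: if \<open>\<theta> = 0\<close>, replacing \<open>v\<^sub>2 - v\<^sub>1\<close> by its negative at constant mean variance
  is first noticed by the sixth cumulant, which contains the cube of that difference. So the order
  is \<open>6\<close> for every \<open>p < 1/2\<close> (\<open>r_asym_eq_6\<close>).

  Upper bound. By compactness of a weighted sphere the two facts give a quantitative form of
  injectivity: the differences of the moments of orders two to six dominate \<open>\<psi>\<^sup>6\<close>
  (\<open>moment_gap_lower_bound\<close>). A difference of moments is at most a constant times the Hellinger
  distance, by Cauchy--Schwarz, so the Hellinger affinity of two parameters is at most \<open>1 - c \<psi>\<^sup>1\<^sup>2\<close>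
  (\<open>affinity_upper_bound\<close>). On a net of mesh \<open>n\<^sup>-\<^sup>2\<close>, with polynomially many points, the square root of
  the likelihood ratio against the true parameter has expectation at most
  \<open>exp (O(1) - c n \<psi>\<^sup>1\<^sup>2)\<close>; a union bound shows that the maximiser has
  \<open>\<psi>\<^sup>6 = O(\<surd>(log n / n))\<close> up to an event of probability \<open>O(1/n)\<close> (\<open>mle_risk_bound\<close>).

  Lower bound. At \<open>\<theta> = 0\<close> the two parameters with opposite variance differences of size \<open>d\<close> have
  densities that differ by \<open>O(d\<^sup>3)\<close>, hence chi-square divergence \<open>O(d\<^sup>6)\<close> (\<open>hard_points_chi2\<close>). With
  \<open>d\<close> of order \<open>n\<^sup>-\<^sup>1\<^sup>/\<^sup>6\<close> a sample of size \<open>n\<close> cannot distinguish them, while their loss is of order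
  \<open>\<surd>d\<close> (\<open>two_point_bound\<close>, \<open>minimax_lower_bound\<close>).
\<close>

section \<open>Formal moment generating functions and the polynomial system\<close>

text \<open>
  The series \<open>exp (a t + v t\<^sup>2 / 2)\<close>, whose coefficients are the moments of \<open>N(a, v)\<close> divided by
  factorials. A formal series makes sense for negative \<open>v\<close> as well, and the unknowns of the
  polynomial system that play the part of variances have no sign.
\<close>
definition gauss_egf :: "real \<Rightarrow> real \<Rightarrow> real fps" where
  "gauss_egf a v = fps_exp a * (fps_exp (v / 2) oo fps_X ^ 2)"

definition mix_egf :: "real \<Rightarrow> param \<Rightarrow> real fps" where
  "mix_egf p = (\<lambda>(\<theta>, v1, v2).
     fps_const p * gauss_egf (- \<theta>) v1 + fps_const (1 - p) * gauss_egf (odds p * \<theta>) v2)"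

lemma gauss_egf_add: "gauss_egf (a + b) (v + w) = gauss_egf a v * gauss_egf b w"
proof -
  have "fps_exp ((v + w) / 2) oo fps_X ^ 2
      = (fps_exp (v / 2) oo fps_X ^ 2) * (fps_exp (w / 2) oo (fps_X::real fps) ^ 2)"
    by (simp add: add_divide_distrib fps_exp_add_mult fps_compose_mult_distrib)
  thus ?thesis
    by (simp add: gauss_egf_def fps_exp_add_mult)
qed

lemma gauss_egf_zero: "gauss_egf 0 0 = 1"
  by (simp add: gauss_egf_def)

lemma fps_nth_compose_square:
  "fps_nth (f oo fps_X ^ 2) n = (if even n then fps_nth f (n div 2) else (0::real))"
proof -
  have "fps_nth (f oo fps_X ^ 2) n = (\<Sum>i=0..n. fps_nth f i * (if n = 2 * i then 1 else 0))"
    by (simp add: fps_compose_nth fps_X_power_nth flip: power_mult)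
  also have "\<dots> = (\<Sum>i\<in>{i\<in>{0..n}. n = 2 * i}. fps_nth f i)"
    by (subst sum.inter_filter) (auto intro!: sum.cong)
  also have "{i\<in>{0..n}. n = 2 * i} = (if even n then {n div 2} else {})"
    by auto
  finally show ?thesis by simp
qed

lemma gauss_egf_nth:
  "fps_nth (gauss_egf a v) n =
     (\<Sum>i=0..n. a ^ i / fact i * (if even (n - i) then (v / 2) ^ ((n - i) div 2) / fact ((n - i) div 2) else 0))"
  unfolding gauss_egf_def fps_mult_nth
  by (intro sum.cong) (simp_all add: fps_nth_compose_square)

text \<open>
  The pairs \<open>(\<alpha>\<^sub>1, \<alpha>\<^sub>2)\<close> of weight \<open>l\<close> over which the polynomial system sums.
\<close>
definition weighted_pairs :: "nat \<Rightarrow> (nat \<times> nat) set" where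
  "weighted_pairs l = {(i, j). i + 2 * j = l}"

lemma finite_weighted_pairs [simp]: "finite (weighted_pairs l)"
  by (rule finite_subset[of _ "{..l} \<times> {..l}"]) (auto simp: weighted_pairs_def)

lemma gauss_egf_nth_weighted_pairs:
  "fps_nth (gauss_egf a v) n = (\<Sum>(i, j)\<in>weighted_pairs n. a ^ i / fact i * (v / 2) ^ j / fact j)"
proof -
  have "(\<Sum>(i, j)\<in>weighted_pairs n. a ^ i / fact i * (v / 2) ^ j / fact j)
      = (\<Sum>i\<in>{i\<in>{0..n}. even (n - i)}. a ^ i / fact i * ((v / 2) ^ ((n - i) div 2) / fact ((n - i) div 2)))"
    by (rule sum.reindex_bij_witness[of _ "\<lambda>i. (i, (n - i) div 2)" fst]) (auto simp: weighted_pairs_def)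
  also have "\<dots> = fps_nth (gauss_egf a v) n"
    unfolding gauss_egf_nth
    by (subst sum.inter_filter) (auto intro!: sum.cong)
  finally show ?thesis ..
qed

text \<open>
  Tuples of weight \<open>l \<le> r\<close> satisfy the bounds by \<open>r\<close>, so the first sum runs over all ways to split
  \<open>l = i + (l - i)\<close> with \<open>i \<ge> 1\<close> and to represent \<open>i\<close> and \<open>l - i\<close> by weighted pairs: it is a
  coefficient of a product of two series from which the term \<open>i = 0\<close> has been removed.
\<close>
lemma asym_poly_eq_nth:
  assumes "1 \<le> l" "l \<le> r"
  shows "asym_poly p r l x1 x2 y1 y2 y3 =
    fps_nth (fps_const (1 - p) * ((gauss_egf (- (odds p * x1)) y2 - 1) * gauss_egf ((odds p + 1) * x2) y3)
      + fps_const p * (gauss_egf x1 y1 - 1)) l"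
proof -
  define h where "h a v n = fps_nth (gauss_egf a v) n" for a v n
  let ?c = "odds p"
  let ?S = "{(a1, a2, b1, b2). a1 + b1 + 2 * a2 + 2 * b2 = l \<and> 1 \<le> a1 + a2 \<and> a1 + a2 \<le> r \<and>
            b1 + b2 \<le> r - (a1 + a2)}"
  have h0: "h a v 0 = 1" for a v
    by (simp add: h_def gauss_egf_nth)
  have S1: "(\<Sum>(a1, a2, b1, b2) \<in> ?S. 1 / 2 ^ (a2 + b2)  *
          (?c ^ a1 * (?c + 1) ^ b1 * (- x1) ^ a1 * x2 ^ b1 * y2 ^ a2 * y3 ^ b2) /
          (fact a1 * fact a2 * fact b1 * fact b2))
      = (\<Sum>i=1..l. h (- (?c * x1)) y2 i * h ((?c + 1) * x2) y3 (l - i))"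
  proof -
    have "(\<Sum>i=1..l. h (- (?c * x1)) y2 i * h ((?c + 1) * x2) y3 (l - i))
      = (\<Sum>i=1..l. \<Sum>((a1, a2), (b1, b2))\<in>weighted_pairs i \<times> weighted_pairs (l - i).
           ((- (?c * x1)) ^ a1 / fact a1 * (y2 / 2) ^ a2 / fact a2)  *
           (((?c + 1) * x2) ^ b1 / fact b1 * (y3 / 2) ^ b2 / fact b2))"
      by (simp add: h_def gauss_egf_nth_weighted_pairs sum_product sum.cartesian_product split_def)
    also have "\<dots> = (\<Sum>(i, (a1, a2), (b1, b2))\<in>Sigma {1..l} (\<lambda>i. weighted_pairs i \<times> weighted_pairs (l - i)).
           ((- (?c * x1)) ^ a1 / fact a1 * (y2 / 2) ^ a2 / fact a2)  *
           (((?c + 1) * x2) ^ b1 / fact b1 * (y3 / 2) ^ b2 / fact b2))"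
      by (subst sum.Sigma) (auto simp: split_def)
    also have "\<dots> = (\<Sum>(a1, a2, b1, b2) \<in> ?S. 1 / 2 ^ (a2 + b2)  *
          (?c ^ a1 * (?c + 1) ^ b1 * (- x1) ^ a1 * x2 ^ b1 * y2 ^ a2 * y3 ^ b2) /
          (fact a1 * fact a2 * fact b1 * fact b2))"
    proof (rule sum.reindex_bij_witness[of _ "\<lambda>(a1, a2, b1, b2). (a1 + 2 * a2, (a1, a2), (b1, b2))"
            "\<lambda>(i, (a1, a2), (b1, b2)). (a1, a2, b1, b2)"], goal_cases)
      case (5 z)
      obtain i a1 a2 b1 b2 where z: "z = (i, (a1, a2), (b1, b2))"
        by (metis prod.exhaust)
      have "(- (?c * x1)) ^ a1 = ?c ^ a1 * (- x1) ^ a1"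
        by (simp flip: power_mult_distrib)
      thus ?case
        unfolding z by (simp add: power_mult_distrib power_divide power_add mult_ac)
    qed (use assms in \<open>auto simp: weighted_pairs_def\<close>)
    finally show ?thesis ..
  qed
  have S2: "(\<Sum>(a1, a2) \<in> {(a1, a2). a1 + 2 * a2 = l \<and> 1 \<le> a1 + a2 \<and> a1 + a2 \<le> r}.
          1 / 2 ^ a2 * (x1 ^ a1 * y1 ^ a2) / (fact a1 * fact a2)) = h x1 y1 l"
    unfolding h_def gauss_egf_nth_weighted_pairs
    by (intro sum.cong) (use assms in \<open>auto simp: weighted_pairs_def power_divide\<close>)
  have "fps_nth ((gauss_egf (- (?c * x1)) y2 - 1) * gauss_egf ((?c + 1) * x2) y3) l
      = (\<Sum>i=0..l. h (- (?c * x1)) y2 i * h ((?c + 1) * x2) y3 (l - i)) - h ((?c + 1) * x2) y3 l"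
    unfolding left_diff_distrib fps_sub_nth mult_1 by (simp add: h_def fps_mult_nth)
  also have "\<dots> = (\<Sum>i=1..l. h (- (?c * x1)) y2 i * h ((?c + 1) * x2) y3 (l - i))"
    by (simp add: sum.atLeast_Suc_atMost h0)
  finally show ?thesis
    unfolding asym_poly_def S1 S2 using assms(1) by (simp add: h_def)
qed

text \<open>
  Multiplication by the invertible series \<open>exp (- x\<^sub>2 t)\<close> does not affect the vanishing of the first
  \<open>r\<close> coefficients and recentres both mixtures: with \<open>\<theta>' = x\<^sub>2\<close>, \<open>\<theta> = x\<^sub>2 - x\<^sub>1\<close> a solution of the
  system is a pair of centred mixtures with the same moments.
\<close>
lemma asym_system_iff_moments:
  assumes p: "0 < p" "p < 1"
  shows "(\<forall>l\<in>{1..r}. asym_poly p r l x1 x2 y1 y2 y3 = 0) \<longleftrightarrow>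
    (\<forall>l\<in>{1..r}. fps_nth (mix_egf p (x2 - x1, y1, y2 + y3)) l = fps_nth (mix_egf p (x2, 0, y3)) l)"
proof -
  let ?c = "odds p"
  define F where "F = fps_const (1 - p) * ((gauss_egf (- (?c * x1)) y2 - 1) * gauss_egf ((?c + 1) * x2) y3)
      + fps_const p * (gauss_egf x1 y1 - 1)"
  define G where "G = mix_egf p (x2 - x1, y1, y2 + y3) - mix_egf p (x2, 0, y3)"
  have 1: "gauss_egf (- x2) 0 * F = G"
  proof -
    have e: "gauss_egf (?c * (x2 - x1)) (y2 + y3)
        = gauss_egf (- x2) 0 * (gauss_egf (- (?c * x1)) y2 * gauss_egf ((?c + 1) * x2) y3)"
      by (simp add: algebra_simps flip: gauss_egf_add)
    have e2: "gauss_egf (?c * x2) y3 = gauss_egf (- x2) 0 * gauss_egf ((?c + 1) * x2) y3"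
      by (simp add: algebra_simps flip: gauss_egf_add)
    have e3: "gauss_egf (- (x2 - x1)) y1 = gauss_egf (- x2) 0 * gauss_egf x1 y1"
      by (simp add: algebra_simps flip: gauss_egf_add)
    show ?thesis
      unfolding F_def G_def mix_egf_def prod.case e e2 e3 by (simp add: algebra_simps)
  qed
  have 2: "F = gauss_egf x2 0 * G"
    unfolding 1[symmetric] mult.assoc[symmetric] gauss_egf_add[symmetric] by (simp add: gauss_egf_zero)
  have F0: "fps_nth F 0 = 0" "fps_nth G 0 = 0"
    by (simp_all add: F_def G_def mix_egf_def gauss_egf_nth)
  have T: "\<forall>l\<in>{1..r}. fps_nth (A * B) l = 0"
    if "\<forall>l\<in>{1..r}. fps_nth B l = 0" "fps_nth B 0 = 0" for A B :: "real fps"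
  proof
    fix l assume "l \<in> {1..r}"
    hence "fps_nth B i = 0" if "i \<le> l" for i
      using \<open>fps_nth B 0 = 0\<close> \<open>\<forall>l\<in>{1..r}. fps_nth B l = 0\<close> that by (cases "i = 0") auto
    thus "fps_nth (A * B) l = 0" by (simp add: fps_mult_nth)
  qed
  have "(\<forall>l\<in>{1..r}. fps_nth F l = 0) \<longleftrightarrow> (\<forall>l\<in>{1..r}. fps_nth G l = 0)"
    using T[of F "gauss_egf (- x2) 0"] T[of G "gauss_egf x2 0"] F0
    unfolding 1 2[symmetric] by blast
  moreover have "asym_poly p r l x1 x2 y1 y2 y3 = fps_nth F l" if "l \<in> {1..r}" for l
    using that unfolding F_def by (intro asym_poly_eq_nth) auto
  ultimately show ?thesis by (simp add: G_def)
qed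

section \<open>Cumulants of a centred mixture\<close>

text \<open>
  The coefficients of \<open>t\<^sup>3, \<dots>, t\<^sup>6\<close> in the logarithm of
  \<open>p + (1 - p) exp (s t + (D - L s\<^sup>2 / 3) t\<^sup>2 / 2)\<close>, divided by \<open>p (1 - p)\<close>, where \<open>L = 2 p - 1\<close>. The
  variance difference is shifted by \<open>L s\<^sup>2 / 3\<close> because this turns the third one into a product.
\<close>
definition cum3 :: "real \<Rightarrow> real \<Rightarrow> real" where
  "cum3 s D = s * D / 2"
definition cum4 :: "real \<Rightarrow> real \<Rightarrow> real \<Rightarrow> real" where
  "cum4 L s D = D^2 / 8 + L * s^2 * D / 6 - (L^2 + 3) * s^4 / 144"
definition cum5 :: "real \<Rightarrow> real \<Rightarrow> real \<Rightarrow> real" where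
  "cum5 L s D = L * s * D^2 / 8 - (1 - L^2) * s^3 * D / 24 - L * (1 + L^2) * s^5 / 360"
definition cum6 :: "real \<Rightarrow> real \<Rightarrow> real \<Rightarrow> real" where
  "cum6 L s D = L * D^3 / 48 + (7 * L^2 - 3) * s^2 * D^2 / 96 + L * (L^2 - 3) * s^4 * D / 144
     + (9 - 5 * L^4) * s^6 / 6480"

abbreviation mix_coeff :: "real \<Rightarrow> nat \<Rightarrow> param \<Rightarrow> real" where
  "mix_coeff p l \<eta> \<equiv> fps_nth (mix_egf p \<eta>) l"

lemma gauss_egf_nths:
  "fps_nth (gauss_egf a v) 1 = a"
  "fps_nth (gauss_egf a v) 2 = a ^ 2 / 2 + v / 2"
  "fps_nth (gauss_egf a v) 3 = a ^ 3/6 + a * v/2"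
  "fps_nth (gauss_egf a v) 4 = a ^ 4/24 + a ^ 2 * v/4 + v ^ 2/8"
  "fps_nth (gauss_egf a v) 5 = a ^ 5/120 + a ^ 3 * v/12 + a * v ^ 2/8"
  "fps_nth (gauss_egf a v) 6 = a ^ 6/720 + a ^ 4 * v/48 + a ^ 2 * v ^ 2/16 + v ^ 3/48"
proof -
  have "{0..1} = {0, 1::nat}" "{0..2} = {0, 1, 2::nat}" "{0..3} = {0, 1, 2, 3::nat}"
    "{0..4} = {0, 1, 2, 3, 4::nat}" "{0..5} = {0, 1, 2, 3, 4, 5::nat}"
    "{0..6} = {0, 1, 2, 3, 4, 5, 6::nat}"
    by auto
  thus "fps_nth (gauss_egf a v) 1 = a"
    "fps_nth (gauss_egf a v) 2 = a ^ 2 / 2 + v / 2"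
    "fps_nth (gauss_egf a v) 3 = a ^ 3 / 6 + a * v / 2"
    "fps_nth (gauss_egf a v) 4 = a ^ 4 / 24 + a ^ 2 * v / 4 + v ^ 2 / 8"
    "fps_nth (gauss_egf a v) 5 = a ^ 5 / 120 + a ^ 3 * v / 12 + a * v ^ 2 / 8"
    "fps_nth (gauss_egf a v) 6 = a ^ 6 / 720 + a ^ 4 * v / 48 + a ^ 2 * v ^ 2 / 16 + v ^ 3 / 48"
    by (simp_all add: gauss_egf_nth fact_numeral power_divide)
qed

text \<open>
  These are the formulas for cumulants in terms of moments divided by factorials. Recentring and
  convolution with \<open>N(0, v\<^sub>1)\<close> change cumulants only up to order two, which is why the higher ones
  depend on \<open>s\<close> and \<open>D\<close> alone.
\<close>
lemma mix_cumulants: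
  assumes p: "0 < p" "p < 1"
  defines "s \<equiv> \<lambda>\<theta>. \<theta> / (1 - p)" and "L \<equiv> 2 * p - 1"
  defines "D \<equiv> \<lambda>(\<theta>, v1, v2). v2 - v1 + L * s \<theta> ^ 2 / 3"
  shows "mix_coeff p 1 (\<theta>, v1, v2) = 0"
    "mix_coeff p 2 (\<theta>, v1, v2) = (v1 + (1 - p) * (v2 - v1) + p * (1 - p) * s \<theta> ^ 2) / 2"
    "mix_coeff p 3 (\<theta>, v1, v2) = p * (1 - p) * cum3 (s \<theta>) (D (\<theta>, v1, v2))"
    "mix_coeff p 4 (\<theta>, v1, v2) - mix_coeff p 2 (\<theta>, v1, v2) ^ 2 / 2 = p * (1 - p) * cum4 L (s \<theta>) (D (\<theta>, v1, v2))"
    "mix_coeff p 5 (\<theta>, v1, v2) - mix_coeff p 2 (\<theta>, v1, v2) * mix_coeff p 3 (\<theta>, v1, v2)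
       = p * (1 - p) * cum5 L (s \<theta>) (D (\<theta>, v1, v2))"
    "mix_coeff p 6 (\<theta>, v1, v2) - mix_coeff p 2 (\<theta>, v1, v2) * mix_coeff p 4 (\<theta>, v1, v2)
       - mix_coeff p 3 (\<theta>, v1, v2) ^ 2 / 2 + mix_coeff p 2 (\<theta>, v1, v2) ^ 3 / 3
       = p * (1 - p) * cum6 L (s \<theta>) (D (\<theta>, v1, v2))"
proof -
  define t d where "t = s \<theta>" and "d = v2 - v1"
  have th: "\<theta> = (1 - p) * t" "odds p * \<theta> = p * t"
    using p by (simp_all add: t_def s_def odds_def)
  have M: "mix_coeff p l (\<theta>, v1, v2) = p * fps_nth (gauss_egf (- ((1 - p) * t)) v1) l
      + (1 - p) * fps_nth (gauss_egf (p * t) (v1 + d)) l" for l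
    by (simp add: mix_egf_def th(2)) (simp add: th(1) d_def)
  have D: "D (\<theta>, v1, v2) = d + L * t ^ 2 / 3" by (simp add: D_def t_def d_def)
  note E = M gauss_egf_nths[unfolded One_nat_def] D L_def d_def[symmetric] t_def[symmetric] cum3_def cum4_def cum5_def cum6_def
  show "mix_coeff p 1 (\<theta>, v1, v2) = 0"
    unfolding M gauss_egf_nths by (simp add: field_simps power_numeral_reduce)
  show "mix_coeff p 2 (\<theta>, v1, v2) = (v1 + (1 - p) * (v2 - v1) + p * (1 - p) * s \<theta> ^ 2) / 2"
    unfolding E by (simp add: field_simps power_numeral_reduce)
  show "mix_coeff p 3 (\<theta>, v1, v2) = p * (1 - p) * cum3 (s \<theta>) (D (\<theta>, v1, v2))"
    unfolding E by (simp add: field_simps power_numeral_reduce)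
  show "mix_coeff p 4 (\<theta>, v1, v2) - mix_coeff p 2 (\<theta>, v1, v2) ^ 2 / 2 = p * (1 - p) * cum4 L (s \<theta>) (D (\<theta>, v1, v2))"
    unfolding E by (simp add: field_simps power_numeral_reduce)
  show "mix_coeff p 5 (\<theta>, v1, v2) - mix_coeff p 2 (\<theta>, v1, v2) * mix_coeff p 3 (\<theta>, v1, v2)
       = p * (1 - p) * cum5 L (s \<theta>) (D (\<theta>, v1, v2))"
    unfolding E by (simp add: field_simps power_numeral_reduce)
  show "mix_coeff p 6 (\<theta>, v1, v2) - mix_coeff p 2 (\<theta>, v1, v2) * mix_coeff p 4 (\<theta>, v1, v2)
       - mix_coeff p 3 (\<theta>, v1, v2) ^ 2 / 2 + mix_coeff p 2 (\<theta>, v1, v2) ^ 3 / 3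
       = p * (1 - p) * cum6 L (s \<theta>) (D (\<theta>, v1, v2))"
    unfolding E by (simp add: field_simps power_numeral_reduce)
qed

section \<open>The cumulants of orders three to six determine the parameters\<close>

text \<open>
  This excludes two different points with the same third to sixth cumulants and with \<open>s s' < 0\<close>, in
  the dimensionless variables introduced in the proof of \<open>cumulants_inj\<close>; here \<open>L\<close> stands for the
  square of the earlier \<open>L\<close>. The equations \<open>e4\<close>, \<open>e5\<close>, \<open>e6\<close> come from the cumulants of these orders.
  The last one and \<open>e4\<close> force \<open>P\<close> to be large, then \<open>e4\<close> forces \<open>k\<close> and \<open>Q\<close> to be small, and the left
  side of \<open>e5\<close> is too large for its right side.
\<close>
lemma cumulant_system_infeasible:
  fixes k P Q L :: real
  assumes k: "k > 0" and P: "P > 0" and L: "0 < L" "L < 1"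
    and Q: "Q = k^2 * L * P"
    and e4: "k * (18 * P + (L + 3) * (Q + 2)) = 24"
    and e5: "45 * P = 15 * (1 - L) * (k * P) + (1 + L) * (Q^2 + 3 * Q + 1)"
    and e6: "135 * P + (9 - 5 * L^2) * (Q + 3) * k = 45 * (3 - L)"
  shows False
proof -
  have Q0: "Q > 0" using Q k P L by simp
  have L2: "L^2 < 1" "L^3 < L^2" "0 < L^2" "0 < L^3"
    using L by (simp_all add: power_strict_decreasing power_less_one_iff)
  have kP: "k * P > 0" using k P by simp
  define X where "X = k * (Q + 2)"
  have X: "X > 0" "(3 + L) * X = 24 - 18 * (k * P)" "k * (Q + 3) \<le> 3 / 2 * X" "k * (Q + 3) = X + k"
  proof -
    show "X > 0" unfolding X_def using k Q0 by (intro mult_pos_pos) auto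
  qed (use k Q0 e4 in \<open>simp_all add: X_def algebra_simps\<close>)
  have f1: "9 - 5 * L^2 \<le> (3 - L - L^2) * (3 + L)"
    using L2 by (simp add: algebra_simps power2_eq_square power3_eq_cube)
  have f2: "9 - 5 * L^2 \<le> (3 - L) * (3 + L)"
    using L2 by (simp add: algebra_simps power2_eq_square)
  \<comment> \<open>A crude bound on \<open>P\<close> first; it is what makes the bracket in the next bound nonnegative.\<close>
  have P1: "135 * P \<ge> 27 - 9 * L + 36 * L^2"
  proof -
    have "(9 - 5 * L^2) * (Q + 3) * k = (9 - 5 * L^2) * (k * (Q + 3))" by simp
    also have "\<dots> \<le> (9 - 5 * L^2) * (3 / 2 * X)"
      using X L2 by (intro mult_left_mono) auto
    also have "\<dots> \<le> (3 - L - L^2) * (3 + L) * (3 / 2 * X)"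
      using X f1 by (intro mult_right_mono) auto
    also have "\<dots> = (3 - L - L^2) * (3 / 2 * ((3 + L) * X))" by simp
    also have "\<dots> \<le> (3 - L - L^2) * 36"
      using kP L L2 by (intro mult_left_mono) (auto simp: X(2))
    finally show ?thesis using e6 by simp
  qed
  have P2: "45 * P \<ge> 7 * (3 - L)"
  proof -
    have "(9 - 5 * L^2) * (Q + 3) * k = (9 - 5 * L^2) * (X + k)" by (simp flip: X(4))
    also have "\<dots> = (9 - 5 * L^2) * X + (9 - 5 * L^2) * k" by (rule distrib_left)
    also have "(9 - 5 * L^2) * X \<le> (3 - L) * ((3 + L) * X)"
      using mult_right_mono[OF f2, of X] X(1) by simp
    also have "\<dots> = (3 - L) * (24 - 18 * (k * P))" by (simp only: X(2))
    also have "\<dots> = (3 - L) * 24 - 18 * (3 - L) * P * k" by (simp add: algebra_simps)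
    finally have a: "135 * P \<ge> 21 * (3 - L) + k * (18 * (3 - L) * P - (9 - 5 * L^2))"
      using e6 by (simp add: algebra_simps)
    have "9 - 5 * L^2 + (9 / 5 - 36 / 5 * L + 103 / 5 * L^2 - 24 / 5 * L^3)
        = 18 * (3 - L) * ((27 - 9 * L + 36 * L^2) / 135)"
      by (simp add: field_simps power2_eq_square power3_eq_cube)
    also have "\<dots> \<le> 18 * (3 - L) * P"
      using P1 L by (intro mult_left_mono) auto
    finally have lo: "9 - 5 * L^2 + (9 / 5 - 36 / 5 * L + 103 / 5 * L^2 - 24 / 5 * L^3) \<le> 18 * (3 - L) * P" .
    have "9 / 5 - 36 / 5 * L + 103 / 5 * L^2 - 24 / 5 * L^3
        = 79 / 5 * (L - 18 / 79)^2 + 387 / 395 + 24 / 5 * (L^2 - L^3)"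
      by (simp add: field_simps power2_eq_square power3_eq_cube)
    moreover have "79 / 5 * (L - 18 / 79)^2 \<ge> 0" "24 / 5 * (L^2 - L^3) \<ge> 0"
      using L2 by simp_all
    ultimately have "9 / 5 - 36 / 5 * L + 103 / 5 * L^2 - 24 / 5 * L^3 \<ge> 0" by simp
    with lo have "18 * (3 - L) * P - (9 - 5 * L^2) \<ge> 0" by simp
    with a k show ?thesis
      by (smt (verit) mult_nonneg_nonneg)
  qed
  have k1: "k \<le> 9 / 5"
  proof -
    have "18 * P + (L + 3) * (Q + 2) \<ge> 68 / 5"
    proof -
      have "(L + 3) * (Q + 2) \<ge> (L + 3) * 2" using L Q0 by (intro mult_left_mono) auto
      thus ?thesis using P2 L by simp
    qed
    hence "k * (68 / 5) \<le> 24" using e4 k by (metis mult_left_mono less_imp_le)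
    thus ?thesis by simp
  qed
  have Q1: "Q \<le> 4 * L / 3" and Q2: "Q \<le> 1"
  proof -
    have "k * (18 * P + (6 + 2 * L)) \<le> 24"
    proof -
      have "k * (18 * P + (6 + 2 * L)) \<le> k * (18 * P + (L + 3) * (Q + 2))"
        using k L Q0 by (intro mult_left_mono) (auto simp: algebra_simps)
      thus ?thesis using e4 by simp
    qed
    hence "(k * (18 * P + (6 + 2 * L)))^2 \<le> 24^2"
      using k P L by (intro power_mono) auto
    \<comment> \<open>Together with \<open>e4\<close>, the inequality of the means bounds \<open>k\<^sup>2 P\<close>, hence \<open>Q\<close>.\<close>
    moreover have "4 * (18 * P) * (6 + 2 * L) \<le> (18 * P + (6 + 2 * L))^2"
      using sum_squares_bound[of "18 * P" "6 + 2 * L"] by (simp add: power2_sum)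
    hence "k^2 * (4 * (18 * P) * (6 + 2 * L)) \<le> (k * (18 * P + (6 + 2 * L)))^2"
      unfolding power_mult_distrib by (intro mult_left_mono) auto
    ultimately have "k^2 * (4 * (18 * P) * (6 + 2 * L)) \<le> 24^2" by (rule order_trans[rotated])
    hence "k^2 * (4 * (18 * P) * (6 + 2 * L)) \<le> 576" by (simp only: power2_eq_square)
    hence "L * (k^2 * (4 * (18 * P) * (6 + 2 * L))) \<le> L * 576"
      using L by (intro mult_left_mono) auto
    hence a: "Q * (3 + L) \<le> 4 * L" by (simp add: Q algebra_simps)
    have "Q * 3 \<le> Q * (3 + L)" using Q0 L by simp
    thus "Q \<le> 4 * L / 3" using a by simp
    have "Q * (4 * L) \<le> Q * (3 + L)" using Q0 L by simp
    hence "Q * (4 * L) \<le> 1 * (4 * L)" using a by simp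
    thus "Q \<le> 1" using L mult_right_le_imp_le[of Q "4 * L" 1] by simp
  qed
  have "Q^2 \<le> Q" using Q0 Q2 by (simp add: power2_eq_square mult_left_le_one_le)
  hence "(1 + L) * (Q^2 + 3 * Q + 1) \<le> (1 + L) * (1 + 16 * L / 3)"
    using L Q1 by (intro mult_left_mono) auto
  moreover have "P * (45 - 15 * (1 - L) * k) \<ge> 7 * (3 - L) / 45 * (45 - 15 * (1 - L) * (9 / 5))"
  proof (rule mult_mono)
    have "15 * (1 - L) * k \<le> 15 * (1 - L) * (9 / 5)" using k1 L by (intro mult_left_mono) auto
    thus "45 - 15 * (1 - L) * (9 / 5) \<le> 45 - 15 * (1 - L) * k" by simp
  qed (use P P2 L in auto)
  moreover have "P * (45 - 15 * (1 - L) * k) = (1 + L) * (Q^2 + 3 * Q + 1)"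
    using e5 by (simp add: algebra_simps)
  moreover have "7 * (3 - L) / 45 * (45 - 15 * (1 - L) * (9 / 5))
      = (1 + L) * (1 + 16 * L / 3) + (37 / 5 + 52 / 15 * L - 143 / 15 * L^2)"
    by (simp add: field_simps power2_eq_square)
  moreover have "L^2 < L" using L by (simp add: power2_eq_square)
  ultimately show False using L L2 by linarith
qed

text \<open>
  Let \<open>w = s D = s' D'\<close> be twice the common third cumulant. If \<open>w = 0\<close>, one coordinate of each point
  vanishes; the sign of the fourth cumulant tells which, and the other one is read off from the term
  \<open>L D\<^sup>3\<close> of the sixth or \<open>L s\<^sup>5\<close> of the fifth cumulant. This is where \<open>L \<noteq> 0\<close>, that is
  \<open>p \<noteq> 1/2\<close>, enters. If \<open>w \<noteq> 0\<close>, substitute \<open>D = w / s\<close>. For \<open>s s' > 0\<close> the fourth cumulant is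
  strictly monotone in \<open>s\<close>, because a discriminant is negative. For \<open>s s' < 0\<close> it
  does not separate the points, and the fifth and sixth cumulants are needed.
\<close>
lemma cumulants_inj:
  fixes L :: real
  assumes L: "L \<noteq> 0" "L^2 < 1"
    and c3: "cum3 s D = cum3 s' D'" and c4: "cum4 L s D = cum4 L s' D'"
    and c5: "cum5 L s D = cum5 L s' D'" and c6: "cum6 L s D = cum6 L s' D'"
  shows "s = s' \<and> D = D'"
proof -
  define w where "w = s * D"
  have w': "w = s' * D'" using c3 by (simp add: w_def cum3_def)
  have Lp: "L^2 > 0" using L by simp
  define K where "K = (L^2 + 3) / 18"
  have K: "K > 0" using Lp by (simp add: K_def add_pos_pos)
  show ?thesis
  proof (cases "w = 0")
    case True
    consider "s = 0" "s' = 0" | "D = 0" "s' = 0" | "s = 0" "D' = 0" | "D = 0" "D' = 0"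
      using True w' by (auto simp: w_def)
    thus ?thesis
    proof cases
      case 1
      have "D^3 = D'^3" using c6 L by (simp add: cum6_def 1)
      hence "D = D'" using odd_real_root_power_cancel[of 3] by (metis odd_numeral)
      thus ?thesis using 1 by simp
    next
      case 2
      have "D'^2 / 8 + (L^2 + 3) * s^4 / 144 = 0" using c4 by (simp add: cum4_def 2 field_simps)
      moreover have "D'^2 / 8 \<ge> 0" "(L^2 + 3) * s^4 / 144 \<ge> 0" by simp_all
      ultimately have "D'^2 / 8 = 0" "(L^2 + 3) * s^4 / 144 = 0" by linarith+
      thus ?thesis using 2 Lp by simp
    next
      case 3
      have "D^2 / 8 + (L^2 + 3) * s'^4 / 144 = 0" using c4 by (simp add: cum4_def 3 field_simps)
      moreover have "D^2 / 8 \<ge> 0" "(L^2 + 3) * s'^4 / 144 \<ge> 0" by simp_all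
      ultimately have "D^2 / 8 = 0" "(L^2 + 3) * s'^4 / 144 = 0" by linarith+
      thus ?thesis using 3 Lp by simp
    next
      case 4
      have "1 + L^2 \<noteq> 0" using Lp by linarith
      hence "s^5 = s'^5" using c5 L by (simp add: cum5_def 4)
      hence "s = s'" using odd_real_root_power_cancel[of 5] by (metis odd_numeral)
      thus ?thesis using 4 by simp
    qed
  next
    case False
    hence nz: "s \<noteq> 0" "s' \<noteq> 0" using w' by (auto simp: w_def)
    have D: "D = w / s" "D' = w / s'"
      using nz by (simp add: w_def, simp add: w')
    show ?thesis
    proof (cases "s = s'")
      case True
      thus ?thesis using D by simp
    next
      case ne: False
      \<comment> \<open>Divided by \<open>s - s'\<close>, the differences of cumulants are symmetric in \<open>s\<close>, \<open>s'\<close>.\<close>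
      define a b where "a = s + s'" and "b = s * s'"
      have bnz: "b \<noteq> 0" using nz by (simp add: b_def)
      have "cum4 L s D - cum4 L s' D' = (s - s') * (- (w^2) * a / b^2 + 4/3 * L * w - K * a * (a^2 - 2 * b)) / 8"
        unfolding D cum4_def a_def b_def K_def using nz
        by (simp add: field_simps power_numeral_reduce)
      hence E4: "- (w^2) * a / b^2 + 4/3 * L * w - K * a * (a^2 - 2 * b) = 0"
        using c4 ne by simp
      have "cum5 L s D - cum5 L s' D' = (s - s') * (- L * w^2 / (8 * b) - (1 - L^2) * a * w / 24
          - L * (1 + L^2) * (a^4 - 3 * a^2 * b + b^2) / 360)"
        unfolding D cum5_def a_def b_def using nz
        by (simp add: field_simps power_numeral_reduce)
      hence E5: "- L * w^2 / (8 * b) - (1 - L^2) * a * w / 24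
          - L * (1 + L^2) * (a^4 - 3 * a^2 * b + b^2) / 360 = 0"
        using c5 ne by simp
      have "cum6 L s D - cum6 L s' D' = (s - s') * (a^2 - b) * (- L * w^3 / (48 * b^3)
          + L * (L^2 - 3) * w / 144 + (9 - 5 * L^4) * (a^3 - 3 * a * b) / 6480)"
        unfolding D cum6_def a_def b_def using nz
        by (simp add: field_simps power_numeral_reduce)
      hence E6': "(a^2 - b) * (- L * w^3 / (48 * b^3)
          + L * (L^2 - 3) * w / 144 + (9 - 5 * L^4) * (a^3 - 3 * a * b) / 6480) = 0"
        using c6 ne by simp
      show ?thesis
      proof (cases "b > 0")
        case True
        have a: "a^2 \<ge> 4 * b" "a \<noteq> 0"
        proof -
          have "a^2 - 4 * b = (s - s')^2" by (simp add: a_def b_def power2_eq_square algebra_simps)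
          thus "a^2 \<ge> 4 * b" by (metis diff_ge_0_iff_ge zero_le_power2)
          thus "a \<noteq> 0" using True by auto
        qed
        have "(w * a)^2 - 4/3 * L * b^2 * (w * a) + K * b^2 * (a^2 * (a^2 - 2 * b))
            = - (a * b^2 * (- (w^2) * a / b^2 + 4/3 * L * w - K * a * (a^2 - 2 * b)))"
          using bnz by (simp add: field_simps power2_eq_square)
        hence "(w * a)^2 - 4/3 * L * b^2 * (w * a) + K * b^2 * (a^2 * (a^2 - 2 * b)) = 0"
          using E4 by simp
        moreover have "K * b^2 * (a^2 * (a^2 - 2 * b)) \<ge> K * b^2 * ((4 * b) * (2 * b))"
          using K True a by (intro mult_left_mono mult_mono) auto
        moreover have "K * b^2 * ((4 * b) * (2 * b)) = 4/9 * L^2 * b^4 + 4/3 * b^4"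
          by (simp add: K_def field_simps power_numeral_reduce)
        moreover have "(w * a - 2/3 * L * b^2)^2 = (w * a)^2 - 4/3 * L * b^2 * (w * a) + 4/9 * L^2 * b^4"
          by (simp add: field_simps power_numeral_reduce)
        moreover have "(w * a - 2/3 * L * b^2)^2 \<ge> 0" by simp
        moreover have "b^4 > 0" using True by simp
        ultimately have False by linarith
        thus ?thesis ..
      next
        case bneg: False
        define B where "B = - b"
        have B: "B > 0" "b = - B" using bneg bnz by (auto simp: B_def)
        have E6: "L * w^3 / (48 * B^3)
          + L * (L^2 - 3) * w / 144 + (9 - 5 * L^4) * (a^3 + 3 * a * B) / 6480 = 0"
        proof -
          have "a^2 - b \<noteq> 0" using B by (smt (verit) zero_le_power2)
          thus ?thesis using E6' B by simp
        qed
        \<comment> \<open>The scaling \<open>s \<mapsto> t s\<close>, \<open>w \<mapsto> t\<^sup>3 w\<close> leaves \<open>k\<close>, \<open>P\<close> and \<open>Q\<close> unchanged.\<close>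
        define k P where "k = a * B / (L * w)" and "P = w^2 / B^3"
        define Q where "Q = k^2 * L^2 * P"
        have a: "a = k * L * w / B" using B L False by (simp add: k_def)
        have Q: "Q = a^2 / B" using B L False unfolding Q_def k_def P_def
          by (simp add: field_simps power_numeral_reduce)
        have P: "P > 0" using False B by (simp add: P_def)
        have Q0: "Q \<ge> 0" using Q B by simp
        have e4: "k * (P + K * (Q + 2)) = 4/3"
        proof -
          have "(- (w^2) * a / b^2 + 4/3 * L * w - K * a * (a^2 - 2 * b)) / (L * w) =
              4/3 - k * (P + K * (Q + 2))"
            unfolding Q k_def P_def B(2) using B(1) L False
            by (simp add: field_simps power_numeral_reduce)
          thus ?thesis using E4 by simp
        qed
        have kpos: "k > 0"
        proof (rule ccontr)
          assume "\<not> k > 0"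
          hence "k * (P + K * (Q + 2)) \<le> 0"
            using P K Q0 by (intro mult_nonpos_nonneg) auto
          thus False using e4 by simp
        qed
        have e5: "45 * P = 15 * (1 - L^2) * (k * P) + (1 + L^2) * (Q^2 + 3 * Q + 1)"
        proof -
          have "(- L * w^2 / (8 * b) - (1 - L^2) * a * w / 24
            - L * (1 + L^2) * (a^4 - 3 * a^2 * b + b^2) / 360) * 360 / (L * B^2)
            = 45 * P - 15 * (1 - L^2) * (k * P) - (1 + L^2) * (Q^2 + 3 * Q + 1)"
            unfolding Q k_def P_def B(2) using B(1) L False
            by (simp add: field_simps power_numeral_reduce)
          thus ?thesis using E5 by simp
        qed
        have e6: "135 * P + (9 - 5 * (L^2)^2) * (Q + 3) * k = 45 * (3 - L^2)"
        proof -
          have "(L * w^3 / (48 * B^3)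
              + L * (L^2 - 3) * w / 144 + (9 - 5 * L^4) * (a^3 + 3 * a * B) / 6480) * 6480 / (L * w)
            = 135 * P + (9 - 5 * (L^2)^2) * (Q + 3) * k - 45 * (3 - L^2)"
            unfolding Q k_def P_def using B(1) L False
            by (simp add: field_simps power_numeral_reduce)
          thus ?thesis using E6 by simp
        qed
        have False
        proof (rule cumulant_system_infeasible[OF kpos P Lp L(2) Q_def _ e5 e6])
          show "k * (18 * P + (L\<^sup>2 + 3) * (Q + 2)) = 24"
            using e4 by (simp add: K_def field_simps)
        qed
        thus ?thesis ..
      qed
    qed
  qed
qed

lemma moments_inj:
  assumes p: "0 < p" "p < 1 / 2"
    and eq: "\<And>l. l \<in> {2..6} \<Longrightarrow> mix_coeff p l \<eta> = mix_coeff p l \<eta>'"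
  shows "\<eta> = \<eta>'"
proof -
  obtain \<theta> v1 v2 \<theta>' v1' v2' where e: "\<eta> = (\<theta>, v1, v2)" "\<eta>' = (\<theta>', v1', v2')"
    by (metis prod.exhaust)
  define L where "L = 2 * p - 1"
  define s D where "s = (\<lambda>\<theta>. \<theta> / (1 - p))" and "D = (\<lambda>(\<theta>, v1, v2). v2 - v1 + L * s \<theta> ^ 2 / 3)"
  have L: "L \<noteq> 0" "L^2 < 1"
    using p by (auto simp: L_def abs_square_less_1)
  have pq: "p * (1 - p) \<noteq> 0" using p by simp
  have p1: "p < 1" using p by simp
  have sD: "x / (1 - p) = s x" "v - u + L * (s x)^2 / 3 = D (x, u, v)" for x u v
    by (simp_all add: s_def D_def)
  note c = mix_cumulants[OF p(1) p1, folded L_def, unfolded prod.case sD]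
  have E: "mix_coeff p l (\<theta>, v1, v2) = mix_coeff p l (\<theta>', v1', v2')" if "l \<in> {2..6}" for l
    using eq[OF that] by (simp add: e)
  have "s \<theta> = s \<theta>' \<and> D (\<theta>, v1, v2) = D (\<theta>', v1', v2')"
  proof (rule cumulants_inj[OF L])
    show "cum3 (s \<theta>) (D (\<theta>, v1, v2)) = cum3 (s \<theta>') (D (\<theta>', v1', v2'))"
      using E[of 3] pq unfolding c by simp
    have "p * (1 - p) * cum4 L (s \<theta>) (D (\<theta>, v1, v2)) = p * (1 - p) * cum4 L (s \<theta>') (D (\<theta>', v1', v2'))"
      using E[of 2] E[of 4] by (simp flip: c(4))
    thus "cum4 L (s \<theta>) (D (\<theta>, v1, v2)) = cum4 L (s \<theta>') (D (\<theta>', v1', v2'))"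
      using pq by simp
    have "p * (1 - p) * cum5 L (s \<theta>) (D (\<theta>, v1, v2)) = p * (1 - p) * cum5 L (s \<theta>') (D (\<theta>', v1', v2'))"
      using E[of 2] E[of 3] E[of 5] by (simp flip: c(5))
    thus "cum5 L (s \<theta>) (D (\<theta>, v1, v2)) = cum5 L (s \<theta>') (D (\<theta>', v1', v2'))"
      using pq by simp
    have "p * (1 - p) * cum6 L (s \<theta>) (D (\<theta>, v1, v2)) = p * (1 - p) * cum6 L (s \<theta>') (D (\<theta>', v1', v2'))"
      using E[of 2] E[of 3] E[of 4] E[of 6] by (simp flip: c(6))
    thus "cum6 L (s \<theta>) (D (\<theta>, v1, v2)) = cum6 L (s \<theta>') (D (\<theta>', v1', v2'))"
      using pq by simp
  qed
  hence th: "\<theta> = \<theta>'" and d: "v2 - v1 = v2' - v1'"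
    using p by (auto simp: s_def D_def)
  moreover have "v1 = v1'"
    using E[of 2] by (simp add: c(2) th d)
  ultimately show ?thesis by (simp add: e)
qed

text \<open>
  For \<open>r \<le> 5\<close> the solution compares \<open>\<theta> = 0\<close>, \<open>(v\<^sub>1, v\<^sub>2) = (0, 1)\<close> with \<open>\<theta> = 0\<close>,
  \<open>(v\<^sub>1, v\<^sub>2) = (2 (1 - p), 2 (1 - p) - 1)\<close>: equal mean variance and opposite variance differences.
\<close>
lemma r_asym_eq_6:
  assumes p: "0 < p" "p < 1 / 2"
  shows "r_asym p = 6"
  unfolding r_asym_def
proof (rule Least_equality)
  have p1: "p < 1" using p by simp
  show "1 \<le> (6::nat) \<and> \<not> (\<exists>x1 x2 y1 y2 y3. asym_nontrivial_solution p 6 x1 x2 y1 y2 y3)"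
  proof (safe, goal_cases)
    case (2 x1 x2 y1 y2 y3)
    hence "mix_coeff p l (x2 - x1, y1, y2 + y3) = mix_coeff p l (x2, 0, y3)" if "l \<in> {2..6}" for l
      using that asym_system_iff_moments[OF p(1) p1, of 6 x1 x2 y1 y2 y3]
      by (auto simp: asym_nontrivial_solution_def)
    hence "(x2 - x1, y1, y2 + y3) = (x2, 0, y3)" by (rule moments_inj[OF p])
    with 2 show False by (auto simp: asym_nontrivial_solution_def)
  qed simp
  fix r :: nat
  assume r: "1 \<le> r \<and> \<not> (\<exists>x1 x2 y1 y2 y3. asym_nontrivial_solution p r x1 x2 y1 y2 y3)"
  show "6 \<le> r"
  proof (rule ccontr)
    assume "\<not> 6 \<le> r"
    hence r5: "r \<le> 5" by simp
    have "\<forall>l\<in>{1..r}. mix_coeff p l (0 - 0, 2 * (1 - p), (2 * (1 - p) - 2) + 1) = mix_coeff p l (0, 0, 1)"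
    proof
      fix l assume "l \<in> {1..r}"
      hence "l = 1 \<or> l = 2 \<or> l = 3 \<or> l = 4 \<or> l = 5" using r5 by auto
      thus "mix_coeff p l (0 - 0, 2 * (1 - p), (2 * (1 - p) - 2) + 1) = mix_coeff p l (0, 0, 1)"
        by (elim disjE; hypsubst)
          (simp_all add: mix_egf_def gauss_egf_nths gauss_egf_nths[unfolded One_nat_def]
             field_simps power2_eq_square)
    qed
    hence "asym_nontrivial_solution p r 0 0 (2 * (1 - p)) (2 * (1 - p) - 2) 1"
      using asym_system_iff_moments[OF p(1) p1, of r 0 0 "2 * (1 - p)" "2 * (1 - p) - 2" 1] p
      by (auto simp: asym_nontrivial_solution_def)
    with r show False by blast
  qed
qed

section \<open>Differences of moments dominate the loss\<close>

definition cum_gap :: "real \<Rightarrow> real \<Rightarrow> real \<Rightarrow> real \<Rightarrow> real \<Rightarrow> real" where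
  "cum_gap L s D s' D' = \<bar>cum3 s D - cum3 s' D'\<bar> + \<bar>cum4 L s D - cum4 L s' D'\<bar>
     + \<bar>cum5 L s D - cum5 L s' D'\<bar> + \<bar>cum6 L s D - cum6 L s' D'\<bar>"

text \<open>
  The determinant of the linear system solved in \<open>cum_det_cramer\<close>.
\<close>
definition cum_det :: "real \<Rightarrow> real \<Rightarrow> real \<Rightarrow> real \<Rightarrow> real \<Rightarrow> real" where
  "cum_det L s D s' D' = (D + D')^2 / 2 + L * (D + D') * (s^2 + s'^2 - (s + s')^2) / 3
     + (L^2 + 3) / 36 * (s + s')^2 * (s^2 + s'^2)"

text \<open>
  On the diagonal the determinant is, up to a constant factor, the Jacobian of \<open>(cum3, cum4)\<close>, and it
  is a positive definite quadratic form in \<open>D\<close> and \<open>s\<^sup>2\<close>.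
\<close>
lemma cum_det_diag_pos:
  assumes "s \<noteq> 0 \<or> D \<noteq> 0"
  shows "cum_det L s D s D > 0"
proof -
  have "cum_det L s D s D = 2 * (D - L * s^2 / 3)^2 + 2/3 * s^4"
    by (simp add: cum_det_def field_simps power_numeral_reduce)
  also have "\<dots> > 0"
  proof (cases "s = 0")
    case True
    thus ?thesis using assms by simp
  next
    case False
    have "2 * (D - L * s^2 / 3)^2 \<ge> 0" by simp
    moreover have "2/3 * s^4 > 0" using False by simp
    ultimately show ?thesis by linarith
  qed
  finally show ?thesis .
qed

text \<open>
  Factoring the differences of the polynomials \<open>cum3\<close> and \<open>cum4\<close> at two points gives expressions
  linear in \<open>s - s'\<close> and \<open>D - D'\<close>, with coefficients that are polynomials in both points. This is
  Cramer's rule for these two equations; unlike the inverse function theorem it is valid for points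
  that are far apart.
\<close>
lemma cum_det_cramer:
  fixes s D s' D' L :: real
  defines "T \<equiv> D + D'" and "a \<equiv> s + s'" and "Q \<equiv> s^2 + s'^2"
  defines "e3 \<equiv> 2 * (cum3 s D - cum3 s' D')" and "e4 \<equiv> 8 * (cum4 L s D - cum4 L s' D')"
  shows "cum_det L s D s' D' * (D - D') = (T / 2) * e4 - (2/3 * L * T * a - (L^2 + 3) / 18 * Q * a) * e3"
    "cum_det L s D s' D' * (s - s') = (T + 2/3 * L * Q) * e3 - (a / 2) * e4"
  unfolding cum_det_def T_def a_def Q_def e3_def e4_def cum3_def cum4_def
  by (simp_all add: field_simps power_numeral_reduce)

text \<open>
  The sum of \<open>cum_gap\<close> and of the absolute value of \<open>cum_det\<close> has no zero on the weighted sphere: if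
  the gap vanishes, the points coincide by injectivity, and then the determinant is positive. By
  compactness the sum is at least some \<open>c > 0\<close>. By Cramer's rule the determinant times the distance
  of the two points is at most a constant times the gap, and so is the gap times that distance,
  which is bounded. Adding both gives the claim.
\<close>
lemma cum_gap_sphere:
  fixes L :: real
  assumes L: "L \<noteq> 0" "L^2 < 1"
  shows "\<exists>c>0. \<forall>s D s' D'. s^2 + \<bar>D\<bar> + s'^2 + \<bar>D'\<bar> = 1 \<longrightarrow>
     c * (\<bar>s - s'\<bar> + \<bar>D - D'\<bar>) \<le> cum_gap L s D s' D'"
proof -
  define S where "S = {z::real \<times> real \<times> real \<times> real. (fst z)^2 + \<bar>fst (snd z)\<bar> + (fst (snd (snd z)))^2 + \<bar>snd (snd (snd z))\<bar> = 1}"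
  define F where "F = (\<lambda>z::real \<times> real \<times> real \<times> real.
     cum_gap L (fst z) (fst (snd z)) (fst (snd (snd z))) (snd (snd (snd z)))
     + \<bar>cum_det L (fst z) (fst (snd z)) (fst (snd (snd z))) (snd (snd (snd z)))\<bar>)"
  have "closed S"
    unfolding S_def by (intro closed_Collect_eq continuous_intros)
  moreover have "S \<subseteq> {-1..1} \<times> {-1..1} \<times> {-1..1} \<times> {-1..1}"
  proof
    fix z assume z: "z \<in> S"
    obtain s D s' D' where e: "z = (s, D, s', D')" by (metis prod.exhaust)
    have "s^2 + \<bar>D\<bar> + s'^2 + \<bar>D'\<bar> = 1" using z by (simp add: S_def e)
    moreover have "s^2 \<ge> 0" "s'^2 \<ge> 0" by simp_all
    ultimately have "s^2 \<le> 1" "s'^2 \<le> 1" "\<bar>D\<bar> \<le> 1" "\<bar>D'\<bar> \<le> 1" by linarith+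
    thus "z \<in> {-1..1} \<times> {-1..1} \<times> {-1..1} \<times> {-1..1}"
      by (auto simp: e abs_square_le_1 abs_le_iff)
  qed
  hence "bounded S"
    by (rule bounded_subset[rotated]) (intro bounded_Times bounded_closed_interval)
  ultimately have "compact S" by (simp add: compact_eq_bounded_closed)
  moreover have "(1, 0, 0, 0) \<in> S" by (simp add: S_def)
  hence "S \<noteq> {}" by blast
  moreover have "continuous_on S F"
    unfolding F_def cum_gap_def cum_det_def cum3_def cum4_def cum5_def cum6_def
    by (intro continuous_intros) auto
  ultimately obtain z0 where z0: "z0 \<in> S" "\<And>z. z \<in> S \<Longrightarrow> F z0 \<le> F z"
    using continuous_attains_inf by metis
  have Fpos: "F z > 0" if z: "z \<in> S" for z
  proof -
    obtain s D s' D' where e: "z = (s, D, s', D')" by (metis prod.exhaust)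
    show ?thesis
    proof (cases "cum_gap L s D s' D' = 0")
      case True
      hence "cum3 s D = cum3 s' D' \<and> cum4 L s D = cum4 L s' D' \<and> cum5 L s D = cum5 L s' D' \<and>
          cum6 L s D = cum6 L s' D'"
        unfolding cum_gap_def by (smt (verit))
      hence "s = s'" "D = D'" using cumulants_inj[OF L] by blast+
      moreover from this z have "s \<noteq> 0 \<or> D \<noteq> 0" by (auto simp: S_def e)
      ultimately show ?thesis using cum_det_diag_pos[of s D L] True by (simp add: F_def e)
    next
      case False
      hence "cum_gap L s D s' D' > 0" by (simp add: cum_gap_def less_le)
      thus ?thesis by (simp add: F_def e)
    qed
  qed
  define c0 where "c0 = F z0"
  have c0: "c0 > 0" using Fpos z0 by (simp add: c0_def)
  show ?thesis
  proof (intro exI[of _ "c0 / 64"] conjI allI impI)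
    show "c0 / 64 > 0" using c0 by simp
    fix s D s' D' :: real
    assume n: "s^2 + \<bar>D\<bar> + s'^2 + \<bar>D'\<bar> = 1"
    hence "(s, D, s', D') \<in> S" by (simp add: S_def)
    hence F: "c0 \<le> cum_gap L s D s' D' + \<bar>cum_det L s D s' D'\<bar>"
      using z0(2) by (force simp: c0_def F_def)
    have sq: "s^2 \<ge> 0" "s'^2 \<ge> 0" by simp_all
    hence "s^2 \<le> 1" "s'^2 \<le> 1" and DD: "\<bar>D\<bar> \<le> 1" "\<bar>D'\<bar> \<le> 1" using n by linarith+
    hence ss: "\<bar>s\<bar> \<le> 1" "\<bar>s'\<bar> \<le> 1" by (simp_all add: abs_square_le_1)
    define N R where "N = cum_gap L s D s' D'" and "R = \<bar>s - s'\<bar> + \<bar>D - D'\<bar>"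
    define T a Q e3 e4 where "T = D + D'" and "a = s + s'" and "Q = s^2 + s'^2"
      and "e3 = 2 * (cum3 s D - cum3 s' D')" and "e4 = 8 * (cum4 L s D - cum4 L s' D')"
    note cr = cum_det_cramer[of L s D s' D', folded T_def a_def Q_def e3_def e4_def]
    have b: "\<bar>T\<bar> \<le> 1" "\<bar>a\<bar> \<le> 2" "\<bar>Q\<bar> \<le> 1" "\<bar>L\<bar> \<le> 1"
      using n sq ss L unfolding T_def a_def Q_def abs_square_less_1 by linarith+
    have N0: "N \<ge> 0" by (simp add: N_def cum_gap_def)
    have e: "\<bar>e3\<bar> \<le> 2 * N" "\<bar>e4\<bar> \<le> 8 * N"
      unfolding e3_def e4_def N_def cum_gap_def abs_mult by simp_all
    have t1: "\<bar>T / 2\<bar> \<le> 1 / 2" using b by simp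
    have LT: "\<bar>L * T\<bar> \<le> 1" "\<bar>L * Q\<bar> \<le> 1"
      using b mult_mono[of "\<bar>L\<bar>" 1 "\<bar>T\<bar>" 1] mult_mono[of "\<bar>L\<bar>" 1 "\<bar>Q\<bar>" 1] by (simp_all add: abs_mult)
    hence "\<bar>L * T * a\<bar> \<le> 2" using b mult_mono[of "\<bar>L * T\<bar>" 1 "\<bar>a\<bar>" 2] by (simp add: abs_mult)
    moreover have "\<bar>(L^2 + 3) / 18 * Q * a\<bar> \<le> 4 / 18 * 1 * 2"
      unfolding abs_mult using b L by (intro mult_mono) (auto simp: abs_of_nonneg)
    ultimately have t2: "\<bar>2/3 * L * T * a - (L^2 + 3) / 18 * Q * a\<bar> \<le> 2"
      by (simp add: abs_le_iff field_simps)
    have t3: "\<bar>T + 2/3 * L * Q\<bar> \<le> 2" using b LT by (simp add: abs_le_iff field_simps)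
    have t4: "\<bar>a / 2\<bar> \<le> 1" using b by simp
    have "\<bar>cum_det L s D s' D'\<bar> * \<bar>D - D'\<bar> \<le> \<bar>(T / 2) * e4\<bar> + \<bar>(2/3 * L * T * a - (L^2 + 3) / 18 * Q * a) * e3\<bar>"
      unfolding abs_mult[symmetric] cr by (rule abs_triangle_ineq4)
    also have "\<dots> \<le> 1 / 2 * (8 * N) + 2 * (2 * N)"
      unfolding abs_mult[of _ e4] abs_mult[of _ e3]
      by (intro add_mono mult_mono t1 t2 e) (use N0 in auto)
    finally have d1: "\<bar>cum_det L s D s' D'\<bar> * \<bar>D - D'\<bar> \<le> 8 * N" by simp
    have "\<bar>cum_det L s D s' D'\<bar> * \<bar>s - s'\<bar> \<le> \<bar>(T + 2/3 * L * Q) * e3\<bar> + \<bar>(a / 2) * e4\<bar>"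
      unfolding abs_mult[symmetric] cr by (rule abs_triangle_ineq4)
    also have "\<dots> \<le> 2 * (2 * N) + 1 * (8 * N)"
      unfolding abs_mult[of _ e4] abs_mult[of _ e3]
      by (intro add_mono mult_mono t3 t4 e) (use N0 in auto)
    finally have d2: "\<bar>cum_det L s D s' D'\<bar> * \<bar>s - s'\<bar> \<le> 12 * N" by simp
    have R: "R \<ge> 0" "R \<le> 4" using ss DD by (auto simp: R_def)
    have "c0 * R \<le> (N + \<bar>cum_det L s D s' D'\<bar>) * R"
      using F R by (intro mult_right_mono) (auto simp: N_def)
    also have "\<dots> = N * R + \<bar>cum_det L s D s' D'\<bar> * \<bar>D - D'\<bar> + \<bar>cum_det L s D s' D'\<bar> * \<bar>s - s'\<bar>"
      by (simp add: R_def algebra_simps)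
    also have "\<dots> \<le> N * 4 + 8 * N + 12 * N"
      by (intro add_mono d1 d2 mult_left_mono R N0)
    also have "\<dots> \<le> 64 * N" using N0 by simp
    finally show "c0 / 64 * (\<bar>s - s'\<bar> + \<bar>D - D'\<bar>) \<le> cum_gap L s D s' D'"
      by (simp add: R_def N_def)
  qed
qed

lemma cum_scale:
  "cum3 (t * s) (t^2 * D) = t^3 * cum3 s D"
  "cum4 L (t * s) (t^2 * D) = t^4 * cum4 L s D"
  "cum5 L (t * s) (t^2 * D) = t^5 * cum5 L s D"
  "cum6 L (t * s) (t^2 * D) = t^6 * cum6 L s D"
  unfolding cum3_def cum4_def cum5_def cum6_def
  by (simp_all add: field_simps power_numeral_reduce)

text \<open>
  Weighted homogeneity transports the bound from the sphere. A cumulant of order \<open>k \<le> 6\<close> scales with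
  \<open>t\<^sup>k\<close>, which is at least of the order of \<open>t\<^sup>6\<close> for bounded \<open>t\<close>; on the right the powers are chosen so
  that each term has weight six.
\<close>
lemma cum_gap_lower_bound:
  fixes L M :: real
  assumes L: "L \<noteq> 0" "L^2 < 1" and M: "M \<ge> 1"
  shows "\<exists>c>0. \<forall>s D s' D'. s^2 + \<bar>D\<bar> + s'^2 + \<bar>D'\<bar> \<le> M^2 \<longrightarrow>
     c * (\<bar>s - s'\<bar>^6 + \<bar>s^2 - s'^2\<bar>^3 + \<bar>D - D'\<bar>^3) \<le> cum_gap L s D s' D'"
proof -
  obtain c where c: "c > 0" "\<And>s D s' D'. s^2 + \<bar>D\<bar> + s'^2 + \<bar>D'\<bar> = 1 \<Longrightarrow>
     c * (\<bar>s - s'\<bar> + \<bar>D - D'\<bar>) \<le> cum_gap L s D s' D'"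
    using cum_gap_sphere[OF L] by blast
  show ?thesis
  proof (intro exI[of _ "c / (64 * M^3)"] conjI allI impI)
    show "c / (64 * M^3) > 0" using c M by simp
    fix s D s' D' :: real
    assume n: "s^2 + \<bar>D\<bar> + s'^2 + \<bar>D'\<bar> \<le> M^2"
    define t where "t = sqrt (s^2 + \<bar>D\<bar> + s'^2 + \<bar>D'\<bar>)"
    have t2: "t^2 = s^2 + \<bar>D\<bar> + s'^2 + \<bar>D'\<bar>" by (simp add: t_def)
    have t0: "t \<ge> 0" by (simp add: t_def)
    have tM: "t \<le> M" using n M t0 by (simp add: t2[symmetric] power2_le_iff_abs_le)
    show "c / (64 * M^3) * (\<bar>s - s'\<bar>^6 + \<bar>s^2 - s'^2\<bar>^3 + \<bar>D - D'\<bar>^3) \<le> cum_gap L s D s' D'"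
    proof (cases "t = 0")
      case True
      have "s^2 \<ge> 0" "s'^2 \<ge> 0" by simp_all
      moreover have "s^2 + \<bar>D\<bar> + s'^2 + \<bar>D'\<bar> = 0" using t2 True by simp
      ultimately have "s^2 = 0" "s'^2 = 0" "D = 0" "D' = 0" by linarith+
      thus ?thesis by (simp add: cum_gap_def)
    next
      case False
      hence t: "t > 0" using t0 by simp
      define u E u' E' where "u = s / t" and "E = D / t^2" and "u' = s' / t" and "E' = D' / t^2"
      have e: "s = t * u" "D = t^2 * E" "s' = t * u'" "D' = t^2 * E'"
        using t by (simp_all add: u_def E_def u'_def E'_def)
      have n1: "u^2 + \<bar>E\<bar> + u'^2 + \<bar>E'\<bar> = 1"
      proof -
        have "t^2 * (u^2 + \<bar>E\<bar> + u'^2 + \<bar>E'\<bar>) = t^2 * 1"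
          using t2 by (simp add: e abs_mult power_mult_distrib algebra_simps)
        thus ?thesis using t by (metis mult_cancel_left zero_eq_power2 less_irrefl)
      qed
      have sq: "u^2 \<ge> 0" "u'^2 \<ge> 0" by simp_all
      hence "u^2 \<le> 1" "u'^2 \<le> 1" and DD: "\<bar>E\<bar> \<le> 1" "\<bar>E'\<bar> \<le> 1" using n1 by linarith+
      hence ss: "\<bar>u\<bar> \<le> 1" "\<bar>u'\<bar> \<le> 1" by (simp_all add: abs_square_le_1)
      define X Y where "X = \<bar>u - u'\<bar>" and "Y = \<bar>E - E'\<bar>"
      have XY: "0 \<le> X" "X \<le> 2" "0 \<le> Y" "Y \<le> 2" using ss DD by (auto simp: X_def Y_def)
      have X6: "X^6 \<le> 2^5 * X"
        using mult_right_mono[OF power_mono[of X 2 5], of X] XY by (simp add: eval_nat_numeral)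
      have Y3: "Y^3 \<le> 2^2 * Y"
        using mult_right_mono[OF power_mono[of Y 2 2], of Y] XY by (simp add: eval_nat_numeral)
      have Z3: "\<bar>u^2 - u'^2\<bar>^3 \<le> 8 * 4 * X"
      proof -
        have "\<bar>u^2 - u'^2\<bar> = \<bar>u + u'\<bar> * X"
          by (simp add: X_def power2_eq_square algebra_simps flip: abs_mult)
        also have "\<dots> \<le> 2 * X" using ss XY by (intro mult_right_mono) auto
        finally have "\<bar>u^2 - u'^2\<bar>^3 \<le> (2 * X)^3" by (intro power_mono) auto
        also have "\<dots> = 8 * X^3" by (simp add: power_mult_distrib)
        also have "X^3 \<le> 2^2 * X"
          using mult_right_mono[OF power_mono[of X 2 2], of X] XY by (simp add: eval_nat_numeral)
        finally show ?thesis by simp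
      qed
      have R: "\<bar>s - s'\<bar>^6 + \<bar>s^2 - s'^2\<bar>^3 + \<bar>D - D'\<bar>^3 = t^6 * (X^6 + \<bar>u^2 - u'^2\<bar>^3 + Y^3)"
      proof -
        have "\<bar>s - s'\<bar> = t * X" using t by (simp add: e X_def abs_mult flip: right_diff_distrib)
        moreover have "\<bar>s^2 - s'^2\<bar> = t^2 * \<bar>u^2 - u'^2\<bar>"
          using t by (simp add: e abs_mult power_mult_distrib flip: right_diff_distrib)
        moreover have "\<bar>D - D'\<bar> = t^2 * Y" by (simp add: e Y_def abs_mult flip: right_diff_distrib)
        ultimately show ?thesis
          by (simp add: power_mult_distrib algebra_simps flip: power_mult)
      qed
      have "c * (X^6 + \<bar>u^2 - u'^2\<bar>^3 + Y^3) \<le> c * (64 * (X + Y))"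
        using X6 Y3 Z3 XY c by (intro mult_left_mono) auto
      also have "\<dots> \<le> 64 * cum_gap L u E u' E'"
        using c(2)[OF n1] unfolding X_def Y_def by (simp only: mult.left_commute[of c 64])
      finally have "t^6 * (c * (X^6 + \<bar>u^2 - u'^2\<bar>^3 + Y^3)) \<le> t^6 * (64 * cum_gap L u E u' E')"
        using t by (intro mult_left_mono) auto
      also have "\<dots> = 64 * (t^6 * cum_gap L u E u' E')" by simp
      also have "t^6 * cum_gap L u E u' E' \<le> M^3 * cum_gap L s D s' D'"
      proof -
        have g: "t^6 * x \<le> M^3 * (t^k * x)" if "3 \<le> k" "k \<le> 6" "x \<ge> 0" for k :: nat and x :: real
        proof -
          have "t^6 = t^(6 - k) * t^k" using that by (simp flip: power_add)
          also have "\<dots> \<le> M^(6 - k) * t^k" using tM t by (intro mult_right_mono power_mono) auto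
          also have "\<dots> \<le> M^3 * t^k" using that M t by (intro mult_right_mono power_increasing) auto
          finally show ?thesis using that mult_right_mono[of "t^6" "M^3 * t^k" x] by simp
        qed
        have "cum_gap L s D s' D' = t^3 * \<bar>cum3 u E - cum3 u' E'\<bar> + t^4 * \<bar>cum4 L u E - cum4 L u' E'\<bar>
             + t^5 * \<bar>cum5 L u E - cum5 L u' E'\<bar> + t^6 * \<bar>cum6 L u E - cum6 L u' E'\<bar>"
          using t by (simp add: cum_gap_def e cum_scale abs_mult flip: right_diff_distrib)
        thus ?thesis
          unfolding cum_gap_def[of L u] distrib_left
          by (simp only: distrib_left) (intro add_mono g; simp)
      qed
      finally show ?thesis unfolding R using M by (simp add: field_simps)
    qed
  qed
qed

text \<open>
  The sixth power of the loss.
\<close>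
definition psi6 :: "param \<Rightarrow> param \<Rightarrow> real" where
  "psi6 = (\<lambda>(\<theta>, v1, v2) (\<theta>', v1', v2'). \<bar>\<theta> - \<theta>'\<bar>^6 + \<bar>v1 - v1'\<bar>^3 + \<bar>v2 - v2'\<bar>^3)"

lemma psi6_nonneg: "psi6 \<eta> \<eta>' \<ge> 0"
  by (auto simp: psi6_def split: prod.splits)

lemma psi_loss_6: "psi_loss 6 \<eta> \<eta>' = psi6 \<eta> \<eta>' powr (1 / 6)"
  by (auto simp: psi_loss_def psi6_def split: prod.splits)

lemma continuous_mix_coeff: "continuous_on UNIV (mix_coeff p l)"
  unfolding mix_egf_def split_def
  by (simp add: gauss_egf_nth_weighted_pairs split_def) (intro continuous_intros; simp)

lemma cube_sum3_le:
  fixes x y z :: real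
  assumes "x \<ge> 0" "y \<ge> 0" "z \<ge> 0"
  shows "(x + y + z)^3 \<le> 9 * (x^3 + y^3 + z^3)"
proof -
  have am: "3 * (x * y * z) \<le> x^3 + y^3 + z^3"
  proof -
    have "x^3 + y^3 + z^3 - 3 * (x * y * z) = (x + y + z) * ((x - y)^2 + (y - z)^2 + (z - x)^2) / 2"
      by (simp add: field_simps power2_eq_square power3_eq_cube)
    also have "\<dots> \<ge> 0" using assms by simp
    finally show ?thesis by simp
  qed
  have "9 * (x^3 + y^3 + z^3) - (x + y + z)^3
     = 3 * ((x + y) * (x - y)^2 + (y + z) * (y - z)^2 + (z + x) * (z - x)^2)
       + 2 * (x^3 + y^3 + z^3 - 3 * (x * y * z))"
    by (simp add: field_simps power2_eq_square power3_eq_cube)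
  also have "\<dots> \<ge> 0"
    using assms am by (intro add_nonneg_nonneg mult_nonneg_nonneg) auto
  finally show ?thesis by simp
qed

lemma abs_diff_mult_le:
  fixes x y :: real
  assumes "\<bar>x\<bar> \<le> K" "\<bar>y'\<bar> \<le> K'" "\<bar>x - x'\<bar> \<le> G" "\<bar>y - y'\<bar> \<le> H"
  shows "\<bar>x * y - x' * y'\<bar> \<le> K * H + K' * G"
proof -
  have "x * y - x' * y' = x * (y - y') + y' * (x - x')" by (simp add: algebra_simps)
  hence "\<bar>x * y - x' * y'\<bar> \<le> \<bar>x\<bar> * \<bar>y - y'\<bar> + \<bar>y'\<bar> * \<bar>x - x'\<bar>"
    by (metis abs_mult abs_triangle_ineq)
  also have "\<dots> \<le> K * H + K' * G" using assms by (intro add_mono mult_mono) auto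
  finally show ?thesis .
qed

text \<open>
  Cumulants are polynomials in the moments, so on a bounded set their differences are bounded by
  those of the moments. It remains to pass from \<open>(s, D)\<close> and the second moment to the parameters: the
  variances are linear in the second moment, \<open>s\<^sup>2\<close> and \<open>D\<close>, which is the reason why the preceding
  bound keeps track of \<open>s\<^sup>2 - s'\<^sup>2\<close>.
\<close>
lemma moment_gap_lower_bound:
  fixes p B :: real
  assumes p: "0 < p" "p < 1 / 2"
  shows "\<exists>c>0. \<forall>\<eta> \<eta>'. \<eta> \<in> {-B..B} \<times> {-B..B} \<times> {-B..B} \<longrightarrow> \<eta>' \<in> {-B..B} \<times> {-B..B} \<times> {-B..B} \<longrightarrow>
     c * psi6 \<eta> \<eta>' \<le> (\<Sum>l\<in>{2..6}. \<bar>mix_coeff p l \<eta> - mix_coeff p l \<eta>'\<bar>)"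
proof -
  define X where "X = {-B..B} \<times> {-B..B} \<times> {-B..B}"
  define L where "L = 2 * p - 1"
  define q where "q = 1 - p"
  have q: "0 < q" "q < 1" "p < 1" using p by (auto simp: q_def)
  have L: "L \<noteq> 0" "L^2 < 1" "\<bar>L\<bar> \<le> 1"
    using p by (auto simp: L_def abs_square_less_1)
  define M where "M = sqrt (1 + 4 * (\<bar>B\<bar> / q)^2 + 4 * \<bar>B\<bar>)"
  have M: "M \<ge> 1" "M^2 = 1 + 4 * (\<bar>B\<bar> / q)^2 + 4 * \<bar>B\<bar>"
    by (auto simp: M_def)
  obtain c where c: "c > 0" "\<And>s D s' D'. s^2 + \<bar>D\<bar> + s'^2 + \<bar>D'\<bar> \<le> M^2 \<Longrightarrow>
     c * (\<bar>s - s'\<bar>^6 + \<bar>s^2 - s'^2\<bar>^3 + \<bar>D - D'\<bar>^3) \<le> cum_gap L s D s' D'"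
    using cum_gap_lower_bound[OF L(1,2) M(1)] by blast
  have "\<exists>K\<ge>1. \<forall>l\<in>{2..6}. \<forall>\<eta>\<in>X. \<bar>mix_coeff p l \<eta>\<bar> \<le> K"
  proof -
    have "compact ((\<lambda>\<eta>. mix_coeff p l \<eta>) ` X)" for l
      unfolding X_def
      by (intro compact_continuous_image continuous_on_subset[OF continuous_mix_coeff] compact_Times) auto
    hence "bounded (\<Union>l\<in>{2..6::nat}. (\<lambda>\<eta>. mix_coeff p l \<eta>) ` X)"
      by (intro bounded_UN) (auto intro: compact_imp_bounded)
    then obtain K where K: "\<And>l \<eta>. l \<in> {2..6} \<Longrightarrow> \<eta> \<in> X \<Longrightarrow> \<bar>mix_coeff p l \<eta>\<bar> \<le> K"
      unfolding bounded_iff by (metis (no_types, lifting) UN_I imageI real_norm_def)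
    show ?thesis
      by (intro exI[of _ "max 1 K"]) (auto intro: le_max_iff_disj[THEN iffD2] K)
  qed
  then obtain K where K1: "K \<ge> 1" and K: "\<And>l \<eta>. l \<in> {2..6} \<Longrightarrow> \<eta> \<in> X \<Longrightarrow> \<bar>mix_coeff p l \<eta>\<bar> \<le> K"
    by blast
  define C where "C = 486 * (11 * K^2 / (p * q)) / c + 576 * K^2"
  have "576 * K^2 > 0" using K1 by simp
  moreover have "486 * (11 * K^2 / (p * q)) / c \<ge> 0" using p q c by simp
  ultimately have C: "C > 0" unfolding C_def by linarith
  show ?thesis
  proof (intro exI[of _ "1 / C"] conjI allI impI)
    show "1 / C > 0" using C by simp
    fix \<eta> \<eta>' assume "\<eta> \<in> {-B..B} \<times> {-B..B} \<times> {-B..B}" "\<eta>' \<in> {-B..B} \<times> {-B..B} \<times> {-B..B}"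
    hence X: "\<eta> \<in> X" "\<eta>' \<in> X" by (simp_all add: X_def)
    obtain \<theta> v1 v2 \<theta>' v1' v2' where e: "\<eta> = (\<theta>, v1, v2)" "\<eta>' = (\<theta>', v1', v2')"
      by (metis prod.exhaust)
    define s s' d d' where "s = \<theta> / q" and "s' = \<theta>' / q" and "d = v2 - v1" and "d' = v2' - v1'"
    define D D' where "D = d + L * s^2 / 3" and "D' = d' + L * s'^2 / 3"
    define m m' where "m l = mix_coeff p l \<eta>" and "m' l = mix_coeff p l \<eta>'" for l
    define G where "G = (\<Sum>l\<in>{2..6}. \<bar>m l - m' l\<bar>)"
    have G: "\<bar>m l - m' l\<bar> \<le> G" if "l \<in> {2..6}" for l
      unfolding G_def by (rule member_le_sum) (use that in auto)
    have G': "\<bar>m 2 - m' 2\<bar> \<le> G" "\<bar>m 3 - m' 3\<bar> \<le> G" "\<bar>m 4 - m' 4\<bar> \<le> G" "\<bar>m 5 - m' 5\<bar> \<le> G" "\<bar>m 6 - m' 6\<bar> \<le> G"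
      by (auto intro!: G)
    have G0: "G \<ge> 0" by (simp add: G_def sum_nonneg)
    have Km: "\<bar>m 2\<bar> \<le> K" "\<bar>m 3\<bar> \<le> K" "\<bar>m' 2\<bar> \<le> K" "\<bar>m' 3\<bar> \<le> K" "\<bar>m' 4\<bar> \<le> K"
      using K X by (auto simp: m_def m'_def)
    note cu = mix_cumulants[OF p(1) q(3), folded L_def q_def, unfolded prod.case]
    have cum: "m 2 = (v1 + q * d + p * q * s^2) / 2"
      "m 3 = p * q * cum3 s D"
      "m 4 - m 2 ^ 2 / 2 = p * q * cum4 L s D"
      "m 5 - m 2 * m 3 = p * q * cum5 L s D"
      "m 6 - m 2 * m 4 - m 3 ^ 2 / 2 + m 2 ^ 3 / 3 = p * q * cum6 L s D"
      using cu(2-6)[of \<theta> v1 v2] unfolding m_def e s_def D_def d_def by simp_all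
    have cum': "m' 2 = (v1' + q * d' + p * q * s'^2) / 2"
      "m' 3 = p * q * cum3 s' D'"
      "m' 4 - m' 2 ^ 2 / 2 = p * q * cum4 L s' D'"
      "m' 5 - m' 2 * m' 3 = p * q * cum5 L s' D'"
      "m' 6 - m' 2 * m' 4 - m' 3 ^ 2 / 2 + m' 2 ^ 3 / 3 = p * q * cum6 L s' D'"
      using cu(2-6)[of \<theta>' v1' v2'] unfolding m'_def e s'_def D'_def d'_def by simp_all
    have a22: "\<bar>m 2 * m 2 - m' 2 * m' 2\<bar> \<le> K * G + K * G"
      and a23: "\<bar>m 2 * m 3 - m' 2 * m' 3\<bar> \<le> K * G + K * G"
      and a24: "\<bar>m 2 * m 4 - m' 2 * m' 4\<bar> \<le> K * G + K * G"
      and a33: "\<bar>m 3 * m 3 - m' 3 * m' 3\<bar> \<le> K * G + K * G"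
      by (intro abs_diff_mult_le Km G'; simp)+
    have K2: "\<bar>m' 2 * m' 2\<bar> \<le> K * K"
      unfolding abs_mult using Km K1 by (intro mult_mono) auto
    have a222: "\<bar>m 2 * (m 2 * m 2) - m' 2 * (m' 2 * m' 2)\<bar> \<le> K * (K * G + K * G) + (K * K) * G"
      by (intro abs_diff_mult_le Km G' a22 K2)
    have lin: "\<bar>a - b - c / 2 + d / 3 - (a' - b' - c' / 2 + d' / 3)\<bar> \<le> e1 + e2 + e3 / 2 + e4 / 3"
      if "\<bar>a - a'\<bar> \<le> e1" "\<bar>b - b'\<bar> \<le> e2" "\<bar>c - c'\<bar> \<le> e3" "\<bar>d - d'\<bar> \<le> e4"
      for a b c d a' b' c' d' e1 e2 e3 e4 :: real
      using that unfolding abs_le_iff by (intro conjI) linarith+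
    have KG: "G \<le> K^2 * G" "K * G \<le> K^2 * G"
    proof -
      have "1 * 1 \<le> K * K" "1 * K \<le> K * K" using K1 by (intro mult_mono; simp)+
      thus "G \<le> K^2 * G" "K * G \<le> K^2 * G"
        using G0 by (auto intro!: mult_right_mono simp: power2_eq_square mult_le_cancel_right1 simp del: mult_1)
    qed
    have pq: "p * q > 0" using p q by simp
    have "p * q * cum_gap L s D s' D' = \<bar>p * q * cum3 s D - p * q * cum3 s' D'\<bar> + \<bar>p * q * cum4 L s D - p * q * cum4 L s' D'\<bar>
       + \<bar>p * q * cum5 L s D - p * q * cum5 L s' D'\<bar> + \<bar>p * q * cum6 L s D - p * q * cum6 L s' D'\<bar>"
      using p q unfolding cum_gap_def by (simp add: abs_mult distrib_left flip: right_diff_distrib)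
    also have "\<dots> \<le> G + (G + K * G) + (G + 2 * (K * G)) + (G + 2 * (K * G) + K * G + K^2 * G)"
    proof (intro add_mono)
      show "\<bar>p * q * cum3 s D - p * q * cum3 s' D'\<bar> \<le> G"
        using G'(2) by (simp only: cum(2) cum'(2))
      show "\<bar>p * q * cum4 L s D - p * q * cum4 L s' D'\<bar> \<le> G + K * G"
        unfolding cum(3)[symmetric] cum'(3)[symmetric] power2_eq_square using G'(3) a22 by linarith
      show "\<bar>p * q * cum5 L s D - p * q * cum5 L s' D'\<bar> \<le> G + 2 * (K * G)"
        unfolding cum(4)[symmetric] cum'(4)[symmetric] power2_eq_square using G'(4) a23 by linarith
      have "\<bar>p * q * cum6 L s D - p * q * cum6 L s' D'\<bar> \<le> G + (K * G + K * G) + (K * G + K * G) / 2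
          + (K * (K * G + K * G) + (K * K) * G) / 3"
        unfolding cum(5)[symmetric] cum'(5)[symmetric]
        unfolding power2_eq_square power3_eq_cube mult.assoc
        by (rule lin[OF G'(5) a24 a33 a222[unfolded mult.assoc]])
      also have "\<dots> = G + 2 * (K * G) + K * G + K^2 * G"
        by (simp add: power2_eq_square algebra_simps)
      finally show "\<bar>p * q * cum6 L s D - p * q * cum6 L s' D'\<bar> \<le> G + 2 * (K * G) + K * G + K^2 * G" .
    qed
    also have "\<dots> \<le> 11 * K^2 * G" using KG unfolding mult.assoc[of 11] by linarith
    finally have gap: "cum_gap L s D s' D' \<le> 11 * K^2 / (p * q) * G"
      using pq by (simp add: field_simps)
    have box: "s^2 + \<bar>D\<bar> + s'^2 + \<bar>D'\<bar> \<le> M^2"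
    proof -
      have sb: "t^2 \<le> (\<bar>B\<bar> / q)^2" if "t = x / q" "x \<in> {-B..B}" for t x
      proof -
        have "\<bar>t\<bar> \<le> \<bar>B\<bar> / q" using that q by (auto simp: abs_mult divide_simps abs_le_iff)
        thus ?thesis by (metis abs_ge_zero power2_abs power_mono)
      qed
      have b1: "s^2 \<le> (\<bar>B\<bar> / q)^2" "s'^2 \<le> (\<bar>B\<bar> / q)^2"
        using X by (intro sb[OF s_def] sb[OF s'_def]; simp add: X_def e)+
      have "\<bar>d\<bar> \<le> 2 * \<bar>B\<bar>" "\<bar>d'\<bar> \<le> 2 * \<bar>B\<bar>" using X by (auto simp: X_def e d_def d'_def)
      moreover have "\<bar>L * t^2 / 3\<bar> \<le> t^2" for t
      proof -
        have "\<bar>L\<bar> * t^2 \<le> 1 * t^2" using L(3) by (intro mult_right_mono) auto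
        moreover have "t^2 \<ge> 0" by simp
        ultimately have "\<bar>L\<bar> * t^2 \<le> t^2 * 3" by linarith
        thus ?thesis by (simp add: abs_mult)
      qed
      hence "\<bar>D\<bar> \<le> \<bar>d\<bar> + s^2" "\<bar>D'\<bar> \<le> \<bar>d'\<bar> + s'^2"
        unfolding D_def D'_def by (meson abs_triangle_ineq add_left_mono order_trans)+
      ultimately show ?thesis using b1 unfolding M(2) by linarith
    qed
    define u x y z where "u = \<bar>s - s'\<bar>" and "x = \<bar>s^2 - s'^2\<bar>" and "y = \<bar>D - D'\<bar>" and "z = \<bar>m 2 - m' 2\<bar>"
    have nn: "u \<ge> 0" "x \<ge> 0" "y \<ge> 0" "z \<ge> 0" by (auto simp: u_def x_def y_def z_def)
    have R: "u^6 + x^3 + y^3 \<le> 11 * K^2 / (p * q) * G / c"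
    proof -
      have "c * (u^6 + x^3 + y^3) \<le> 11 * K^2 / (p * q) * G"
        using order_trans[OF c(2)[OF box] gap] by (simp only: u_def x_def y_def)
      thus ?thesis by (intro mult_imp_le_div_pos c(1)) (subst mult.commute)
    qed
    have th: "\<bar>\<theta> - \<theta>'\<bar>^6 \<le> u^6"
    proof (rule power_mono)
      have "\<theta> - \<theta>' = q * (s - s')" using q by (simp add: s_def s'_def field_simps)
      hence "\<bar>\<theta> - \<theta>'\<bar> = q * u" using q by (simp add: abs_mult u_def)
      also have "\<dots> \<le> 1 * u" using q nn by (intro mult_right_mono) auto
      finally show "\<bar>\<theta> - \<theta>'\<bar> \<le> u" by simp
    qed auto
    have dd: "\<bar>d - d'\<bar> \<le> y + x"
    proof -
      have "d - d' = (D - D') - L * (s^2 - s'^2) / 3" by (simp add: D_def D'_def field_simps)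
      moreover have "\<bar>L * (s^2 - s'^2) / 3\<bar> \<le> x"
      proof -
        have "\<bar>L\<bar> * x \<le> 1 * x" using L(3) nn by (intro mult_right_mono) auto
        hence "\<bar>L\<bar> * x \<le> x * 3" using nn by linarith
        thus ?thesis by (simp add: abs_mult x_def)
      qed
      ultimately show ?thesis unfolding y_def by linarith
    qed
    have tri: "\<bar>2 * a - b - c\<bar> \<le> 2 * \<bar>a\<bar> + \<bar>b\<bar> + \<bar>c\<bar>" for a b c :: real
      by linarith
    have dv1: "\<bar>v1 - v1'\<bar> \<le> 2 * z + y + 2 * x"
    proof -
      have "v1 - v1' = 2 * (m 2 - m' 2) - q * (d - d') - p * q * (s^2 - s'^2)"
        unfolding cum(1) cum'(1) by (simp add: field_simps)
      hence "\<bar>v1 - v1'\<bar> \<le> 2 * \<bar>m 2 - m' 2\<bar> + \<bar>q * (d - d')\<bar> + \<bar>p * q * (s^2 - s'^2)\<bar>"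
        by (simp only: tri)
      also have "\<dots> \<le> 2 * z + 1 * (y + x) + 1 * x"
      proof (intro add_mono)
        show "\<bar>q * (d - d')\<bar> \<le> 1 * (y + x)"
          unfolding abs_mult using q dd by (intro mult_mono) auto
        show "\<bar>p * q * (s^2 - s'^2)\<bar> \<le> 1 * x"
          unfolding abs_mult[of "p * q"] x_def
          using p q by (intro mult_mono) (auto simp: abs_mult mult_le_one)
      qed (simp add: z_def)
      finally show ?thesis by simp
    qed
    have dv2: "\<bar>v2 - v2'\<bar> \<le> 2 * z + 2 * y + 3 * x"
      using dv1 dd nn unfolding d_def d'_def by linarith
    have cb: "\<bar>w\<bar>^3 \<le> 9 * (8 * z^3 + 8 * y^3 + 27 * x^3)" if "\<bar>w\<bar> \<le> 2 * z + 2 * y + 3 * x" for w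
    proof -
      have "\<bar>w\<bar>^3 \<le> (2 * z + 2 * y + 3 * x)^3" using that by (intro power_mono) auto
      also have "\<dots> \<le> 9 * ((2 * z)^3 + (2 * y)^3 + (3 * x)^3)" by (rule cube_sum3_le) (use nn in auto)
      finally show ?thesis by (simp add: power_mult_distrib)
    qed
    have z3: "z^3 \<le> 4 * K^2 * G"
    proof -
      have "z \<le> 2 * K" using Km unfolding z_def by linarith
      hence "z^2 * z \<le> (2 * K)^2 * G" using nn G'(1) by (intro mult_mono power_mono) (auto simp: z_def)
      thus ?thesis by (simp add: power2_eq_square power3_eq_cube mult_ac)
    qed
    have "psi6 \<eta> \<eta>' = \<bar>\<theta> - \<theta>'\<bar>^6 + \<bar>v1 - v1'\<bar>^3 + \<bar>v2 - v2'\<bar>^3" by (simp add: psi6_def e)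
    also have "\<dots> \<le> u^6 + 9 * (8 * z^3 + 8 * y^3 + 27 * x^3) + 9 * (8 * z^3 + 8 * y^3 + 27 * x^3)"
      using dv1 dv2 nn by (intro add_mono th cb) auto
    also have "\<dots> \<le> 486 * (u^6 + x^3 + y^3) + 144 * z^3"
    proof -
      have lin: "a + 9 * (8 * d + 8 * b + 27 * e) + 9 * (8 * d + 8 * b + 27 * e) \<le> 486 * (a + e + b) + 144 * d"
        if "a \<ge> 0" "b \<ge> 0" for a b d e :: real
        using that by simp
      show ?thesis by (rule lin) (use nn in auto)
    qed
    also have "\<dots> \<le> 486 * (11 * K^2 / (p * q) * G / c) + 144 * (4 * K^2 * G)"
      using R z3 by (intro add_mono mult_left_mono) auto
    also have "\<dots> = C * G" by (simp add: C_def algebra_simps)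
    finally show "1 / C * psi6 \<eta> \<eta>' \<le> (\<Sum>l\<in>{2..6}. \<bar>mix_coeff p l \<eta> - mix_coeff p l \<eta>'\<bar>)"
      using C unfolding G_def m_def m'_def by (simp add: pos_divide_le_eq mult.commute)
  qed
qed

section \<open>Moments, envelopes and Lipschitz bounds for the densities\<close>

lemma gauss_has_moments:
  assumes v: "v > 0"
  shows "has_bochner_integral lborel (\<lambda>x. gauss x a v * x ^ n) (fact n * fps_nth (gauss_egf a v) n)"
proof -
  define E where "E j = (if even j then (v / 2) ^ (j div 2) / fact (j div 2) else 0)" for j
  have sv: "sqrt v > 0" "(sqrt v)^2 = v" using v by simp_all
  have central: "has_bochner_integral lborel (\<lambda>x. gauss x a v * (x - a) ^ j) (fact j * E j)" for j
  proof (cases "even j")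
    case True
    then obtain k where k: "j = 2 * k" by (elim evenE)
    show ?thesis
      using normal_moment_even[OF sv(1), of a k] by (simp add: k gauss_def E_def sv(2) power_divide)
  next
    case False
    then obtain k where k: "j = 2 * k + 1" by (elim oddE)
    show ?thesis
      using normal_moment_odd[OF sv(1), of a k] by (simp add: k gauss_def E_def)
  qed
  have "has_bochner_integral lborel
     (\<lambda>x. \<Sum>i\<le>n. of_nat (n choose i) * a ^ i * (gauss x a v * (x - a) ^ (n - i)))
     (\<Sum>i\<le>n. of_nat (n choose i) * a ^ i * (fact (n - i) * E (n - i)))"
    by (intro has_bochner_integral_sum has_bochner_integral_mult_right central)
  moreover have "(\<Sum>i\<le>n. of_nat (n choose i) * a ^ i * (gauss x a v * (x - a) ^ (n - i))) = gauss x a v * x ^ n" for x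
  proof -
    have "x ^ n = (a + (x - a)) ^ n" by simp
    also have "\<dots> = (\<Sum>i\<le>n. of_nat (n choose i) * a ^ i * (x - a) ^ (n - i))" by (rule binomial_ring)
    finally show ?thesis by (simp add: sum_distrib_left mult_ac)
  qed
  moreover have "(\<Sum>i\<le>n. of_nat (n choose i) * a ^ i * (fact (n - i) * E (n - i))) = fact n * fps_nth (gauss_egf a v) n"
    unfolding gauss_egf_nth sum_distrib_left atMost_atLeast0
    by (intro sum.cong refl) (simp add: binomial_fact E_def)
  ultimately show ?thesis by simp
qed

lemma mix_has_moments:
  assumes "v1 > 0" "v2 > 0"
  shows "has_bochner_integral lborel (\<lambda>x. mix_density p x (\<theta>, v1, v2) * x ^ n) (fact n * mix_coeff p n (\<theta>, v1, v2))"
proof -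
  have "has_bochner_integral lborel
     (\<lambda>x. p * (gauss x (- \<theta>) v1 * x ^ n) + (1 - p) * (gauss x (odds p * \<theta>) v2 * x ^ n))
     (p * (fact n * fps_nth (gauss_egf (- \<theta>) v1) n) + (1 - p) * (fact n * fps_nth (gauss_egf (odds p * \<theta>) v2) n))"
    by (intro has_bochner_integral_add has_bochner_integral_mult_right gauss_has_moments assms)
  thus ?thesis by (simp add: mix_density_def mix_egf_def algebra_simps)
qed

text \<open>
  The density of \<open>N(0, 2 V)\<close>. Doubling the variance makes up for bounded shifts of the mean, since
  \<open>(x - a)\<^sup>2 \<ge> x\<^sup>2 / 2 - a\<^sup>2\<close>.
\<close>
definition gauss_env :: "real \<Rightarrow> real \<Rightarrow> real" where
  "gauss_env V x = normal_density 0 (sqrt (2 * V)) x"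

lemma gauss_env_pos: "V > 0 \<Longrightarrow> gauss_env V x > 0"
  by (simp add: gauss_env_def normal_density_pos)

lemma gauss_env_borel [measurable]: "gauss_env V \<in> borel_measurable borel"
  unfolding gauss_env_def[abs_def] by measurable

lemma gauss_env_moment_integrable: "V > 0 \<Longrightarrow> integrable lborel (\<lambda>x. gauss_env V x * x ^ n)"
  using integrable_normal_moment[of "sqrt (2 * V)" 0 n] by (simp add: gauss_env_def)

lemma gauss_pos: "v > 0 \<Longrightarrow> gauss x a v > 0"
  by (simp add: gauss_def normal_density_pos)

lemma gauss_borel [measurable]: "(\<lambda>x. gauss x a v) \<in> borel_measurable borel"
  unfolding gauss_def by measurable

lemma gauss_le_gauss_env:
  assumes v: "0 < m" "m \<le> v" "v \<le> V" and a: "\<bar>a\<bar> \<le> A"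
  shows "gauss x a v \<le> sqrt (2 * V / m) * exp (A^2 / (2 * V)) * gauss_env V x"
proof -
  have pos: "v > 0" "V > 0" using v by auto
  have a2: "a^2 \<le> A^2" using a by (metis abs_ge_zero power2_abs power_mono)
  have "(x - a)^2 \<ge> x^2 / 2 - A^2"
  proof -
    have "(x - a)^2 - (x^2 / 2 - a^2) = (x - 2 * a)^2 / 2" by (simp add: field_simps power2_eq_square)
    moreover have "(x - 2 * a)^2 / 2 \<ge> 0" by simp
    ultimately show ?thesis using a2 by linarith
  qed
  have 1: "- ((x - a)^2) / (2 * v) \<le> A^2 / (2 * V) - x^2 / (4 * V)"
  proof -
    have "(x - a)^2 / (2 * v) \<ge> (x - a)^2 / (2 * V)"
      using v pos by (intro divide_left_mono) auto
    moreover have "(x - a)^2 / (2 * V) \<ge> (x^2 / 2 - A^2) / (2 * V)"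
      using \<open>(x - a)^2 \<ge> x^2 / 2 - A^2\<close> pos by (intro divide_right_mono) auto
    moreover have "(x^2 / 2 - A^2) / (2 * V) = x^2 / (4 * V) - A^2 / (2 * V)"
      by (simp add: diff_divide_distrib)
    ultimately show ?thesis by simp
  qed
  have 2: "1 / sqrt (2 * pi * v) \<le> 1 / sqrt (2 * pi * m)"
    using v by (intro divide_left_mono mult_pos_pos) auto
  have "gauss x a v = 1 / sqrt (2 * pi * v) * exp (- ((x - a)^2) / (2 * v))"
    using pos by (simp add: gauss_def normal_density_def)
  also have "\<dots> \<le> 1 / sqrt (2 * pi * m) * exp (A^2 / (2 * V) - x^2 / (4 * V))"
    using 1 2 v by (intro mult_mono) auto
  also have "\<dots> = 1 / sqrt (2 * pi * m) * exp (A^2 / (2 * V)) * exp (- (x^2) / (4 * V))"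
    by (simp add: exp_diff exp_minus field_simps)
  also have "1 / sqrt (2 * pi * m) = sqrt (2 * V / m) / sqrt (4 * pi * V)"
  proof -
    have "sqrt (2 * V / m) / sqrt (4 * pi * V) = sqrt ((2 * V / m) / (4 * pi * V))"
      by (rule real_sqrt_divide[symmetric])
    also have "(2 * V / m) / (4 * pi * V) = 1 / (2 * pi * m)"
      using v pos by (simp add: field_simps)
    finally show ?thesis by (simp add: real_sqrt_divide)
  qed
  finally show ?thesis
    using pos by (simp add: gauss_env_def normal_density_def field_simps)
qed

lemma gauss_deriv_mean:
  assumes "v > 0"
  shows "((\<lambda>a. gauss x a v) has_real_derivative gauss x a v * ((x - a) / v)) (at a within S)"
proof -
  have "((\<lambda>a. exp (- ((x - a)^2) / (2 * v))) has_real_derivative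
      exp (- ((x - a)^2) / (2 * v)) * ((x - a) / v)) (at a within S)"
    using assms by (auto intro!: derivative_eq_intros simp: field_simps power2_eq_square)
  from DERIV_cmult[OF this, of "1 / sqrt (2 * pi * v)"] show ?thesis
    using assms by (simp add: gauss_def normal_density_def)
qed

lemma gauss_deriv_var:
  assumes "v > 0"
  shows "((\<lambda>v. gauss x a v) has_real_derivative gauss x a v * ((x - a)^2 / (2 * v^2) - 1 / (2 * v))) (at v)"
proof -
  have d: "((\<lambda>v. 1 / sqrt (2 * pi * v) * exp (- ((x - a)^2) / (2 * v))) has_real_derivative
      1 / sqrt (2 * pi * v) * exp (- ((x - a)^2) / (2 * v)) * ((x - a)^2 / (2 * v^2) - 1 / (2 * v))) (at v)"
  proof -
    have s: "sqrt (2 * pi * v) > 0" "sqrt (2 * pi * v) * sqrt (2 * pi * v) = 2 * pi * v" "pi * v > 0" using assms by simp_all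
    have 1: "((\<lambda>v. 1 / sqrt (2 * pi * v)) has_real_derivative - (1 / sqrt (2 * pi * v)) / (2 * v)) (at v)"
      using assms s by (auto intro!: derivative_eq_intros simp: field_simps mult_less_0_iff)
    have 2: "((\<lambda>v. exp (- ((x - a)^2) / (2 * v))) has_real_derivative
       exp (- ((x - a)^2) / (2 * v)) * ((x - a)^2 / (2 * v^2))) (at v)"
      using assms by (auto intro!: derivative_eq_intros simp: field_simps power2_eq_square)
    show ?thesis
      by (rule DERIV_cong[OF DERIV_mult[OF 1 2]]) (simp add: algebra_simps)
  qed
  have "eventually (\<lambda>u. u > 0) (nhds v)" using assms by (intro eventually_nhds_in_open[of "{0<..}", simplified]) auto
  hence "eventually (\<lambda>u. gauss x a u = 1 / sqrt (2 * pi * u) * exp (- ((x - a)^2) / (2 * u))) (nhds v)"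
    by eventually_elim (simp add: gauss_def normal_density_def)
  hence "((\<lambda>v. gauss x a v) has_real_derivative
      1 / sqrt (2 * pi * v) * exp (- ((x - a)^2) / (2 * v)) * ((x - a)^2 / (2 * v^2) - 1 / (2 * v))) (at v)"
    using d by (subst DERIV_cong_ev[OF refl _ refl])
  thus ?thesis using assms by (simp add: gauss_def normal_density_def)
qed

lemma gauss_lipschitz:
  assumes m: "0 < m" and A: "A \<ge> 0"
  shows "\<exists>C>0. \<forall>x a b v w. \<bar>a\<bar> \<le> A \<longrightarrow> \<bar>b\<bar> \<le> A \<longrightarrow> v \<in> {m..V} \<longrightarrow> w \<in> {m..V} \<longrightarrow>
     \<bar>gauss x a v - gauss x b w\<bar> \<le> C * (\<bar>a - b\<bar> + \<bar>v - w\<bar>) * ((1 + x^2) * gauss_env V x)"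
proof (cases "m \<le> V")
  case False
  thus ?thesis by (intro exI[of _ 1]) auto
next
  case mV: True
  hence V: "V > 0" using m by simp
  define K where "K = sqrt (2 * V / m) * exp (A^2 / (2 * V))"
  have K: "K > 0" using m V by (simp add: K_def)
  have gK: "gauss x a v \<le> K * gauss_env V x" if "\<bar>a\<bar> \<le> A" "v \<in> {m..V}" for x a v
    using gauss_le_gauss_env[of m v V a A x] m that by (simp add: K_def)
  define C1 C2 where "C1 = (1 + A) / m" and "C2 = (1 + A^2) / m^2 + 1 / (2 * m)"
  have C12: "C1 \<ge> 0" "C2 > 0" using m A by (auto simp: C1_def C2_def add_pos_nonneg intro!: add_nonneg_pos)
  have d1: "\<bar>gauss x a v - gauss x b v\<bar> \<le> (K * C1 * ((1 + x^2) * gauss_env V x)) * \<bar>a - b\<bar>"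
    if "\<bar>a\<bar> \<le> A" "\<bar>b\<bar> \<le> A" "v \<in> {m..V}" for x a b v
  proof -
    have "norm (gauss x a v - gauss x b v) \<le> (K * C1 * ((1 + x^2) * gauss_env V x)) * norm (a - b)"
    proof (rule field_differentiable_bound[of "{-A..A}"])
      fix z assume z: "z \<in> {-A..A}"
      have v: "v > 0" using that m by simp
      show "((\<lambda>a. gauss x a v) has_real_derivative gauss x z v * ((x - z) / v)) (at z within {-A..A})"
        by (rule gauss_deriv_mean[OF v])
      have "\<bar>x - z\<bar> \<le> (1 + A) * (1 + x^2)"
      proof -
        have "\<bar>x\<bar> \<le> 1 + x^2"
          using sum_squares_bound[of "\<bar>x\<bar>" 1] zero_le_power2[of x] unfolding power2_abs by simp
        moreover have "A * 1 \<le> A * (1 + x^2)" using A by (intro mult_left_mono) auto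
        moreover have "\<bar>x - z\<bar> \<le> \<bar>x\<bar> + A" using z by auto
        moreover have "(1 + A) * (1 + x^2) = (1 + x^2) + A * (1 + x^2)" by (simp add: algebra_simps)
        ultimately show ?thesis by linarith
      qed
      hence "\<bar>(x - z) / v\<bar> \<le> (1 + A) * (1 + x^2) / m"
        unfolding abs_divide using that m A v by (intro frac_le) auto
      hence "gauss x z v * \<bar>(x - z) / v\<bar> \<le> (K * gauss_env V x) * ((1 + A) * (1 + x^2) / m)"
        using gK[of z v x] z that gauss_pos[OF v, of x z] K gauss_env_pos[OF V, of x]
        by (intro mult_mono) auto
      thus "norm (gauss x z v * ((x - z) / v)) \<le> K * C1 * ((1 + x^2) * gauss_env V x)"
        using gauss_pos[OF v, of x z] by (simp add: abs_mult C1_def mult_ac)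
    qed (use that in auto)
    thus ?thesis by simp
  qed
  have d2: "\<bar>gauss x a v - gauss x a w\<bar> \<le> (K * C2 * ((1 + x^2) * gauss_env V x)) * \<bar>v - w\<bar>"
    if "\<bar>a\<bar> \<le> A" "v \<in> {m..V}" "w \<in> {m..V}" for x a v w
  proof -
    have "norm (gauss x a v - gauss x a w) \<le> (K * C2 * ((1 + x^2) * gauss_env V x)) * norm (v - w)"
    proof (rule field_differentiable_bound[of "{m..V}"])
      fix z assume z: "z \<in> {m..V}"
      have z0: "z > 0" using z m by simp
      show "((\<lambda>v. gauss x a v) has_real_derivative gauss x a z * ((x - a)^2 / (2 * z^2) - 1 / (2 * z))) (at z within {m..V})"
        by (rule has_field_derivative_at_within[OF gauss_deriv_var[OF z0]])
      have a2: "a^2 \<le> A^2" using that(1) by (metis abs_ge_zero power2_abs power_mono)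
      have "\<bar>(x - a)^2 / (2 * z^2) - 1 / (2 * z)\<bar> \<le> (x - a)^2 / (2 * z^2) + 1 / (2 * z)"
        using abs_triangle_ineq4[of "(x - a)^2 / (2 * z^2)" "1 / (2 * z)"] z0 by simp
      also have "\<dots> \<le> (2 * x^2 + 2 * A^2) / (2 * m^2) + 1 / (2 * m)"
      proof (intro add_mono frac_le)
        have "(2 * x^2 + 2 * a^2) - ((x - a)^2) = (x + a)^2" by (simp add: power2_eq_square algebra_simps)
        moreover have "(x + a)^2 \<ge> 0" by simp
        ultimately show "(x - a)^2 \<le> 2 * x^2 + 2 * A^2" using a2 by linarith
      qed (use z m in \<open>auto intro!: power_mono\<close>)
      also have "\<dots> \<le> C2 * (1 + x^2)"
      proof -
        have "C2 * (1 + x^2) - ((2 * x^2 + 2 * A^2) / (2 * m^2) + 1 / (2 * m))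
             = (1 + A^2 * x^2) / m^2 + x^2 / (2 * m)"
          using m by (simp add: C2_def field_simps)
        also have "\<dots> \<ge> 0" using m by simp
        finally show ?thesis by simp
      qed
      finally have "gauss x a z * \<bar>(x - a)^2 / (2 * z^2) - 1 / (2 * z)\<bar> \<le> (K * gauss_env V x) * (C2 * (1 + x^2))"
        using gK[of a z x] z that gauss_pos[OF z0, of x a] K gauss_env_pos[OF V, of x]
        by (intro mult_mono) auto
      thus "norm (gauss x a z * ((x - a)^2 / (2 * z^2) - 1 / (2 * z))) \<le> K * C2 * ((1 + x^2) * gauss_env V x)"
        using gauss_pos[OF z0, of x a] by (simp add: abs_mult mult_ac)
    qed (use that in auto)
    thus ?thesis by simp
  qed
  show ?thesis
  proof (intro exI[of _ "K * C1 + K * C2"] conjI allI impI)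
    show "K * C1 + K * C2 > 0" using K C12 by (simp add: add_nonneg_pos)
    fix x a b v w
    assume *: "\<bar>a\<bar> \<le> A" "\<bar>b\<bar> \<le> A" "v \<in> {m..V}" "w \<in> {m..V}"
    define e where "e = (1 + x^2) * gauss_env V x"
    have e: "e \<ge> 0" using gauss_env_pos[OF V, of x] by (simp add: e_def)
    have "\<bar>gauss x a v - gauss x b w\<bar> \<le> \<bar>gauss x a v - gauss x b v\<bar> + \<bar>gauss x b v - gauss x b w\<bar>" by simp
    also have "\<dots> \<le> (K * C1 * e) * \<bar>a - b\<bar> + (K * C2 * e) * \<bar>v - w\<bar>"
      unfolding e_def by (intro add_mono d1 d2 *)
    also have "\<dots> \<le> (K * C1 * e) * \<bar>a - b\<bar> + (K * C2 * e) * \<bar>v - w\<bar> + ((K * C1 * e) * \<bar>v - w\<bar> + (K * C2 * e) * \<bar>a - b\<bar>)"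
      using K C12 e by simp
    also have "\<dots> = (K * C1 + K * C2) * (\<bar>a - b\<bar> + \<bar>v - w\<bar>) * e" by (simp add: algebra_simps)
    finally show "\<bar>gauss x a v - gauss x b w\<bar> \<le> (K * C1 + K * C2) * (\<bar>a - b\<bar> + \<bar>v - w\<bar>) * ((1 + x^2) * gauss_env V x)"
      by (simp add: e_def)
  qed
qed

definition param_box :: "real \<Rightarrow> real \<Rightarrow> real \<Rightarrow> param set" where
  "param_box M m V = {-M..M} \<times> {m..V} \<times> {m..V}"

definition l1_dist :: "param \<Rightarrow> param \<Rightarrow> real" where
  "l1_dist = (\<lambda>(\<theta>, v1, v2) (\<theta>', v1', v2'). \<bar>\<theta> - \<theta>'\<bar> + \<bar>v1 - v1'\<bar> + \<bar>v2 - v2'\<bar>)"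

lemma mix_density_pos:
  assumes "0 < p" "p < 1" "0 < m" "\<eta> \<in> param_box M m V"
  shows "mix_density p x \<eta> > 0"
proof -
  obtain \<theta> v1 v2 where e: "\<eta> = (\<theta>, v1, v2)" by (metis prod.exhaust)
  have "v1 > 0" "v2 > 0" using assms by (auto simp: e param_box_def)
  thus ?thesis
    unfolding e mix_density_def prod.case using assms(1,2)
    by (intro add_pos_pos mult_pos_pos gauss_pos) auto
qed

lemma mix_density_borel [measurable]: "(\<lambda>x. mix_density p x \<eta>) \<in> borel_measurable borel"
  by (cases \<eta>) (simp add: mix_density_def)

lemma mix_moments_box:
  assumes "0 < m" "\<eta> \<in> param_box M m V"
  shows "has_bochner_integral lborel (\<lambda>x. mix_density p x \<eta> * x ^ n) (fact n * mix_coeff p n \<eta>)"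
  using assms mix_has_moments by (auto simp: param_box_def)

lemma mix_density_integral_1:
  assumes "0 < m" "\<eta> \<in> param_box M m V"
  shows "has_bochner_integral lborel (\<lambda>x. mix_density p x \<eta>) 1"
  using mix_moments_box[OF assms, of p 0]
  by (cases \<eta>) (simp add: mix_egf_def gauss_egf_nth)

lemma mix_density_le_gauss_env:
  assumes p: "0 < p" "p < 1 / 2" and m: "0 < m" "m \<le> V" and M: "M \<ge> 0"
  shows "\<exists>K>0. \<forall>\<eta>\<in>param_box M m V. \<forall>x. mix_density p x \<eta> \<le> K * gauss_env V x"
proof (intro exI conjI ballI allI)
  let ?K = "sqrt (2 * V / m) * exp (M^2 / (2 * V))"
  show "?K > 0" using m by simp
  fix \<eta> x assume "\<eta> \<in> param_box M m V"
  then obtain \<theta> v1 v2 where e: "\<eta> = (\<theta>, v1, v2)" "\<bar>\<theta>\<bar> \<le> M" "v1 \<in> {m..V}" "v2 \<in> {m..V}"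
    by (auto simp: param_box_def abs_le_iff)
  have o: "0 < odds p" "odds p < 1" using p by (auto simp: odds_def field_simps)
  have "\<bar>odds p * \<theta>\<bar> \<le> 1 * M" unfolding abs_mult using o e by (intro mult_mono) auto
  hence "p * gauss x (- \<theta>) v1 + (1 - p) * gauss x (odds p * \<theta>) v2 \<le> p * (?K * gauss_env V x) + (1 - p) * (?K * gauss_env V x)"
    using p e m by (intro add_mono mult_left_mono gauss_le_gauss_env) auto
  thus "mix_density p x \<eta> \<le> ?K * gauss_env V x" by (simp add: mix_density_def e algebra_simps)
qed

lemma mix_density_lipschitz:
  assumes p: "0 < p" "p < 1 / 2" and m: "0 < m" and M: "M \<ge> 0"
  shows "\<exists>C>0. \<forall>\<eta>\<in>param_box M m V. \<forall>\<eta>'\<in>param_box M m V. \<forall>x.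
    \<bar>mix_density p x \<eta> - mix_density p x \<eta>'\<bar> \<le> C * l1_dist \<eta> \<eta>' * ((1 + x^2) * gauss_env V x)"
proof -
  obtain C where C: "C > 0" "\<And>x a b v w. \<bar>a\<bar> \<le> M \<Longrightarrow> \<bar>b\<bar> \<le> M \<Longrightarrow> v \<in> {m..V} \<Longrightarrow> w \<in> {m..V} \<Longrightarrow>
     \<bar>gauss x a v - gauss x b w\<bar> \<le> C * (\<bar>a - b\<bar> + \<bar>v - w\<bar>) * ((1 + x^2) * gauss_env V x)"
    using gauss_lipschitz[OF m M, of V] by blast
  show ?thesis
  proof (intro exI[of _ C] conjI ballI allI C(1))
    fix \<eta> \<eta>' x assume "\<eta> \<in> param_box M m V" "\<eta>' \<in> param_box M m V"
    then obtain \<theta> v1 v2 \<theta>' v1' v2' where e: "\<eta> = (\<theta>, v1, v2)" "\<bar>\<theta>\<bar> \<le> M" "v1 \<in> {m..V}" "v2 \<in> {m..V}"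
      "\<eta>' = (\<theta>', v1', v2')" "\<bar>\<theta>'\<bar> \<le> M" "v1' \<in> {m..V}" "v2' \<in> {m..V}"
      by (auto simp: param_box_def abs_le_iff)
    have V: "V > 0" using e m by auto
    have o: "0 < odds p" "odds p < 1" using p by (auto simp: odds_def field_simps)
    have ob: "\<bar>odds p * t\<bar> \<le> \<bar>t\<bar>" for t
      unfolding abs_mult using o mult_right_mono[of "\<bar>odds p\<bar>" 1 "\<bar>t\<bar>"] by simp
    define E where "E = (1 + x^2) * gauss_env V x"
    have E: "E \<ge> 0" using gauss_env_pos[OF V, of x] by (simp add: E_def)
    define d where "d = l1_dist \<eta> \<eta>'"
    have g1: "\<bar>gauss x (- \<theta>) v1 - gauss x (- \<theta>') v1'\<bar> \<le> C * d * E"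
    proof -
      have "\<bar>gauss x (- \<theta>) v1 - gauss x (- \<theta>') v1'\<bar> \<le> C * (\<bar>- \<theta> - (- \<theta>')\<bar> + \<bar>v1 - v1'\<bar>) * E"
        unfolding E_def using e by (intro C(2)) auto
      also have "\<dots> \<le> C * d * E"
        using C(1) E by (intro mult_right_mono mult_left_mono) (auto simp: d_def l1_dist_def e)
      finally show ?thesis .
    qed
    have g2: "\<bar>gauss x (odds p * \<theta>) v2 - gauss x (odds p * \<theta>') v2'\<bar> \<le> C * d * E"
    proof -
      have "\<bar>gauss x (odds p * \<theta>) v2 - gauss x (odds p * \<theta>') v2'\<bar> \<le> C * (\<bar>odds p * \<theta> - odds p * \<theta>'\<bar> + \<bar>v2 - v2'\<bar>) * E"
        unfolding E_def using e ob[of \<theta>] ob[of \<theta>'] by (intro C(2)) auto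
      also have "\<bar>odds p * \<theta> - odds p * \<theta>'\<bar> \<le> \<bar>\<theta> - \<theta>'\<bar>"
        using ob[of "\<theta> - \<theta>'"] by (simp add: right_diff_distrib)
      hence "C * (\<bar>odds p * \<theta> - odds p * \<theta>'\<bar> + \<bar>v2 - v2'\<bar>) * E \<le> C * d * E"
        using C(1) E by (intro mult_right_mono mult_left_mono) (auto simp: d_def l1_dist_def e)
      finally show ?thesis .
    qed
    have "mix_density p x \<eta> - mix_density p x \<eta>' = p * (gauss x (- \<theta>) v1 - gauss x (- \<theta>') v1')
        + (1 - p) * (gauss x (odds p * \<theta>) v2 - gauss x (odds p * \<theta>') v2')"
      by (simp add: mix_density_def e algebra_simps)
    also have "\<bar>\<dots>\<bar> \<le> p * \<bar>gauss x (- \<theta>) v1 - gauss x (- \<theta>') v1'\<bar> + (1 - p) * \<bar>gauss x (odds p * \<theta>) v2 - gauss x (odds p * \<theta>') v2'\<bar>"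
      using p by (intro order_trans[OF abs_triangle_ineq]) (simp add: abs_mult)
    also have "\<dots> \<le> p * (C * d * E) + (1 - p) * (C * d * E)"
      using p by (intro add_mono mult_left_mono g1 g2) auto
    also have "\<dots> = C * d * E" by (simp add: algebra_simps)
    finally show "\<bar>mix_density p x \<eta> - mix_density p x \<eta>'\<bar> \<le> C * l1_dist \<eta> \<eta>' * ((1 + x^2) * gauss_env V x)"
      by (simp add: d_def E_def)
  qed
qed

section \<open>Hellinger affinity\<close>

lemma sqrt_product_integrable:
  fixes f g :: "real \<Rightarrow> real"
  assumes [measurable]: "f \<in> borel_measurable borel" "g \<in> borel_measurable borel"
    and "integrable lborel f" "integrable lborel g" "\<And>x. f x \<ge> 0" "\<And>x. g x \<ge> 0"
  shows "integrable lborel (\<lambda>x. sqrt (f x * g x))"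
    and "(\<integral>x. sqrt (f x * g x) \<partial>lborel) \<le> ((\<integral>x. f x \<partial>lborel) + (\<integral>x. g x \<partial>lborel)) / 2"
proof -
  have le: "sqrt (f x * g x) \<le> (f x + g x) / 2" for x
    using arith_geo_mean_sqrt[of "f x" "g x"] assms by simp
  show i: "integrable lborel (\<lambda>x. sqrt (f x * g x))"
    by (rule Bochner_Integration.integrable_bound[of _ "\<lambda>x. (f x + g x) / 2"])
      (use assms le in \<open>auto intro!: AE_I2 simp: abs_of_nonneg\<close>)
  have "(\<integral>x. sqrt (f x * g x) \<partial>lborel) \<le> (\<integral>x. (f x + g x) / 2 \<partial>lborel)"
    using assms le i by (intro integral_mono) auto
  thus "(\<integral>x. sqrt (f x * g x) \<partial>lborel) \<le> ((\<integral>x. f x \<partial>lborel) + (\<integral>x. g x \<partial>lborel)) / 2"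
    using assms by simp
qed

text \<open>
  The Cauchy--Schwarz inequality for \<open>(\<surd>f - \<surd>g) \<cdot> (\<surd>f + \<surd>g) h\<close>: the integral of the square of
  \<open>(\<surd>f - \<surd>g) - t (\<surd>f + \<surd>g) h\<close> is nonnegative, and \<open>t = (a - b) / B\<close> minimises the resulting bound. Unbounded
  test functions such as powers are admissible because both densities lie below an integrable
  envelope.
\<close>
lemma moment_gap_le_hellinger:
  fixes f g h :: "real \<Rightarrow> real"
  assumes f: "has_bochner_integral lborel f 1" "\<And>x. f x > 0"
    and g: "has_bochner_integral lborel g 1" "\<And>x. g x > 0"
    and m: "has_bochner_integral lborel (\<lambda>x. f x * h x) a" "has_bochner_integral lborel (\<lambda>x. g x * h x) b"
    and [measurable]: "h \<in> borel_measurable borel"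
    and E: "integrable lborel (\<lambda>x. E x * (h x)^2)" "\<And>x. f x \<le> E x" "\<And>x. g x \<le> E x"
    and B: "4 * (\<integral>x. E x * (h x)^2 \<partial>lborel) \<le> B" "B > 0"
  shows "(a - b)^2 \<le> 2 * B * (1 - (\<integral>x. sqrt (f x * g x) \<partial>lborel))"
proof -
  note [measurable] = borel_measurable_has_bochner_integral[OF f(1), simplified] borel_measurable_has_bochner_integral[OF g(1), simplified]
  define t where "t = (a - b) / B"
  have fg: "integrable lborel f" "integrable lborel g" "integral\<^sup>L lborel f = 1" "integral\<^sup>L lborel g = 1"
    using f g by (auto simp: has_bochner_integral_iff)
  have fgh: "integrable lborel (\<lambda>x. f x * h x)" "integrable lborel (\<lambda>x. g x * h x)"
    "(\<integral>x. f x * h x \<partial>lborel) = a" "(\<integral>x. g x * h x \<partial>lborel) = b"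
    using m by (auto simp: has_bochner_integral_iff)
  have i: "integrable lborel (\<lambda>x. sqrt (f x * g x))"
    by (rule sqrt_product_integrable) (use fg f g in \<open>auto intro: less_imp_le\<close>)
  define Q where "Q x = f x + g x - 2 * sqrt (f x * g x) - 2 * t * (f x * h x - g x * h x) + t^2 * (4 * (E x * (h x)^2))" for x
  have "0 \<le> Q x" for x
  proof -
    define u w where "u = sqrt (f x)" and "w = sqrt (g x)"
    have uw: "f x = u^2" "g x = w^2" "sqrt (f x * g x) = u * w"
      using f(2)[of x] g(2)[of x] by (auto simp: u_def w_def real_sqrt_mult)
    have "(u + w)^2 \<le> 4 * E x"
    proof -
      have "(u + w)^2 = 2 * u^2 + 2 * w^2 - (u - w)^2" by (simp add: power2_eq_square algebra_simps)
      also have "\<dots> \<le> 2 * u^2 + 2 * w^2" by simp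
      finally show ?thesis using E(2)[of x] E(3)[of x] unfolding uw by linarith
    qed
    hence "t^2 * ((u + w)^2 * (h x)^2) \<le> t^2 * ((4 * E x) * (h x)^2)"
      by (intro mult_left_mono mult_right_mono) auto
    moreover have "((u - w) - t * ((u + w) * h x))^2 = u^2 + w^2 - 2 * (u * w) - 2 * t * (u^2 * h x - w^2 * h x) + t^2 * ((u + w)^2 * (h x)^2)"
      by (simp add: power2_eq_square algebra_simps)
    moreover have "((u - w) - t * ((u + w) * h x))^2 \<ge> 0" by simp
    ultimately show ?thesis unfolding Q_def uw(3) by (simp add: uw(1,2) mult_ac)
  qed
  hence "0 \<le> (\<integral>x. Q x \<partial>lborel)" by (intro Bochner_Integration.integral_nonneg) auto
  also have "(\<integral>x. Q x \<partial>lborel) = 1 + 1 - 2 * (\<integral>x. sqrt (f x * g x) \<partial>lborel) - 2 * t * (a - b)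
      + t^2 * (4 * (\<integral>x. E x * (h x)^2 \<partial>lborel))"
    unfolding Q_def using fg fgh i E(1) by simp
  also have "\<dots> \<le> 2 - 2 * (\<integral>x. sqrt (f x * g x) \<partial>lborel) - 2 * t * (a - b) + t^2 * B"
    using mult_left_mono[OF B(1), of "t^2"] by simp
  also have "\<dots> = 2 * (1 - (\<integral>x. sqrt (f x * g x) \<partial>lborel)) - (a - b)^2 / B"
    using B(2) by (simp add: t_def field_simps power2_eq_square)
  finally show ?thesis using B(2) by (simp add: field_simps)
qed

definition affinity :: "real \<Rightarrow> param \<Rightarrow> param \<Rightarrow> real" where
  "affinity p \<eta> \<eta>' = (\<integral>x. sqrt (mix_density p x \<eta> * mix_density p x \<eta>') \<partial>lborel)"

lemma affinity_upper_bound: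
  assumes p: "0 < p" "p < 1 / 2" and m: "0 < m" "m \<le> V" and M: "M \<ge> 0"
  shows "\<exists>c>0. \<forall>\<eta>\<in>param_box M m V. \<forall>\<eta>'\<in>param_box M m V. affinity p \<eta> \<eta>' \<le> 1 - c * (psi6 \<eta> \<eta>')^2"
proof -
  define R where "R = max M V"
  have V: "V > 0" using m by simp
  have sub: "param_box M m V \<subseteq> {-R..R} \<times> {-R..R} \<times> {-R..R}" using m by (auto simp: param_box_def R_def)
  obtain c where c0: "c > 0" "\<forall>\<eta> \<eta>'. \<eta> \<in> {-R..R} \<times> {-R..R} \<times> {-R..R} \<longrightarrow> \<eta>' \<in> {-R..R} \<times> {-R..R} \<times> {-R..R} \<longrightarrow>
     c * psi6 \<eta> \<eta>' \<le> (\<Sum>l\<in>{2..6}. \<bar>mix_coeff p l \<eta> - mix_coeff p l \<eta>'\<bar>)"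
    using moment_gap_lower_bound[OF p, of R] by blast
  have c: "c > 0" "c * psi6 \<eta> \<eta>' \<le> (\<Sum>l\<in>{2..6}. \<bar>mix_coeff p l \<eta> - mix_coeff p l \<eta>'\<bar>)"
    if "\<eta> \<in> param_box M m V" "\<eta>' \<in> param_box M m V" for \<eta> \<eta>'
    using c0(1) c0(2)[rule_format, OF subsetD[OF sub that(1)] subsetD[OF sub that(2)]] by simp_all
  obtain K where K: "K > 0" "\<And>\<eta> x. \<eta> \<in> param_box M m V \<Longrightarrow> mix_density p x \<eta> \<le> K * gauss_env V x"
    using mix_density_le_gauss_env[OF p m M] by blast
  define B where "B = 1 + (\<Sum>l\<in>{2..6::nat}. 4 * (\<integral>x. (K * gauss_env V x) * (x ^ l)^2 \<partial>lborel))"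
  have nn: "0 \<le> 4 * (\<integral>x. (K * gauss_env V x) * (x ^ l)^2 \<partial>lborel)" for l :: nat
    using K gauss_env_pos[OF V] by (intro mult_nonneg_nonneg Bochner_Integration.integral_nonneg) (auto intro: less_imp_le)
  have B: "B > 0" unfolding B_def by (intro add_pos_nonneg sum_nonneg nn) auto
  have Bl: "4 * (\<integral>x. (K * gauss_env V x) * (x ^ l)^2 \<partial>lborel) \<le> B" if "l \<in> {2..6}" for l :: nat
  proof -
    have "4 * (\<integral>x. (K * gauss_env V x) * (x ^ l)^2 \<partial>lborel) \<le> (\<Sum>l\<in>{2..6::nat}. 4 * (\<integral>x. (K * gauss_env V x) * (x ^ l)^2 \<partial>lborel))"
      by (rule member_le_sum[OF that]) (use nn in auto)
    thus ?thesis by (simp add: B_def)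
  qed
  show ?thesis
  proof (intro exI[of _ "c^2 / (50 * B)"] conjI ballI)
    show "c^2 / (50 * B) > 0" using c0 B by simp
    fix \<eta> \<eta>' assume e: "\<eta> \<in> param_box M m V" "\<eta>' \<in> param_box M m V"
    have p1: "p < 1" using p by simp
    define r where "r = affinity p \<eta> \<eta>'"
    have gap: "(fact l * (mix_coeff p l \<eta> - mix_coeff p l \<eta>'))^2 \<le> 2 * B * (1 - r)" if "l \<in> {2..6}" for l
    proof -
      have ii: "integrable lborel (\<lambda>x. K * gauss_env V x * (x ^ l)^2)"
        using integrable_mult_right[OF gauss_env_moment_integrable[OF V, of "l * 2"], of K] by (simp add: mult.assoc flip: power_mult)
      have "(fact l * mix_coeff p l \<eta> - fact l * mix_coeff p l \<eta>')^2 \<le> 2 * B * (1 - r)"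
        unfolding r_def affinity_def
        by (rule moment_gap_le_hellinger[where h = "\<lambda>x. x ^ l" and E = "\<lambda>x. K * gauss_env V x",
              OF mix_density_integral_1[OF m(1) e(1)] mix_density_pos[OF p(1) p1 m(1) e(1)]
                mix_density_integral_1[OF m(1) e(2)] mix_density_pos[OF p(1) p1 m(1) e(2)]
                mix_moments_box[OF m(1) e(1)] mix_moments_box[OF m(1) e(2)] _
                ii K(2)[OF e(1)] K(2)[OF e(2)] Bl[OF that] B]) simp
      thus ?thesis by (simp add: right_diff_distrib)
    qed
    have "\<bar>mix_coeff p l \<eta> - mix_coeff p l \<eta>'\<bar> \<le> sqrt (2 * B * (1 - r))" if "l \<in> {2..6}" for l
    proof (rule real_le_rsqrt)
      have "1 * \<bar>mix_coeff p l \<eta> - mix_coeff p l \<eta>'\<bar> \<le> fact l * \<bar>mix_coeff p l \<eta> - mix_coeff p l \<eta>'\<bar>"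
        by (intro mult_right_mono fact_ge_1) auto
      hence "\<bar>mix_coeff p l \<eta> - mix_coeff p l \<eta>'\<bar>^2 \<le> (fact l * \<bar>mix_coeff p l \<eta> - mix_coeff p l \<eta>'\<bar>)^2"
        by (intro power_mono) auto
      thus "\<bar>mix_coeff p l \<eta> - mix_coeff p l \<eta>'\<bar>^2 \<le> 2 * B * (1 - r)"
        using gap[OF that] by (simp add: power_mult_distrib)
    qed
    hence "(\<Sum>l\<in>{2..6}. \<bar>mix_coeff p l \<eta> - mix_coeff p l \<eta>'\<bar>) \<le> (\<Sum>l\<in>{2..6::nat}. sqrt (2 * B * (1 - r)))"
      by (intro sum_mono)
    hence "c * psi6 \<eta> \<eta>' \<le> 5 * sqrt (2 * B * (1 - r))" using c(2)[OF e] by simp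
    hence "(c * psi6 \<eta> \<eta>')^2 \<le> (5 * sqrt (2 * B * (1 - r)))^2"
      using c0 psi6_nonneg by (intro power_mono) auto
    also have "1 - r \<ge> 0"
    proof -
      have "0 \<le> 2 * B * (1 - r)" by (rule order_trans[OF zero_le_power2 gap[of 2]]) simp
      thus ?thesis using B by (simp add: zero_le_mult_iff)
    qed
    hence "(5 * sqrt (2 * B * (1 - r)))^2 = 50 * B * (1 - r)"
      using B by (simp add: power_mult_distrib)
    finally have "c^2 * (psi6 \<eta> \<eta>')^2 \<le> 50 * B * (1 - r)" by (simp add: power_mult_distrib)
    thus "affinity p \<eta> \<eta>' \<le> 1 - c^2 / (50 * B) * (psi6 \<eta> \<eta>')^2"
      using B by (simp add: field_simps flip: r_def)
  qed
qed

section \<open>Risk of the maximum likelihood estimator\<close>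

lemma prob_space_mix:
  assumes "0 < p" "p < 1" "0 < m" "\<eta> \<in> param_box M m V"
  shows "prob_space (density lborel (\<lambda>x. ennreal (mix_density p x \<eta>)))"
proof
  have h: "has_bochner_integral lborel (\<lambda>x. mix_density p x \<eta>) 1"
    using assms by (intro mix_density_integral_1)
  have "(\<integral>\<^sup>+ x. ennreal (mix_density p x \<eta>) \<partial>lborel) = ennreal 1"
    using h mix_density_pos[OF assms]
    by (subst nn_integral_eq_integral) (auto simp: has_bochner_integral_iff less_imp_le)
  thus "emeasure (density lborel (\<lambda>x. ennreal (mix_density p x \<eta>))) (space (density lborel (\<lambda>x. ennreal (mix_density p x \<eta>)))) = 1"
    by (simp add: emeasure_density)
qed

lemma sets_sample_law: "sets (sample_law p n \<eta>) = sets (sample_space n)"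
  unfolding sample_law_def sample_space_def by (intro sets_PiM_cong) auto

lemma space_sample_law: "space (sample_law p n \<eta>) = space (sample_space n)"
  by (rule sets_eq_imp_space_eq[OF sets_sample_law])

lemma prob_space_sample_law:
  assumes "0 < p" "p < 1" "0 < m" "\<eta> \<in> param_box M m V"
  shows "prob_space (sample_law p n \<eta>)"
  unfolding sample_law_def using prob_space_mix[OF assms] by (rule prob_space_PiM)

lemma nn_integral_sample_prod:
  assumes "0 < p" "p < 1" "0 < m" "\<eta> \<in> param_box M m V"
    and [measurable]: "u \<in> borel_measurable borel"
  shows "(\<integral>\<^sup>+ y. (\<Prod>i<n. u (y i)) \<partial>sample_law p n \<eta>) = (\<integral>\<^sup>+ x. ennreal (mix_density p x \<eta>) * u x \<partial>lborel) ^ n"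
proof -
  interpret D: prob_space "density lborel (\<lambda>x. ennreal (mix_density p x \<eta>))"
    using assms(1-4) by (rule prob_space_mix)
  interpret product_sigma_finite "\<lambda>_::nat. density lborel (\<lambda>x. ennreal (mix_density p x \<eta>))"
    by standard
  show ?thesis
    unfolding sample_law_def
    by (subst product_nn_integral_prod) (simp_all add: nn_integral_density)
qed

text \<open>
  One representative for each cell of a cubic grid that meets \<open>H\<close>. The representatives lie in \<open>H\<close>
  itself, so that they are parameters of mixture densities and all bounds on \<open>H\<close> apply to them.
\<close>
lemma finite_net:
  fixes H :: "param set"
  assumes H: "H \<subseteq> param_box M m V" and m: "0 < m" "m \<le> V" and M: "M \<ge> 0" and e: "e > 0"
  shows "\<exists>N. finite N \<and> N \<subseteq> H \<and> real (card N) \<le> (2 * (max M V / e) + 3) ^ 3 \<and>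
     (\<forall>\<theta> v1 v2. (\<theta>, v1, v2) \<in> H \<longrightarrow> (\<exists>\<theta>' v1' v2'. (\<theta>', v1', v2') \<in> N \<and>
        \<bar>\<theta> - \<theta>'\<bar> \<le> e \<and> \<bar>v1 - v1'\<bar> \<le> e \<and> \<bar>v2 - v2'\<bar> \<le> e))"
proof -
  define key where "key = (\<lambda>(\<theta>, v1, v2). (\<lfloor>\<theta> / e\<rfloor>, \<lfloor>v1 / e\<rfloor>, \<lfloor>v2 / e\<rfloor>))"
  define R where "R = max M V"
  define k where "k = \<lceil>R / e\<rceil>"
  have R: "R \<ge> 0" using M by (simp add: R_def)
  have "R / e \<ge> 0" using R e by simp
  hence k0: "k \<ge> 0" unfolding k_def by linarith
  have fl: "\<lfloor>x / e\<rfloor> \<in> {-k..k}" if "\<bar>x\<bar> \<le> R" for x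
  proof -
    have "x / e \<le> R / e" "- (R / e) \<le> x / e" using that e by (auto simp: field_simps abs_le_iff)
    moreover have "R / e \<le> of_int k" by (simp add: k_def)
    ultimately have 1: "x / e \<le> of_int k" "of_int (- k) \<le> x / e" by auto
    have "of_int \<lfloor>x / e\<rfloor> \<le> (of_int k :: real)" by (rule order_trans[OF of_int_floor_le 1(1)])
    moreover have "- k \<le> \<lfloor>x / e\<rfloor>" using 1(2) by (simp only: le_floor_iff)
    ultimately show ?thesis by simp
  qed
  have sub: "key ` H \<subseteq> {-k..k} \<times> {-k..k} \<times> {-k..k}"
  proof
    fix z assume "z \<in> key ` H"
    then obtain \<theta> v1 v2 where z: "(\<theta>, v1, v2) \<in> H" "z = (\<lfloor>\<theta> / e\<rfloor>, \<lfloor>v1 / e\<rfloor>, \<lfloor>v2 / e\<rfloor>)"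
      by (auto simp: key_def)
    have "\<bar>\<theta>\<bar> \<le> R" "\<bar>v1\<bar> \<le> R" "\<bar>v2\<bar> \<le> R"
      using subsetD[OF H z(1)] m by (auto simp: param_box_def R_def)
    thus "z \<in> {-k..k} \<times> {-k..k} \<times> {-k..k}" using fl unfolding z(2) by blast
  qed
  have fin: "finite (key ` H)" by (rule finite_subset[OF sub]) auto
  have "card (key ` H) \<le> card ({-k..k} \<times> {-k..k} \<times> {-k..k})" by (rule card_mono[OF _ sub]) auto
  also have "\<dots> = nat (2 * k + 1) ^ 3" by (simp add: card_cartesian_product power3_eq_cube)
  finally have "real (card (key ` H)) \<le> real (nat (2 * k + 1)) ^ 3"
    by (metis of_nat_le_iff of_nat_power)
  also have "real (nat (2 * k + 1)) = 2 * of_int k + 1" using k0 by simp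
  also have "(2 * of_int k + 1) ^ 3 \<le> (2 * (R / e) + 3) ^ 3"
  proof (rule power_mono)
    have "of_int k \<le> R / e + 1" unfolding k_def by (rule of_int_ceiling_le_add_one)
    thus "2 * of_int k + 1 \<le> 2 * (R / e) + 3" by simp
  qed (use k0 in simp)
  finally have ck: "real (card (key ` H)) \<le> (2 * (R / e) + 3) ^ 3" .
  define pick where "pick z = (SOME \<eta>. \<eta> \<in> H \<and> key \<eta> = z)" for z
  have pick: "pick z \<in> H \<and> key (pick z) = z" if "z \<in> key ` H" for z
    unfolding pick_def by (rule someI_ex) (use that in auto)
  have near: "\<bar>x - y\<bar> \<le> e" if "\<lfloor>x / e\<rfloor> = \<lfloor>y / e\<rfloor>" for x y
  proof -
    have "\<bar>x / e - y / e\<bar> \<le> 1" using that by linarith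
    hence "\<bar>x - y\<bar> / e \<le> 1" using e by (simp add: diff_divide_distrib[symmetric])
    thus ?thesis using e by (simp add: field_simps)
  qed
  show ?thesis
  proof (intro exI[of _ "pick ` key ` H"] conjI allI impI)
    show "finite (pick ` key ` H)" using fin by simp
    show "pick ` key ` H \<subseteq> H" using pick by blast
    have "card (pick ` key ` H) \<le> card (key ` H)" by (rule card_image_le[OF fin])
    thus "real (card (pick ` key ` H)) \<le> (2 * (max M V / e) + 3) ^ 3" using ck by (simp add: R_def)
    fix \<theta> v1 v2 assume h: "(\<theta>, v1, v2) \<in> H"
    obtain \<theta>' v1' v2' where e': "pick (key (\<theta>, v1, v2)) = (\<theta>', v1', v2')" by (metis prod.exhaust)
    have "key (\<theta>', v1', v2') = key (\<theta>, v1, v2)" using pick[of "key (\<theta>, v1, v2)"] h e' by auto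
    thus "\<exists>\<theta>' v1' v2'. (\<theta>', v1', v2') \<in> pick ` key ` H \<and>
        \<bar>\<theta> - \<theta>'\<bar> \<le> e \<and> \<bar>v1 - v1'\<bar> \<le> e \<and> \<bar>v2 - v2'\<bar> \<le> e"
      using h e' by (intro exI[of _ \<theta>'] exI[of _ v1'] exI[of _ v2']) (auto simp: key_def intro!: near intro: rev_image_eqI)
  qed
qed

lemma power_add_le:
  fixes x y :: real
  assumes "x \<ge> 0" "y \<ge> 0"
  shows "(x + y) ^ k \<le> 2 ^ k * (x ^ k + y ^ k)"
proof -
  have "(x + y) ^ k \<le> (2 * max x y) ^ k" using assms by (intro power_mono) auto
  also have "\<dots> = 2 ^ k * max x y ^ k" by (simp add: power_mult_distrib)
  also have "max x y ^ k \<le> x ^ k + y ^ k" using assms by (auto simp: max_def)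
  finally show ?thesis by simp
qed

lemma psi6_perturb:
  assumes "\<bar>\<theta> - \<theta>'\<bar> \<le> e" "\<bar>v1 - v1'\<bar> \<le> e" "\<bar>v2 - v2'\<bar> \<le> e" "0 \<le> e" "e \<le> 1"
  shows "psi6 (\<theta>, v1, v2) \<eta> \<le> 64 * (psi6 (\<theta>', v1', v2') \<eta> + 3 * e ^ 3)"
proof -
  obtain t w1 w2 where e: "\<eta> = (t, w1, w2)" by (metis prod.exhaust)
  have 1: "\<bar>x - t\<bar> ^ k \<le> 64 * (\<bar>x' - t\<bar> ^ k + e ^ 3)" if "\<bar>x - x'\<bar> \<le> e" "3 \<le> k" "k \<le> 6" for x x' t and k :: nat
  proof -
    have "\<bar>x - t\<bar> ^ k \<le> (\<bar>x' - t\<bar> + e) ^ k" using that by (intro power_mono) auto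
    also have "\<dots> \<le> 2 ^ k * (\<bar>x' - t\<bar> ^ k + e ^ k)" using assms by (intro power_add_le) auto
    also have "\<dots> \<le> 2 ^ 6 * (\<bar>x' - t\<bar> ^ k + e ^ 3)"
      using that assms by (intro mult_mono[OF power_increasing add_left_mono[OF power_decreasing]]) auto
    finally show ?thesis by simp
  qed
  show ?thesis
    using 1[OF assms(1), of 6 t] 1[OF assms(2), of 3 w1] 1[OF assms(3), of 3 w2]
    by (simp add: psi6_def e)
qed

text \<open>
  Any function \<open>U\<close> above the density at a point of larger likelihood gives a statistic that is at
  least one. It is a product over the sample, so its expectation factorises; the square root makes
  each factor an affinity.
\<close>
lemma mle_sqrt_ratio_ge_1:
  assumes p: "0 < p" "p < 1" and m: "0 < m"
    and T: "T \<in> param_box M m V" "\<eta> \<in> param_box M m V"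
    and max: "log_lik p n y \<eta> \<le> log_lik p n y T"
    and U: "\<And>x. mix_density p x T \<le> U x"
  shows "1 \<le> (\<Prod>i<n. sqrt (U (y i) / mix_density p (y i) \<eta>))"
proof -
  note pT = mix_density_pos[OF p m T(1)] and pe = mix_density_pos[OF p m T(2)]
  have "1 \<le> exp ((log_lik p n y T - log_lik p n y \<eta>) / 2)" using max by simp
  also have "\<dots> = exp (\<Sum>i<n. (ln (mix_density p (y i) T) - ln (mix_density p (y i) \<eta>)) / 2)"
    by (simp add: log_lik_def sum_subtractf flip: sum_divide_distrib)
  also have "\<dots> = (\<Prod>i<n. exp ((ln (mix_density p (y i) T) - ln (mix_density p (y i) \<eta>)) / 2))"
    by (simp add: exp_sum)
  also have "\<dots> = (\<Prod>i<n. sqrt (mix_density p (y i) T / mix_density p (y i) \<eta>))"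
  proof (rule prod.cong[OF refl])
    fix i
    let ?r = "mix_density p (y i) T / mix_density p (y i) \<eta>"
    have r: "?r > 0" using pT[of "y i"] pe[of "y i"] by simp
    have "ln (mix_density p (y i) T) - ln (mix_density p (y i) \<eta>) = ln ?r"
      using pT[of "y i"] pe[of "y i"] by (simp add: ln_div)
    moreover have "exp (ln ?r / 2) = exp (ln (sqrt ?r))"
      using r by (simp only: ln_sqrt)
    moreover have "exp (ln (sqrt ?r)) = sqrt ?r"
      using r by (intro exp_ln) simp
    ultimately show "exp ((ln (mix_density p (y i) T) - ln (mix_density p (y i) \<eta>)) / 2) = sqrt ?r" by simp
  qed
  also have "\<dots> \<le> (\<Prod>i<n. sqrt (U (y i) / mix_density p (y i) \<eta>))"
    using pT pe U by (intro prod_mono conjI real_sqrt_le_mono divide_right_mono) (auto intro: less_imp_le)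
  finally show ?thesis .
qed

text \<open>
  By subadditivity of the square root, enlarging the density by \<open>d\<^sup>2 G\<close> costs only \<open>O(d)\<close>. For
  \<open>d = 1/n\<close> this is harmless after taking the \<open>n\<close>-th power, which is why the net has mesh \<open>n\<^sup>-\<^sup>2\<close>.
\<close>
lemma sqrt_ratio_integral:
  assumes p: "0 < p" "p < 1" and m: "0 < m"
    and e: "\<eta>' \<in> param_box M m V" "\<eta> \<in> param_box M m V"
    and [measurable]: "G \<in> borel_measurable borel" and G: "integrable lborel G" "\<And>x. G x \<ge> 0" and d: "d \<ge> 0"
  shows "(\<integral>\<^sup>+ x. ennreal (mix_density p x \<eta>) * ennreal (sqrt ((mix_density p x \<eta>' + d^2 * G x) / mix_density p x \<eta>)) \<partial>lborel)
    \<le> ennreal (affinity p \<eta>' \<eta> + d * ((integral\<^sup>L lborel G + 1) / 2))"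
proof -
  let ?g = "\<lambda>x. mix_density p x \<eta>" and ?f = "\<lambda>x. mix_density p x \<eta>'"
  note pf = mix_density_pos[OF p m e(1)] and pg = mix_density_pos[OF p m e(2)]
  have if1: "integrable lborel ?f" "integrable lborel ?g" "integral\<^sup>L lborel ?g = 1"
    using mix_density_integral_1[OF m e(1), of p] mix_density_integral_1[OF m e(2), of p] by (auto simp: has_bochner_integral_iff)
  have i1: "integrable lborel (\<lambda>x. sqrt (?f x * ?g x))"
    by (rule sqrt_product_integrable) (use if1 pf pg in \<open>auto intro: less_imp_le\<close>)
  have i2: "integrable lborel (\<lambda>x. sqrt (G x * ?g x))"
    "(\<integral>x. sqrt (G x * ?g x) \<partial>lborel) \<le> (integral\<^sup>L lborel G + 1) / 2"
    using sqrt_product_integrable[of G ?g] if1 pf pg G by (auto intro: less_imp_le)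
  have "?g x * sqrt ((?f x + d^2 * G x) / ?g x) \<le> sqrt (?f x * ?g x) + d * sqrt (G x * ?g x)" for x
  proof -
    have "?g x * sqrt ((?f x + d^2 * G x) / ?g x) = sqrt ((?f x + d^2 * G x) * ?g x)"
    proof -
      have "?g x * sqrt ((?f x + d^2 * G x) / ?g x) = sqrt (?g x ^ 2 * ((?f x + d^2 * G x) / ?g x))"
        using pg[of x] by (simp only: real_sqrt_mult real_sqrt_abs abs_of_pos)
      also have "?g x ^ 2 * ((?f x + d^2 * G x) / ?g x) = (?f x + d^2 * G x) * ?g x"
        using pg[of x] by (simp add: power2_eq_square)
      finally show ?thesis .
    qed
    also have "\<dots> = sqrt (?f x * ?g x + d^2 * (G x * ?g x))" by (simp add: algebra_simps)
    also have "\<dots> \<le> sqrt (?f x * ?g x) + sqrt (d^2 * (G x * ?g x))"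
      using pf[of x] pg[of x] G(2)[of x] by (intro sqrt_add_le_add_sqrt) auto
    also have "sqrt (d^2 * (G x * ?g x)) = d * sqrt (G x * ?g x)" using d by (simp add: real_sqrt_mult)
    finally show ?thesis .
  qed
  hence "(\<integral>\<^sup>+ x. ennreal (?g x) * ennreal (sqrt ((?f x + d^2 * G x) / ?g x)) \<partial>lborel)
    \<le> (\<integral>\<^sup>+ x. ennreal (sqrt (?f x * ?g x) + d * sqrt (G x * ?g x)) \<partial>lborel)"
    using pg by (intro nn_integral_mono) (simp add: less_imp_le ennreal_leI flip: ennreal_mult')
  also have "\<dots> = ennreal (\<integral>x. sqrt (?f x * ?g x) + d * sqrt (G x * ?g x) \<partial>lborel)"
    using i1 i2 d pf[THEN less_imp_le] pg[THEN less_imp_le] G(2)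
    by (intro nn_integral_eq_integral) (auto intro!: AE_I2 add_nonneg_nonneg mult_nonneg_nonneg)
  also have "(\<integral>x. sqrt (?f x * ?g x) + d * sqrt (G x * ?g x) \<partial>lborel) \<le> affinity p \<eta>' \<eta> + d * ((integral\<^sup>L lborel G + 1) / 2)"
    using i1 i2(1) mult_left_mono[OF i2(2) d] by (simp add: affinity_def)
  finally show ?thesis by (simp add: ennreal_leI)
qed

text \<open>
  Unless \<open>\<psi>\<^sup>6\<close> is below the threshold \<open>a = A \<surd>(log n / n)\<close>, some net point \<open>j\<close> at loss \<open>\<psi>\<^sup>6 \<ge> b\<close> from
  the truth has a statistic as in \<open>mle_sqrt_ratio_ge_1\<close> that is at least one. The loss is therefore
  pointwise at most \<open>a\<^sup>1\<^sup>/\<^sup>6\<close> plus its maximum times the sum of these statistics, and it suffices to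
  integrate this bound.
\<close>
lemma mle_risk_bound:
  assumes p: "0 < p" "p < 1 / 2" and m: "0 < m" "m \<le> V" and M: "M \<ge> 0"
    and H: "H \<subseteq> param_box M m V"
  shows "\<exists>C>0. \<forall>n\<ge>2. \<forall>T. is_mle p H n T \<longrightarrow>
    (\<forall>\<eta>\<in>H. risk p 6 n T \<eta> \<le> ennreal (C * (ln (real n) / real n) powr (1 / 12)))"
proof -
  have p1: "p < 1" using p by simp
  have V: "V > 0" using m by simp
  obtain c where c: "c > 0" "\<forall>\<eta>\<in>param_box M m V. \<forall>\<eta>'\<in>param_box M m V. affinity p \<eta> \<eta>' \<le> 1 - c * (psi6 \<eta> \<eta>')^2"
    using affinity_upper_bound[OF p m M] by blast
  obtain L where L: "L > 0" "\<forall>\<eta>\<in>param_box M m V. \<forall>\<eta>'\<in>param_box M m V. \<forall>x.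
    \<bar>mix_density p x \<eta> - mix_density p x \<eta>'\<bar> \<le> L * l1_dist \<eta> \<eta>' * ((1 + x^2) * gauss_env V x)"
    using mix_density_lipschitz[OF p m(1) M] by blast
  define G where "G x = 3 * L * ((1 + x^2) * gauss_env V x)" for x
  have [measurable]: "G \<in> borel_measurable borel" unfolding G_def[abs_def] by measurable
  have G0: "G x \<ge> 0" for x using L(1) gauss_env_pos[OF V, of x] by (simp add: G_def)
  have Gi: "integrable lborel G"
  proof -
    have "integrable lborel (\<lambda>x. 3 * L * (gauss_env V x * x ^ 0 + gauss_env V x * x ^ 2))"
      by (intro integrable_mult_right Bochner_Integration.integrable_add gauss_env_moment_integrable V)
    thus ?thesis by (simp add: G_def[abs_def] algebra_simps)
  qed
  define I where "I = (integral\<^sup>L lborel G + 1) / 2"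
  have I: "I > 0" using G0 by (simp add: I_def add_nonneg_pos Bochner_Integration.integral_nonneg)
  define R where "R = max M V"
  have R: "R > 0" using V by (simp add: R_def)
  \<comment> \<open>With \<open>b = a / 128\<close> each net point contributes at most \<open>O(n\<^sup>-\<^sup>7)\<close> to the expectation, against \<open>O(n\<^sup>6)\<close> net points; the first bound makes the mesh negligible compared with \<open>a\<close>.\<close>
  define A where "A = max 768 (sqrt (7 * 16384 / c))"
  have A: "A \<ge> 768" "c * A^2 \<ge> 7 * 16384"
  proof -
    show "A \<ge> 768" by (simp add: A_def)
    have "sqrt (7 * 16384 / c) ^ 2 \<le> A^2" using c by (intro power_mono) (auto simp: A_def)
    hence "7 * 16384 / c \<le> A^2" using c by simp
    thus "c * A^2 \<ge> 7 * 16384" using c by (simp add: field_simps)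
  qed
  define Dm where "Dm = ((2 * R) ^ 6 + (2 * R) ^ 3 + (2 * R) ^ 3) powr (1 / 6)"
  have Dm: "psi_loss 6 \<eta> \<eta>' \<le> Dm" if "\<eta> \<in> param_box M m V" "\<eta>' \<in> param_box M m V" for \<eta> \<eta>'
  proof -
    obtain \<theta> v1 v2 \<theta>' v1' v2' where e: "\<eta> = (\<theta>, v1, v2)" "\<eta>' = (\<theta>', v1', v2')"
      by (metis prod.exhaust)
    have "\<bar>\<theta> - \<theta>'\<bar> \<le> 2 * R" "\<bar>v1 - v1'\<bar> \<le> 2 * R" "\<bar>v2 - v2'\<bar> \<le> 2 * R"
      using that m by (auto simp: e param_box_def R_def)
    hence "psi6 \<eta> \<eta>' \<le> (2 * R) ^ 6 + (2 * R) ^ 3 + (2 * R) ^ 3"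
      unfolding psi6_def e prod.case by (intro add_mono power_mono) auto
    thus ?thesis unfolding psi_loss_6 Dm_def using psi6_nonneg by (intro powr_mono2) auto
  qed
  have Dm0: "Dm \<ge> 0" by (simp add: Dm_def)
  define C where "C = A powr (1 / 6) + 2 * (Dm * (2 * R + 3) ^ 3 * exp I)"
  have C: "C > 0" using A Dm0 R by (auto simp: C_def intro!: add_pos_nonneg)
  show ?thesis
  proof (intro exI[of _ C] conjI allI impI ballI C)
    fix n T \<eta> assume n: "(n::nat) \<ge> 2" and T: "is_mle p H n T" and \<eta>: "\<eta> \<in> H"
    define q where "q = ln (real n) / real n"
    have n0: "real n > 0" using n by simp
    have lnn: "ln (real n) \<ge> 1 / 2"
    proof -
      have "ln (real n) \<ge> ln 2" using n by simp
      thus ?thesis using ln2_ge_two_thirds by linarith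
    qed
    have q: "q > 0" "q \<ge> 1 / (2 * real n)" using n lnn by (auto simp: q_def field_simps)
    define e where "e = 1 / (real n)^2"
    define a where "a = A * sqrt q"
    define b where "b = a / 128"
    have e: "e > 0" "e \<le> 1" "e = (1 / real n)^2"
      using n by (auto simp: e_def power_divide)
    have a0: "a > 0" using A q by (simp add: a_def)
    have ae: "a \<ge> 384 * e ^ 3"
    proof -
      have "e ^ 3 \<le> e ^ 1" using e by (intro power_decreasing) auto
      also have "e ^ 1 \<le> 1 / real n" using n by (simp add: e_def field_simps power2_eq_square)
      finally have 1: "384 * e ^ 3 \<le> 768 * (1 / (2 * real n))" by simp
      have "1 / (2 * real n) = sqrt ((1 / (2 * real n)) ^ 2)" by simp
      also have "\<dots> \<le> sqrt q"
      proof (rule real_sqrt_le_mono)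
        have "(1 / (2 * real n)) ^ 2 \<le> (1 / (2 * real n)) ^ 1" using n by (intro power_decreasing) auto
        thus "(1 / (2 * real n)) ^ 2 \<le> q" using q by simp
      qed
      finally have "768 * (1 / (2 * real n)) \<le> A * sqrt q" using A q by (intro mult_mono) auto
      thus ?thesis using 1 by (simp add: a_def)
    qed
    obtain N where N: "finite N" "N \<subseteq> H" "real (card N) \<le> (2 * (R / e) + 3) ^ 3"
      "\<forall>\<theta> v1 v2. (\<theta>, v1, v2) \<in> H \<longrightarrow> (\<exists>\<theta>' v1' v2'. (\<theta>', v1', v2') \<in> N \<and>
        \<bar>\<theta> - \<theta>'\<bar> \<le> e \<and> \<bar>v1 - v1'\<bar> \<le> e \<and> \<bar>v2 - v2'\<bar> \<le> e)"
      using finite_net[OF H m M e(1)] unfolding R_def by blast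
    define J where "J = {j \<in> N. psi6 j \<eta> \<ge> b}"
    have J: "finite J" "J \<subseteq> N" using N(1) by (auto simp: J_def)
    define u where "u j x = sqrt ((mix_density p x j + (1 / real n)^2 * G x) / mix_density p x \<eta>)" for j x
    have um [measurable]: "u j \<in> borel_measurable borel" for j unfolding u_def[abs_def] by measurable
    have \<eta>B: "\<eta> \<in> param_box M m V" using \<eta> H by blast
    have u0: "u j x \<ge> 0" if "j \<in> J" for j x
    proof -
      have "j \<in> param_box M m V" using that J(2) N(2) H by blast
      thus ?thesis
        using G0[of x] mix_density_pos[OF p(1) p1 m(1) \<eta>B, of x] mix_density_pos[OF p(1) p1 m(1), of j M V x]
        by (simp add: u_def)
    qed
    have ptw: "psi_loss 6 (T y) \<eta> \<le> A powr (1 / 6) * q powr (1 / 12) + Dm * (\<Sum>j\<in>J. \<Prod>i<n. u j (y i))"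
      if y: "y \<in> space (sample_space n)" for y
    proof -
      have TH: "T y \<in> H" "log_lik p n y \<eta> \<le> log_lik p n y (T y)"
        using T y \<eta> unfolding is_mle_def is_arg_max_def by (blast, metis not_less)
      have TB: "T y \<in> param_box M m V" using TH H by blast
      have nn: "0 \<le> (\<Sum>j\<in>J. \<Prod>i<n. u j (y i))" by (intro sum_nonneg prod_nonneg u0)
      show ?thesis
      proof (cases "psi6 (T y) \<eta> \<le> a")
        case True
        have "psi_loss 6 (T y) \<eta> \<le> a powr (1 / 6)"
          unfolding psi_loss_6 using True psi6_nonneg by (intro powr_mono2) auto
        also have "a powr (1 / 6) = A powr (1 / 6) * q powr (1 / 12)"
          using A q unfolding a_def by (subst powr_mult) (auto simp: powr_half_sqrt[symmetric] powr_powr)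
        finally show ?thesis using nn Dm0 by (simp add: add_increasing2)
      next
        case False
        obtain \<theta> v1 v2 where t: "T y = (\<theta>, v1, v2)" by (metis prod.exhaust)
        obtain \<theta>' v1' v2' where j: "(\<theta>', v1', v2') \<in> N"
          "\<bar>\<theta> - \<theta>'\<bar> \<le> e" "\<bar>v1 - v1'\<bar> \<le> e" "\<bar>v2 - v2'\<bar> \<le> e"
          using N(4) TH(1) unfolding t by blast
        define j where "j = (\<theta>', v1', v2')"
        have "psi6 (T y) \<eta> \<le> 64 * (psi6 j \<eta> + 3 * e ^ 3)"
          unfolding t j_def using j e by (intro psi6_perturb) auto
        hence "psi6 j \<eta> \<ge> b" using False ae by (simp add: b_def)
        hence jJ: "j \<in> J" using j by (simp add: J_def j_def)
        have jB: "j \<in> param_box M m V" using j N(2) H by (auto simp: j_def)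
        have l1: "l1_dist (T y) j \<le> 3 * e" using j by (simp add: l1_dist_def t j_def)
        have "mix_density p x (T y) \<le> mix_density p x j + (1 / real n)^2 * G x" for x
        proof -
          have "\<bar>mix_density p x (T y) - mix_density p x j\<bar> \<le> L * l1_dist (T y) j * ((1 + x^2) * gauss_env V x)"
            using L(2) TB jB by blast
          also have "\<dots> \<le> L * (3 * e) * ((1 + x^2) * gauss_env V x)"
            using L(1) l1 gauss_env_pos[OF V, of x] by (intro mult_right_mono mult_left_mono) auto
          also have "\<dots> = (1 / real n)^2 * G x" by (simp add: G_def e(3))
          finally show ?thesis by linarith
        qed
        hence "1 \<le> (\<Prod>i<n. u j (y i))"
          unfolding u_def by (intro mle_sqrt_ratio_ge_1[OF p(1) p1 m(1) TB \<eta>B TH(2)])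
        also have "\<dots> \<le> (\<Sum>j\<in>J. \<Prod>i<n. u j (y i))"
          by (rule member_le_sum[OF jJ]) (auto intro!: prod_nonneg u0 simp: J)
        finally have "Dm * 1 \<le> Dm * (\<Sum>j\<in>J. \<Prod>i<n. u j (y i))" using Dm0 by (intro mult_left_mono) auto
        moreover have "psi_loss 6 (T y) \<eta> \<le> Dm" using Dm TB \<eta>B by blast
        moreover have "A powr (1 / 6) * q powr (1 / 12) \<ge> 0" by simp
        ultimately show ?thesis by linarith
      qed
    qed
    have Lm [measurable]: "(\<lambda>y. \<Prod>i<n. ennreal (u j (y i))) \<in> borel_measurable (sample_law p n \<eta>)" for j
      unfolding measurable_cong_sets[OF sets_sample_law refl] sample_space_def by measurable
    have Ej: "(\<integral>\<^sup>+ y. (\<Prod>i<n. ennreal (u j (y i))) \<partial>sample_law p n \<eta>) \<le> ennreal (exp I / real n ^ 7)" if j: "j \<in> J" for j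
    proof -
      have jB: "j \<in> param_box M m V" using j J N H by blast
      have "(\<integral>\<^sup>+ y. (\<Prod>i<n. ennreal (u j (y i))) \<partial>sample_law p n \<eta>) = (\<integral>\<^sup>+ x. ennreal (mix_density p x \<eta>) * ennreal (u j x) \<partial>lborel) ^ n"
        by (rule nn_integral_sample_prod[OF p(1) p1 m(1) \<eta>B]) measurable
      also have "\<dots> \<le> ennreal (exp (I / real n - c * b^2)) ^ n"
      proof (rule power_mono)
        have "(\<integral>\<^sup>+ x. ennreal (mix_density p x \<eta>) * ennreal (u j x) \<partial>lborel) \<le> ennreal (affinity p j \<eta> + 1 / real n * I)"
          unfolding u_def I_def by (rule sqrt_ratio_integral[OF p(1) p1 m(1) jB \<eta>B _ Gi G0]) auto
        also have "affinity p j \<eta> + 1 / real n * I \<le> 1 + (I / real n - c * b^2)"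
        proof -
          have "affinity p j \<eta> \<le> 1 - c * (psi6 j \<eta>)^2" using c(2) jB \<eta>B by blast
          moreover have "c * b^2 \<le> c * (psi6 j \<eta>)^2"
            using j a0 c(1) by (intro mult_left_mono power_mono) (auto simp: J_def b_def)
          ultimately show ?thesis by simp
        qed
        also have "\<dots> \<le> exp (I / real n - c * b^2)" by (rule exp_ge_add_one_self)
        finally show "(\<integral>\<^sup>+ x. ennreal (mix_density p x \<eta>) * ennreal (u j x) \<partial>lborel) \<le> ennreal (exp (I / real n - c * b^2))"
          by (simp add: ennreal_leI)
      qed simp
      also have "\<dots> = ennreal (exp (I - real n * (c * b^2)))"
        using n by (simp add: ennreal_power exp_of_nat_mult[symmetric] right_diff_distrib)
      also have "real n * (c * b^2) \<ge> 7 * ln (real n)"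
      proof -
        have "7 * ln (real n) \<le> c * A^2 / 16384 * ln (real n)" using A lnn by (intro mult_right_mono) auto
        also have "\<dots> = real n * (c * b^2)"
          using q n by (simp add: b_def a_def power_divide power_mult_distrib q_def)
        finally show ?thesis .
      qed
      hence "exp (I - real n * (c * b^2)) \<le> exp (I - 7 * ln (real n))" by simp
      also have "exp (I - 7 * ln (real n)) = exp I / real n ^ 7"
        using n0 by (simp add: exp_diff exp_of_nat_mult[of 7 "ln (real n)", simplified])
      finally show ?thesis by (simp add: ennreal_leI)
    qed
    have "risk p 6 n T \<eta> \<le> (\<integral>\<^sup>+ y. ennreal (A powr (1 / 6) * q powr (1 / 12)) + ennreal Dm * (\<Sum>j\<in>J. \<Prod>i<n. ennreal (u j (y i))) \<partial>sample_law p n \<eta>)"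
      unfolding risk_def
    proof (rule nn_integral_mono)
      fix y assume "y \<in> space (sample_law p n \<eta>)"
      hence y: "y \<in> space (sample_space n)" by (simp add: space_sample_law)
      have "(\<Sum>j\<in>J. \<Prod>i<n. ennreal (u j (y i))) = ennreal (\<Sum>j\<in>J. \<Prod>i<n. u j (y i))"
        by (subst sum_ennreal[symmetric]) (auto intro!: sum.cong prod_ennreal prod_nonneg u0)
      thus "ennreal (psi_loss 6 (T y) \<eta>) \<le> ennreal (A powr (1 / 6) * q powr (1 / 12)) + ennreal Dm * (\<Sum>j\<in>J. \<Prod>i<n. ennreal (u j (y i)))"
        using ptw[OF y] Dm0
        by (simp add: sum_nonneg prod_nonneg u0 ennreal_leI flip: ennreal_plus ennreal_mult)
    qed
    also have "\<dots> = ennreal (A powr (1 / 6) * q powr (1 / 12)) + ennreal Dm * (\<Sum>j\<in>J. \<integral>\<^sup>+ y. (\<Prod>i<n. ennreal (u j (y i))) \<partial>sample_law p n \<eta>)"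
    proof -
      interpret S: prob_space "sample_law p n \<eta>" using p(1) p1 m(1) \<eta>B by (rule prob_space_sample_law)
      show ?thesis
        by (subst nn_integral_add, measurable, subst nn_integral_cmult, measurable, subst nn_integral_sum, measurable)
          (simp add: S.emeasure_space_1)
    qed
    also have "\<dots> \<le> ennreal (A powr (1 / 6) * q powr (1 / 12)) + ennreal Dm * (\<Sum>j\<in>J. ennreal (exp I / real n ^ 7))"
      by (intro add_left_mono mult_left_mono sum_mono Ej) auto
    also have "\<dots> = ennreal (A powr (1 / 6) * q powr (1 / 12) + Dm * (real (card J) * (exp I / real n ^ 7)))"
      using Dm0 by (simp add: ennreal_of_nat_eq_real_of_nat flip: ennreal_plus ennreal_mult ennreal_mult')
    also have "\<dots> \<le> ennreal (C * q powr (1 / 12))"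
    proof (rule ennreal_leI)
      have "real (card J) \<le> real (card N)" using card_mono[OF N(1) J(2)] by simp
      also note N(3)
      also have "(2 * (R / e) + 3) ^ 3 \<le> ((2 * R + 3) * real n ^ 2) ^ 3"
      proof (rule power_mono)
        have "3 * 1 \<le> 3 * real n ^ 2" using n by (intro mult_left_mono) auto
        thus "2 * (R / e) + 3 \<le> (2 * R + 3) * real n ^ 2" by (simp add: e_def algebra_simps)
      qed (use R e in simp)
      finally have cJ: "real (card J) \<le> (2 * R + 3) ^ 3 * real n ^ 6"
        by (simp add: power_mult_distrib flip: power_mult)
      have "real (card J) * (exp I / real n ^ 7) \<le> (2 * R + 3) ^ 3 * real n ^ 6 * (exp I / real n ^ 7)"
        using cJ by (intro mult_right_mono) auto
      also have "\<dots> = (2 * R + 3) ^ 3 * exp I * (1 / real n)"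
        using n0 by (simp add: field_simps eval_nat_numeral)
      also have "1 / real n \<le> 2 * q powr (1 / 12)"
      proof -
        define z where "z = 1 / (2 * real n)"
        have z: "0 < z" "z \<le> 1" "z \<le> q" using n q by (auto simp: z_def)
        have "z powr 1 \<le> z powr (1 / 12)" using z by (intro powr_mono') auto
        also have "\<dots> \<le> q powr (1 / 12)" using z by (intro powr_mono2) auto
        finally show ?thesis using z by (simp add: z_def)
      qed
      hence "(2 * R + 3) ^ 3 * exp I * (1 / real n) \<le> (2 * R + 3) ^ 3 * exp I * (2 * q powr (1 / 12))"
        using R by (intro mult_left_mono) auto
      finally have "Dm * (real (card J) * (exp I / real n ^ 7)) \<le> Dm * ((2 * R + 3) ^ 3 * exp I * (2 * q powr (1 / 12)))"
        using Dm0 by (intro mult_left_mono) auto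
      thus "A powr (1 / 6) * q powr (1 / 12) + Dm * (real (card J) * (exp I / real n ^ 7)) \<le> C * q powr (1 / 12)"
        by (simp add: C_def algebra_simps)
    qed
    finally show "risk p 6 n T \<eta> \<le> ennreal (C * (ln (real n) / real n) powr (1 / 12))" by (simp add: q_def)
  qed
qed

section \<open>A pair of parameters that is hard to distinguish\<close>

text \<open>
  The derivatives of order \<open>k \<le> 3\<close> with respect to \<open>t\<close> of \<open>t exp (- t\<^sup>2 x\<^sup>2 / 2)\<close>, which is
  \<open>\<surd>(2 \<pi>)\<close> times the density of \<open>N(0, 1 / t\<^sup>2)\<close>. Parametrised by the inverse standard deviation, the
  derivatives are polynomials times the exponential; in the variance they are less convenient, and
  the cancellation used below is the same for every smooth parametrisation.
\<close>
definition prec_gauss :: "nat \<Rightarrow> real \<Rightarrow> real \<Rightarrow> real" where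
  "prec_gauss k x t = exp (- (t^2 * x^2 / 2)) *
     (if k = 0 then t else if k = 1 then 1 - t^2 * x^2
      else if k = 2 then t^3 * x^4 - 3 * t * x^2
      else 6 * t^2 * x^4 - 3 * x^2 - t^4 * x^6)"

lemma prec_gauss_deriv:
  assumes "k < 3"
  shows "(prec_gauss k x has_real_derivative prec_gauss (Suc k) x t) (at t)"
proof -
  have E: "((\<lambda>t. exp (- (t^2 * x^2 / 2))) has_real_derivative - (t * x^2) * exp (- (t^2 * x^2 / 2))) (at t)"
    by (auto intro!: derivative_eq_intros)
  consider "k = 0" | "k = 1" | "k = 2" using assms by linarith
  thus ?thesis
  proof cases
    case 1
    have "((\<lambda>t. exp (- (t^2 * x^2 / 2)) * t) has_real_derivative
       - (t * x^2) * exp (- (t^2 * x^2 / 2)) * t + 1 * exp (- (t^2 * x^2 / 2))) (at t)"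
      by (rule DERIV_mult[OF E DERIV_ident])
    thus ?thesis using 1 by (simp add: prec_gauss_def[abs_def] algebra_simps power2_eq_square)
  next
    case 2
    have P: "((\<lambda>t. 1 - t^2 * x^2) has_real_derivative - (2 * t * x^2)) (at t)"
      by (auto intro!: derivative_eq_intros)
    show ?thesis using DERIV_mult[OF E P] 2
      by (simp add: prec_gauss_def[abs_def] algebra_simps eval_nat_numeral)
  next
    case 3
    have P: "((\<lambda>t. t^3 * x^4 - 3 * t * x^2) has_real_derivative 3 * t^2 * x^4 - 3 * x^2) (at t)"
      by (auto intro!: derivative_eq_intros)
    show ?thesis using DERIV_mult[OF E P] 3
      by (simp add: prec_gauss_def[abs_def] algebra_simps eval_nat_numeral)
  qed
qed

lemma prec_gauss_0: "prec_gauss 0 x t = t * exp (- (t^2 * x^2 / 2))"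
  by (simp add: prec_gauss_def)

lemma gauss_precision:
  assumes "t > 0"
  shows "gauss x 0 (1 / t^2) = prec_gauss 0 x t / sqrt (2 * pi)"
  using assms by (simp add: gauss_def normal_density_def prec_gauss_0 real_sqrt_divide field_simps)

text \<open>
  A bound of the third derivative for \<open>t\<close> within \<open>t0 / 10\<close> of \<open>t0\<close>; the constant is
  \<open>81/200 = (9/10)\<^sup>2 / 2\<close>.
\<close>
definition prec_bound :: "real \<Rightarrow> real \<Rightarrow> real" where
  "prec_bound t0 x = exp (- (81 / 200 * t0^2 * x^2)) * (3 * x^2 + 8 * t0^2 * x^4 + 2 * t0^4 * x^6)"

lemma prec_gauss_3_bound:
  assumes t0: "t0 > 0" and t: "\<bar>t - t0\<bar> \<le> t0 / 10"
  shows "\<bar>prec_gauss 3 x t\<bar> \<le> prec_bound t0 x"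
proof -
  have tb: "9 / 10 * t0 \<le> t" "t \<le> 11 / 10 * t0" using t by linarith+
  have "(9 / 10 * t0)^2 \<le> t^2" using tb t0 by (intro power_mono) auto
  hence lo: "81 / 100 * t0^2 \<le> t^2" by (simp add: power_mult_distrib power_divide)
  have "t^2 \<le> (11 / 10 * t0)^2" using tb t0 by (intro power_mono) auto
  hence t2: "t^2 \<le> 121 / 100 * t0^2" by (simp add: power_mult_distrib power_divide)
  have "t^4 \<le> (11 / 10 * t0)^4" using tb t0 by (intro power_mono) auto
  also have "\<dots> = 14641 / 10000 * t0^4" by (simp add: power_mult_distrib power_divide)
  also have "\<dots> \<le> 2 * t0^4" by simp
  finally have t4: "t^4 \<le> 2 * t0^4" .
  have "\<bar>6 * t^2 * x^4 - 3 * x^2 - t^4 * x^6\<bar> \<le> 6 * t^2 * x^4 + 3 * x^2 + t^4 * x^6"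
  proof -
    have "6 * t^2 * x^4 \<ge> 0" "3 * x^2 \<ge> 0" "t^4 * x^6 \<ge> 0" by simp_all
    thus ?thesis by (intro abs_leI) linarith+
  qed
  also have "\<dots> \<le> 8 * t0^2 * x^4 + 3 * x^2 + 2 * t0^4 * x^6"
  proof (intro add_mono mult_right_mono order_refl t4)
    show "6 * t^2 \<le> 8 * t0^2" using t2 zero_le_power2[of t0] by linarith
  qed auto
  finally have poly: "\<bar>6 * t^2 * x^4 - 3 * x^2 - t^4 * x^6\<bar> \<le> 3 * x^2 + 8 * t0^2 * x^4 + 2 * t0^4 * x^6" by simp
  have "81 / 100 * t0^2 * x^2 \<le> t^2 * x^2" using lo by (intro mult_right_mono) auto
  hence ex: "exp (- (t^2 * x^2 / 2)) \<le> exp (- (81 / 200 * t0^2 * x^2))" by simp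
  show ?thesis
    unfolding prec_bound_def prec_gauss_def abs_mult using poly ex
    by (intro mult_mono) auto
qed

text \<open>
  The symmetric difference has no term of second order, so what remains after the linear term is
  cubic.
\<close>
lemma prec_gauss_symmetric_diff:
  assumes t0: "t0 > 0" and h: "0 < h" "h \<le> t0 / 10"
  shows "\<bar>prec_gauss 0 x (t0 + h) - prec_gauss 0 x (t0 - h) - 2 * h * prec_gauss 1 x t0\<bar> \<le> h^3 / 3 * prec_bound t0 x"
proof -
  let ?F = "\<lambda>k. prec_gauss k x"
  define diff where "diff k s = (if k = 0 then ?F 0 (t0 + s) - ?F 0 (t0 - s) - 2 * s * ?F 1 t0
      else if k = 1 then ?F 1 (t0 + s) + ?F 1 (t0 - s) - 2 * ?F 1 t0
      else if k = 2 then ?F 2 (t0 + s) - ?F 2 (t0 - s)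
      else ?F 3 (t0 + s) + ?F 3 (t0 - s))" for k :: nat and s
  have dp: "((\<lambda>s. ?F k (t0 + s)) has_real_derivative ?F (Suc k) (t0 + s)) (at s)" if "k < 3" for k s
    by (rule DERIV_cong[OF DERIV_chain2[OF prec_gauss_deriv[OF that], where Db = 1]])
      (auto intro!: derivative_eq_intros)
  have dm: "((\<lambda>s. ?F k (t0 - s)) has_real_derivative - ?F (Suc k) (t0 - s)) (at s)" if "k < 3" for k s
    by (rule DERIV_cong[OF DERIV_chain2[OF prec_gauss_deriv[OF that], where Db = "- 1"]])
      (auto intro!: derivative_eq_intros)
  have D: "DERIV (diff k) s :> diff (Suc k) s" if k3: "k < 3" for k s
  proof -
    consider "k = 0" | "k = 1" | "k = 2" using k3 by linarith
    thus ?thesis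
    proof cases
      case 1
      show ?thesis unfolding 1 diff_def[abs_def] using dp[of 0 s] dm[of 0 s]
        by (auto intro!: derivative_eq_intros)
    next
      case 2
      show ?thesis unfolding 2 diff_def[abs_def] using dp[of 1 s] dm[of 1 s]
        by (auto intro!: derivative_eq_intros simp: numeral_2_eq_2)
    next
      case 3
      show ?thesis unfolding 3 diff_def[abs_def] using dp[of 2 s] dm[of 2 s]
        by (auto intro!: derivative_eq_intros simp: numeral_3_eq_3 numeral_2_eq_2)
    qed
  qed
  obtain s where s: "0 < s" "s < h"
    "diff 0 h = (\<Sum>k<3. diff k 0 / fact k * h ^ k) + diff 3 s / fact 3 * h ^ 3"
    using Maclaurin[of h 3 diff "diff 0"] h D by auto
  have "(\<Sum>k<3. diff k 0 / fact k * h ^ k) = 0"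
    by (simp add: diff_def numeral_3_eq_3)
  hence e: "diff 0 h = diff 3 s / 6 * h ^ 3" using s(3) by (simp add: fact_numeral)
  have "\<bar>diff 3 s\<bar> \<le> \<bar>?F 3 (t0 + s)\<bar> + \<bar>?F 3 (t0 - s)\<bar>"
    by (simp add: diff_def)
  also have "\<dots> \<le> prec_bound t0 x + prec_bound t0 x"
    using s h by (intro add_mono prec_gauss_3_bound t0) auto
  finally have "\<bar>diff 3 s\<bar> * (h^3 / 6) \<le> (prec_bound t0 x + prec_bound t0 x) * (h^3 / 6)"
    using h by (intro mult_right_mono) auto
  hence "\<bar>diff 0 h\<bar> \<le> h^3 / 3 * prec_bound t0 x"
    using h unfolding e by (simp add: abs_mult field_simps)
  thus ?thesis by (simp add: diff_def)
qed

text \<open>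
  The inverse standard deviations of the two components are moved in opposite directions, in the
  ratio that keeps their mean with respect to the mixing weights. The hard pair consists of the
  points for \<open>d\<close> and \<open>- d\<close>.
\<close>
definition hard_point :: "real \<Rightarrow> real \<Rightarrow> real \<Rightarrow> param" where
  "hard_point p t0 d = (0, 1 / (t0 - (1 - p) * d)^2, 1 / (t0 + p * d)^2)"

lemma hard_point_density:
  assumes "\<bar>(1 - p) * d\<bar> < t0" "\<bar>p * d\<bar> < t0"
  shows "mix_density p x (hard_point p t0 d) =
    (p * prec_gauss 0 x (t0 - (1 - p) * d) + (1 - p) * prec_gauss 0 x (t0 + p * d)) / sqrt (2 * pi)"
proof -
  have "t0 - (1 - p) * d > 0" "t0 + p * d > 0" using assms by (auto simp: abs_less_iff)
  thus ?thesis
    by (simp add: mix_density_def hard_point_def gauss_precision add_divide_distrib)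
qed

text \<open>
  The difference of the two densities is a combination of two symmetric differences with steps
  \<open>p d\<close> and \<open>(1 - p) d\<close> and weights \<open>1 - p\<close> and \<open>p\<close>, so the linear terms cancel and it is
  \<open>O(d\<^sup>3)\<close>. Its square, divided by the first density, is integrable since the variances of all
  components involved are within a factor less than two.
\<close>
lemma hard_points_chi2:
  assumes p: "0 < p" "p < 1" and t0: "t0 > 0"
  shows "\<exists>K>0. \<forall>d. 0 < d \<longrightarrow> d \<le> t0 / 10 \<longrightarrow>
    (\<integral>\<^sup>+ x. ennreal ((mix_density p x (hard_point p t0 (-d)))^2 / mix_density p x (hard_point p t0 d)) \<partial>lborel)
      \<le> ennreal (1 + K * d^6)"
proof -
  define W where "W x = exp (- (41 / 200 * t0^2 * x^2)) * (3 * x^2 + 8 * t0^2 * x^4 + 2 * t0^4 * x^6)^2" for x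
  have Wi: "integrable lborel W"
  proof -
    \<comment> \<open>The exponential in \<open>W\<close> is a multiple of the density of \<open>N(0, s\<^sup>2)\<close>.\<close>
    define s where "s = sqrt (100 / (41 * t0^2))"
    have s: "s > 0" "s^2 = 100 / (41 * t0^2)" using t0 by (auto simp: s_def)
    have W: "W x = sqrt (2 * pi * s^2) * (9 * (normal_density 0 s x * (x - 0)^4)
        + (48 * t0^2) * (normal_density 0 s x * (x - 0)^6) + (12 * t0^4 + 64 * t0^4) * (normal_density 0 s x * (x - 0)^8)
        + (32 * t0^6) * (normal_density 0 s x * (x - 0)^10) + (4 * t0^8) * (normal_density 0 s x * (x - 0)^12))" for x
    proof -
      have n: "sqrt (2 * pi * s^2) * normal_density 0 s x = exp (- (41 / 200 * t0^2 * x^2))"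
        using t0 s by (simp add: normal_density_def field_simps)
      have "W x = (sqrt (2 * pi * s^2) * normal_density 0 s x) * (9 * x^4 + (48 * t0^2) * x^6 + (12 * t0^4 + 64 * t0^4) * x^8 + (32 * t0^6) * x^10 + (4 * t0^8) * x^12)"
        unfolding n W_def by (simp add: algebra_simps power_numeral_reduce)
      thus ?thesis by (simp add: algebra_simps)
    qed
    show ?thesis unfolding W
      by (intro integrable_mult_right Bochner_Integration.integrable_add integrable_normal_moment s)
  qed
  have W0: "W x \<ge> 0" for x by (simp add: W_def)
  define J where "J = integral\<^sup>L lborel W"
  have J: "J \<ge> 0" unfolding J_def using W0 by (intro Bochner_Integration.integral_nonneg)
  define k0 where "k0 = 10 / (9 * t0) / sqrt (2 * pi)"
  have k0: "k0 > 0" using t0 by (simp add: k0_def)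
  show ?thesis
  proof (intro exI[of _ "k0 * J + 1"] conjI allI impI)
    show "k0 * J + 1 > 0" using k0 J by (simp add: add_nonneg_pos)
    fix d :: real assume d: "0 < d" "d \<le> t0 / 10"
    let ?q = "1 - p"
    have q: "0 < ?q" "?q < 1" using p by auto
    have pd: "0 < p * d" "p * d \<le> t0 / 10" "0 < ?q * d" "?q * d \<le> t0 / 10"
    proof -
      have "p * d \<le> 1 * d" "?q * d \<le> 1 * d" using p q d by (intro mult_right_mono; simp)+
      thus "p * d \<le> t0 / 10" "?q * d \<le> t0 / 10" using d by linarith+
    qed (use p q d in auto)
    have pdl: "p * d < t0" "?q * d < t0" using pd t0 by linarith+
    define g1 g2 where "g1 x = mix_density p x (hard_point p t0 d)" and "g2 x = mix_density p x (hard_point p t0 (-d))" for x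
    have g1: "g1 x = (p * prec_gauss 0 x (t0 - ?q * d) + ?q * prec_gauss 0 x (t0 + p * d)) / sqrt (2 * pi)" for x
      unfolding g1_def using pd pdl by (subst hard_point_density) auto
    have g2: "g2 x = (p * prec_gauss 0 x (t0 + ?q * d) + ?q * prec_gauss 0 x (t0 - p * d)) / sqrt (2 * pi)" for x
      unfolding g2_def using pd pdl by (subst hard_point_density) auto
    have pos: "1 / (t0 - ?q * d)^2 > 0" "1 / (t0 + p * d)^2 > 0" "1 / (t0 + ?q * d)^2 > 0" "1 / (t0 - p * d)^2 > 0"
      using pd pdl t0 by (auto simp: zero_less_power2)
    have i1: "has_bochner_integral lborel g1 1"
      using mix_has_moments[OF pos(1,2), of p 0 0]
      by (simp add: g1_def[abs_def] hard_point_def mix_egf_def gauss_egf_nth)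
    have i2: "has_bochner_integral lborel g2 1"
      using mix_has_moments[OF pos(3,4), of p 0 0]
      by (simp add: g2_def[abs_def] hard_point_def mix_egf_def gauss_egf_nth)
    have lowF: "prec_gauss 0 x t \<ge> 9 / 10 * t0 * exp (- (121 / 200 * t0^2 * x^2))" if "\<bar>t - t0\<bar> \<le> t0 / 10" for t x
    proof -
      have tb: "9 / 10 * t0 \<le> t" "t \<le> 11 / 10 * t0" using that by linarith+
      have "t^2 \<le> (11 / 10 * t0)^2" using tb t0 by (intro power_mono) auto
      hence "t^2 * x^2 \<le> 121 / 100 * t0^2 * x^2" by (intro mult_right_mono) (simp_all add: power_mult_distrib power_divide)
      hence "exp (- (121 / 200 * t0^2 * x^2)) \<le> exp (- (t^2 * x^2 / 2))" by simp
      thus ?thesis unfolding prec_gauss_0 using tb t0 by (intro mult_mono) auto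
    qed
    have g1low: "g1 x \<ge> 9 / 10 * t0 * exp (- (121 / 200 * t0^2 * x^2)) / sqrt (2 * pi)" for x
    proof -
      let ?m = "9 / 10 * t0 * exp (- (121 / 200 * t0^2 * x^2))"
      have "p * ?m + ?q * ?m \<le> p * prec_gauss 0 x (t0 - ?q * d) + ?q * prec_gauss 0 x (t0 + p * d)"
        using p q pd by (intro add_mono mult_left_mono lowF) auto
      moreover have "p * c + ?q * c = c" for c by (simp add: algebra_simps)
      ultimately have "?m \<le> p * prec_gauss 0 x (t0 - ?q * d) + ?q * prec_gauss 0 x (t0 + p * d)"
        by (simp only:)
      thus ?thesis unfolding g1 by (intro divide_right_mono) auto
    qed
    have g1pos: "g1 x > 0" for x
      by (rule less_le_trans[OF _ g1low]) (use t0 in simp)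
    have diff: "\<bar>g1 x - g2 x\<bar> \<le> d^3 * prec_bound t0 x / sqrt (2 * pi)" for x
    proof -
      let ?F = "prec_gauss 0 x"
      define A1 where "A1 = ?F (t0 + p * d) - ?F (t0 - p * d) - 2 * (p * d) * prec_gauss 1 x t0"
      define A2 where "A2 = ?F (t0 + ?q * d) - ?F (t0 - ?q * d) - 2 * (?q * d) * prec_gauss 1 x t0"
      have b0: "prec_bound t0 x \<ge> 0" by (simp add: prec_bound_def)
      have c: "y^3 / 3 * prec_bound t0 x \<le> d^3 / 3 * prec_bound t0 x" if "0 < y" "y \<le> d" for y
        using that b0 by (intro mult_right_mono divide_right_mono power_mono) auto
      have le: "p * d \<le> d" "?q * d \<le> d" using p q d by (auto simp: mult_le_cancel_right1)
      have "\<bar>A1\<bar> \<le> d^3 / 3 * prec_bound t0 x"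
        unfolding A1_def using prec_gauss_symmetric_diff[OF t0 pd(1,2), of x] c[OF pd(1) le(1)] by linarith
      moreover have "\<bar>A2\<bar> \<le> d^3 / 3 * prec_bound t0 x"
        unfolding A2_def using prec_gauss_symmetric_diff[OF t0 pd(3,4), of x] c[OF pd(3) le(2)] by linarith
      moreover have "\<bar>?q * A1 - p * A2\<bar> \<le> \<bar>A1\<bar> + \<bar>A2\<bar>"
      proof -
        have "\<bar>?q * A1\<bar> \<le> 1 * \<bar>A1\<bar>" "\<bar>p * A2\<bar> \<le> 1 * \<bar>A2\<bar>"
          unfolding abs_mult using p q by (intro mult_right_mono; simp)+
        thus ?thesis by linarith
      qed
      moreover have "d^3 / 3 * prec_bound t0 x \<ge> 0" using d b0 by simp
      ultimately have "\<bar>?q * A1 - p * A2\<bar> \<le> d^3 * prec_bound t0 x" by linarith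
      moreover have "g1 x - g2 x = (?q * A1 - p * A2) / sqrt (2 * pi)"
        unfolding g1 g2 A1_def A2_def diff_divide_distrib[symmetric]
        by (rule arg_cong[of _ _ "\<lambda>z. z / sqrt (2 * pi)"]) (simp add: algebra_simps)
      ultimately show ?thesis by (simp add: divide_right_mono)
    qed
    have chi: "(g1 x - g2 x)^2 / g1 x \<le> k0 * d^6 * W x" for x
    proof -
      let ?m = "9 / 10 * t0 * exp (- (121 / 200 * t0^2 * x^2)) / sqrt (2 * pi)"
      have m: "?m > 0" using t0 by simp
      have "(g1 x - g2 x)^2 \<le> (d^3 * prec_bound t0 x / sqrt (2 * pi))^2"
        using diff[of x] by (metis abs_ge_zero power2_abs power_mono)
      hence "(g1 x - g2 x)^2 / g1 x \<le> (d^3 * prec_bound t0 x / sqrt (2 * pi))^2 / ?m"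
        using m g1low[of x] by (intro frac_le) auto
      also have "\<dots> = k0 * d^6 * W x"
      proof -
        define P where "P = 3 * x^2 + 8 * t0^2 * x^4 + 2 * t0^4 * x^6"
        define E where "E = exp (- (81 / 200 * t0^2 * x^2))"
        have EE: "E^2 / exp (- (121 / 200 * t0^2 * x^2)) = exp (- (41 / 200 * t0^2 * x^2))"
          by (simp add: E_def power2_eq_square flip: exp_add exp_diff)
        have "(d^3 * prec_bound t0 x / sqrt (2 * pi))^2 / ?m = k0 * d^6 * ((E^2 / exp (- (121 / 200 * t0^2 * x^2))) * P^2)"
          unfolding prec_bound_def P_def[symmetric] E_def[symmetric] k0_def using t0
          by (simp add: power_divide power_mult_distrib field_simps power2_eq_square power_numeral_reduce)
        thus ?thesis unfolding EE by (simp add: W_def P_def)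
      qed
      finally show ?thesis .
    qed
    have "g2 x ^ 2 / g1 x = 2 * g2 x - g1 x + (g1 x - g2 x)^2 / g1 x" for x
      using g1pos[of x] by (simp add: field_simps power2_eq_square)
    hence le: "g2 x ^ 2 / g1 x \<le> 2 * g2 x - g1 x + k0 * d^6 * W x" for x using chi[of x] by simp
    have nn: "0 \<le> 2 * g2 x - g1 x + k0 * d^6 * W x" for x
    proof -
      have "0 \<le> g2 x ^ 2 / g1 x" using g1pos[of x] by simp
      thus ?thesis using le[of x] by linarith
    qed
    have int: "has_bochner_integral lborel (\<lambda>x. 2 * g2 x - g1 x + k0 * d^6 * W x) (2 * 1 - 1 + k0 * d^6 * J)"
      by (intro has_bochner_integral_add has_bochner_integral_diff has_bochner_integral_mult_right i1 i2)
        (simp add: has_bochner_integral_iff J_def Wi)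
    have "(\<integral>\<^sup>+ x. ennreal (g2 x ^ 2 / g1 x) \<partial>lborel) \<le> (\<integral>\<^sup>+ x. ennreal (2 * g2 x - g1 x + k0 * d^6 * W x) \<partial>lborel)"
      by (intro nn_integral_mono ennreal_leI le)
    also have "\<dots> = ennreal (2 * 1 - 1 + k0 * d^6 * J)"
      using int nn by (subst nn_integral_eq_integral) (auto simp: has_bochner_integral_iff)
    also have "\<dots> \<le> ennreal (1 + (k0 * J + 1) * d^6)"
      using d by (intro ennreal_leI) (simp add: algebra_simps)
    finally show "(\<integral>\<^sup>+ x. ennreal ((mix_density p x (hard_point p t0 (-d)))^2 / mix_density p x (hard_point p t0 d)) \<partial>lborel)
      \<le> ennreal (1 + (k0 * J + 1) * d^6)"
      by (simp add: g1_def g2_def)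
  qed
qed

section \<open>Two-point lower bound for the minimax risk\<close>

lemma sample_law_density:
  assumes p: "0 < p" "p < 1" and m: "0 < m" and e: "\<eta> \<in> param_box M m V" "\<eta>' \<in> param_box M m V"
  shows "sample_law p n \<eta>' = density (sample_law p n \<eta>) (\<lambda>y. \<Prod>i<n. ennreal (mix_density p (y i) \<eta>' / mix_density p (y i) \<eta>))"
    (is "_ = ?D")
proof -
  note pg = mix_density_pos[OF p m e(1)] and pg' = mix_density_pos[OF p m e(2)]
  let ?l = "\<lambda>x. ennreal (mix_density p x \<eta>' / mix_density p x \<eta>)"
  interpret A: prob_space "density lborel (\<lambda>x. ennreal (mix_density p x \<eta>))"
    using p m e(1) by (rule prob_space_mix)
  interpret B: prob_space "density lborel (\<lambda>x. ennreal (mix_density p x \<eta>'))"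
    using p m e(2) by (rule prob_space_mix)
  interpret PA: product_sigma_finite "\<lambda>_::nat. density lborel (\<lambda>x. ennreal (mix_density p x \<eta>))"
    by standard
  interpret PB: product_sigma_finite "\<lambda>_::nat. density lborel (\<lambda>x. ennreal (mix_density p x \<eta>'))"
    by standard
  have Lm [measurable]: "(\<lambda>y. \<Prod>i<n. ?l (y i)) \<in> borel_measurable (sample_law p n \<eta>)"
    unfolding measurable_cong_sets[OF sets_sample_law refl] sample_space_def by measurable
  have "?D = (\<Pi>\<^sub>M i\<in>{..<n}. density lborel (\<lambda>x. ennreal (mix_density p x \<eta>')))"
  proof (rule PB.PiM_eqI)
    show "sets ?D = sets (\<Pi>\<^sub>M i\<in>{..<n}. density lborel (\<lambda>x. ennreal (mix_density p x \<eta>')))"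
      by (simp add: sets_sample_law sets_sample_law[of p n \<eta>', unfolded sample_law_def])
    fix S :: "nat \<Rightarrow> real set"
    assume S0: "\<And>i. i \<in> {..<n} \<Longrightarrow> S i \<in> sets (density lborel (\<lambda>x. ennreal (mix_density p x \<eta>')))"
    hence S: "\<And>i. i \<in> {..<n} \<Longrightarrow> S i \<in> sets borel" by simp
    have PS: "Pi\<^sub>E {..<n} S \<in> sets (sample_law p n \<eta>)"
      unfolding sample_law_def using S by (intro sets_PiM_I_finite) auto
    have "emeasure ?D (Pi\<^sub>E {..<n} S) = (\<integral>\<^sup>+ y. (\<Prod>i<n. ?l (y i)) * indicator (Pi\<^sub>E {..<n} S) y \<partial>sample_law p n \<eta>)"
      using PS by (subst emeasure_density) auto
    also have "\<dots> = (\<integral>\<^sup>+ y. (\<Prod>i<n. ?l (y i) * indicator (S i) (y i)) \<partial>sample_law p n \<eta>)"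
    proof (rule nn_integral_cong)
      fix y assume "y \<in> space (sample_law p n \<eta>)"
      hence y: "y \<in> extensional {..<n}" by (simp add: space_sample_law sample_space_def space_PiM PiE_def)
      have "indicator (Pi\<^sub>E {..<n} S) y = (\<Prod>i<n. indicator (S i) (y i) :: ennreal)"
      proof (cases "\<forall>i<n. y i \<in> S i")
        case True
        thus ?thesis using y by (auto simp: PiE_def Pi_def indicator_def)
      next
        case False
        then obtain i where "i < n" "y i \<notin> S i" by blast
        hence "(\<Prod>i<n. indicator (S i) (y i) :: ennreal) = 0" by (intro prod_zero bexI[of _ i]) auto
        moreover have "y \<notin> Pi\<^sub>E {..<n} S" using \<open>i < n\<close> \<open>y i \<notin> S i\<close> by auto
        ultimately show ?thesis by simp
      qed
      thus "(\<Prod>i<n. ?l (y i)) * indicator (Pi\<^sub>E {..<n} S) y = (\<Prod>i<n. ?l (y i) * indicator (S i) (y i))"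
        by (simp add: prod.distrib)
    qed
    also have "\<dots> = (\<Prod>i<n. \<integral>\<^sup>+ x. ?l x * indicator (S i) x \<partial>density lborel (\<lambda>x. ennreal (mix_density p x \<eta>)))"
      unfolding sample_law_def using S
      by (subst PA.product_nn_integral_prod[where f = "\<lambda>i x. ?l x * indicator (S i) x"]) auto
    also have "\<dots> = (\<Prod>i<n. emeasure (density lborel (\<lambda>x. ennreal (mix_density p x \<eta>'))) (S i))"
    proof (rule prod.cong[OF refl])
      fix i assume "i \<in> {..<n}"
      hence [measurable]: "S i \<in> sets borel" using S by blast
      have "(\<integral>\<^sup>+ x. ?l x * indicator (S i) x \<partial>density lborel (\<lambda>x. ennreal (mix_density p x \<eta>)))
        = (\<integral>\<^sup>+ x. ennreal (mix_density p x \<eta>) * (?l x * indicator (S i) x) \<partial>lborel)"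
        by (subst nn_integral_density) auto
      also have "\<dots> = (\<integral>\<^sup>+ x. ennreal (mix_density p x \<eta>') * indicator (S i) x \<partial>lborel)"
      proof (rule nn_integral_cong)
        fix x
        have "ennreal (mix_density p x \<eta>) * ?l x = ennreal (mix_density p x \<eta>')"
          using pg[of x] pg'[of x] by (simp add: less_imp_le flip: ennreal_mult)
        thus "ennreal (mix_density p x \<eta>) * (?l x * indicator (S i) x) = ennreal (mix_density p x \<eta>') * indicator (S i) x"
          by (simp flip: mult.assoc)
      qed
      also have "\<dots> = emeasure (density lborel (\<lambda>x. ennreal (mix_density p x \<eta>'))) (S i)"
        by (subst emeasure_density) auto
      finally show "(\<integral>\<^sup>+ x. ?l x * indicator (S i) x \<partial>density lborel (\<lambda>x. ennreal (mix_density p x \<eta>)))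
        = emeasure (density lborel (\<lambda>x. ennreal (mix_density p x \<eta>'))) (S i)" .
    qed
    finally show "emeasure ?D (Pi\<^sub>E {..<n} S) = (\<Prod>i\<in>{..<n}. emeasure (density lborel (\<lambda>x. ennreal (mix_density p x \<eta>'))) (S i))" .
  qed simp
  thus ?thesis by (simp add: sample_law_def)
qed

text \<open>
  Let \<open>R\<close> be the likelihood ratio. Then \<open>a + R b \<ge> s min(1, R) \<ge> s (R - R\<^sup>2 / 4)\<close>, and under the first
  law \<open>R\<close> has mean one and second moment \<open>(1 + \<chi>\<^sup>2)\<^sup>n \<le> (1 + 1/n)\<^sup>n \<le> 3\<close>. The quadratic minorant of
  \<open>min(1, R)\<close> replaces the total variation distance of the product measures.
\<close>
lemma two_point_bound:
  assumes p: "0 < p" "p < 1" and m: "0 < m" and e: "\<eta> \<in> param_box M m V" "\<eta>' \<in> param_box M m V"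
    and n: "n \<ge> 1"
    and chi: "(\<integral>\<^sup>+ x. ennreal ((mix_density p x \<eta>')^2 / mix_density p x \<eta>) \<partial>lborel) \<le> ennreal (1 + 1 / real n)"
    and [measurable]: "a \<in> borel_measurable (sample_space n)" "b \<in> borel_measurable (sample_space n)"
    and ab: "\<And>y. a y \<ge> 0" "\<And>y. b y \<ge> 0" "\<And>y. s \<le> a y + b y" and s: "s \<ge> 0"
  shows "ennreal (s / 4) \<le> (\<integral>\<^sup>+ y. ennreal (a y) \<partial>sample_law p n \<eta>) + (\<integral>\<^sup>+ y. ennreal (b y) \<partial>sample_law p n \<eta>')"
proof -
  note pg = mix_density_pos[OF p m e(1)] and pg' = mix_density_pos[OF p m e(2)]
  define r where "r x = mix_density p x \<eta>' / mix_density p x \<eta>" for x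
  have [measurable]: "r \<in> borel_measurable borel" unfolding r_def[abs_def] by measurable
  have r0: "r x \<ge> 0" for x using pg[of x] pg'[of x] by (simp add: r_def)
  define R where "R y = (\<Prod>i<n. r (y i))" for y :: "nat \<Rightarrow> real"
  have R0: "R y \<ge> 0" for y unfolding R_def by (intro prod_nonneg) (simp add: r0)
  have RE: "ennreal (R y) = (\<Prod>i<n. ennreal (r (y i)))" for y
    unfolding R_def by (subst prod_ennreal) (auto simp: r0)
  note cong = measurable_cong_sets[OF sets_sample_law refl]
  have [measurable]: "R \<in> borel_measurable (sample_law p n \<eta>)"
    unfolding cong R_def[abs_def] sample_space_def by measurable
  have [measurable]: "a \<in> borel_measurable (sample_law p n \<eta>)" "b \<in> borel_measurable (sample_law p n \<eta>)"
    unfolding cong by measurable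
  have law': "sample_law p n \<eta>' = density (sample_law p n \<eta>) (\<lambda>y. ennreal (R y))"
    unfolding RE r_def by (rule sample_law_density[OF p m e])
  have Eb: "(\<integral>\<^sup>+ y. ennreal (b y) \<partial>sample_law p n \<eta>') = (\<integral>\<^sup>+ y. ennreal (R y) * ennreal (b y) \<partial>sample_law p n \<eta>)"
    unfolding law' by (subst nn_integral_density) auto
  have E1: "(\<integral>\<^sup>+ y. ennreal (R y) \<partial>sample_law p n \<eta>) = 1"
  proof -
    interpret P: prob_space "sample_law p n \<eta>'" using p m e(2) by (rule prob_space_sample_law)
    have "1 = emeasure (sample_law p n \<eta>') (space (sample_law p n \<eta>'))" by (simp add: P.emeasure_space_1)
    also have "\<dots> = (\<integral>\<^sup>+ y. ennreal (R y) * indicator (space (sample_law p n \<eta>)) y \<partial>sample_law p n \<eta>)"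
      by (simp add: space_sample_law) (subst law', subst emeasure_density, auto simp flip: space_sample_law[of p n \<eta>])
    also have "\<dots> = (\<integral>\<^sup>+ y. ennreal (R y) \<partial>sample_law p n \<eta>)" by (intro nn_integral_cong) simp
    finally show ?thesis ..
  qed
  have E2: "(\<integral>\<^sup>+ y. ennreal ((R y)^2) \<partial>sample_law p n \<eta>) \<le> 3"
  proof -
    have "(\<integral>\<^sup>+ y. ennreal ((R y)^2) \<partial>sample_law p n \<eta>) = (\<integral>\<^sup>+ y. (\<Prod>i<n. ennreal ((r (y i))^2)) \<partial>sample_law p n \<eta>)"
      by (intro nn_integral_cong) (simp add: R_def prod_power_distrib prod_ennreal)
    also have "\<dots> = (\<integral>\<^sup>+ x. ennreal (mix_density p x \<eta>) * ennreal ((r x)^2) \<partial>lborel) ^ n"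
      by (rule nn_integral_sample_prod[OF p m e(1)]) measurable
    also have "(\<integral>\<^sup>+ x. ennreal (mix_density p x \<eta>) * ennreal ((r x)^2) \<partial>lborel)
       = (\<integral>\<^sup>+ x. ennreal ((mix_density p x \<eta>')^2 / mix_density p x \<eta>) \<partial>lborel)"
    proof (rule nn_integral_cong)
      fix x
      show "ennreal (mix_density p x \<eta>) * ennreal ((r x)^2) = ennreal ((mix_density p x \<eta>')^2 / mix_density p x \<eta>)"
        using pg[of x] by (simp add: r_def power_divide power2_eq_square less_imp_le flip: ennreal_mult')
    qed
    also have "\<dots> ^ n \<le> ennreal (1 + 1 / real n) ^ n" by (intro power_mono chi) simp
    also have "\<dots> = ennreal ((1 + 1 / real n) ^ n)" by (rule ennreal_power) simp
    also have "(1 + 1 / real n) ^ n \<le> exp (1 / real n) ^ n" by (intro power_mono exp_ge_add_one_self) auto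
    also have "exp (1 / real n) ^ n = exp 1" using n by (simp flip: exp_of_nat_mult)
    also have "exp 1 \<le> (3::real)" by (rule exp_le)
    finally show ?thesis by (simp add: ennreal_leI)
  qed
  have ptw: "ennreal s * ennreal (R y) \<le> ennreal (a y) + ennreal (R y) * ennreal (b y) + ennreal (s / 4) * ennreal ((R y)^2)" for y
  proof -
    have "s * (R y - (R y)^2 / 4) \<le> a y + R y * b y"
    proof -
      have m1: "R y - (R y)^2 / 4 \<le> min 1 (R y)"
      proof -
        have "(R y / 2 - 1)^2 \<ge> 0" by simp
        hence "R y - (R y)^2 / 4 \<le> 1" by (simp add: power2_eq_square field_simps)
        thus ?thesis by simp
      qed
      have "s * (R y - (R y)^2 / 4) \<le> s * min 1 (R y)" using s m1 by (intro mult_left_mono)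
      also have "\<dots> \<le> (a y + b y) * min 1 (R y)" using ab R0[of y] by (intro mult_right_mono) auto
      also have "\<dots> = a y * min 1 (R y) + b y * min 1 (R y)" by (rule distrib_right)
      also have "\<dots> \<le> a y * 1 + b y * R y" using ab by (intro add_mono mult_left_mono) auto
      finally show ?thesis by (simp add: mult.commute)
    qed
    hence "s * R y \<le> a y + R y * b y + s / 4 * (R y)^2" by (simp add: algebra_simps)
    thus ?thesis
      using ab s R0[of y] by (simp add: ennreal_leI flip: ennreal_mult ennreal_plus)
  qed
  have "ennreal s = (\<integral>\<^sup>+ y. ennreal s * ennreal (R y) \<partial>sample_law p n \<eta>)"
    by (subst nn_integral_cmult) (auto simp: E1)
  also have "\<dots> \<le> (\<integral>\<^sup>+ y. ennreal (a y) + ennreal (R y) * ennreal (b y) + ennreal (s / 4) * ennreal ((R y)^2) \<partial>sample_law p n \<eta>)"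
    by (intro nn_integral_mono ptw)
  also have "\<dots> = (\<integral>\<^sup>+ y. ennreal (a y) \<partial>sample_law p n \<eta>) + (\<integral>\<^sup>+ y. ennreal (b y) \<partial>sample_law p n \<eta>')
      + ennreal (s / 4) * (\<integral>\<^sup>+ y. ennreal ((R y)^2) \<partial>sample_law p n \<eta>)"
    unfolding Eb by (subst nn_integral_add, measurable, subst nn_integral_add, measurable, subst nn_integral_cmult, measurable)
  also have "\<dots> \<le> (\<integral>\<^sup>+ y. ennreal (a y) \<partial>sample_law p n \<eta>) + (\<integral>\<^sup>+ y. ennreal (b y) \<partial>sample_law p n \<eta>')
      + ennreal (s / 4) * 3"
    by (intro add_left_mono mult_left_mono E2) auto
  also have "ennreal (s / 4) * 3 = ennreal (3 / 4 * s)"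
    using s by (simp flip: ennreal_numeral ennreal_mult)
  finally have f: "ennreal s \<le> ((\<integral>\<^sup>+ y. ennreal (a y) \<partial>sample_law p n \<eta>) + (\<integral>\<^sup>+ y. ennreal (b y) \<partial>sample_law p n \<eta>')) + ennreal (3 / 4 * s)" .
  have imp: "ennreal (s / 4) \<le> z" if "ennreal s \<le> z + ennreal (3 / 4 * s)" for z
  proof (cases z)
    case (real w)
    have "ennreal s \<le> ennreal (w + 3 / 4 * s)" using that real s by (simp add: ennreal_plus)
    hence "s \<le> w + 3 / 4 * s" using real s by (subst (asm) ennreal_le_iff) auto
    thus ?thesis using real by (simp add: ennreal_leI)
  qed simp
  show ?thesis by (rule imp[OF f])
qed

lemma inverse_square_diff:
  fixes t0 h :: real
  assumes t0: "t0 > 0" and h: "\<bar>h\<bar> \<le> t0 / 10"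
  shows "\<bar>1 / (t0 + h)^2 - 1 / t0^2\<bar> \<le> 3 / t0^3 * \<bar>h\<bar>"
proof -
  have b: "9 / 10 * t0 \<le> t0 + h" "t0 + h \<le> 11 / 10 * t0" using h by linarith+
  have pos: "t0 + h > 0" using b t0 by linarith
  have "(9 / 10 * t0)^2 \<le> (t0 + h)^2" using b t0 by (intro power_mono) auto
  hence sq: "81 / 100 * t0^2 \<le> (t0 + h)^2" by (simp add: power_mult_distrib power_divide)
  have "1 / (t0 + h)^2 - 1 / t0^2 = - (h * (2 * t0 + h)) / ((t0 + h)^2 * t0^2)"
  proof -
    have "1 / (t0 + h)^2 - 1 / t0^2 = (t0^2 - (t0 + h)^2) / ((t0 + h)^2 * t0^2)"
      using pos t0 by (simp add: diff_frac_eq)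
    also have "t0^2 - (t0 + h)^2 = - (h * (2 * t0 + h))" by (simp add: power2_eq_square algebra_simps)
    finally show ?thesis .
  qed
  hence "\<bar>1 / (t0 + h)^2 - 1 / t0^2\<bar> = \<bar>h\<bar> * \<bar>2 * t0 + h\<bar> / ((t0 + h)^2 * t0^2)"
    by (simp add: abs_mult)
  also have "\<dots> \<le> \<bar>h\<bar> * (21 / 10 * t0) / ((81 / 100 * t0^2) * t0^2)"
    using h t0 sq pos by (intro frac_le mult_left_mono mult_right_mono) (auto simp: abs_le_iff)
  also have "\<dots> = (70 / 27) / t0^3 * \<bar>h\<bar>" using t0 by (simp add: field_simps power_numeral_reduce)
  also have "\<dots> \<le> 3 / t0^3 * \<bar>h\<bar>" using t0 by (intro mult_right_mono divide_right_mono) auto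
  finally show ?thesis .
qed

lemma psi_loss_6_ge_sqrt:
  "sqrt \<bar>snd (snd \<eta>) - snd (snd \<eta>')\<bar> \<le> psi_loss 6 \<eta> \<eta>'"
proof -
  obtain \<theta> v1 v2 \<theta>' v1' v2' where e: "\<eta> = (\<theta>, v1, v2)" "\<eta>' = (\<theta>', v1', v2')"
    by (metis prod.exhaust)
  have "sqrt x = (x^3) powr (1 / 6)" if "x \<ge> 0" for x
  proof -
    have "(x^3) powr (1 / 6) = (x powr 3) powr (1 / 6)" using that by simp
    also have "\<dots> = x powr (1 / 2)" by (simp only: powr_powr) simp
    finally show ?thesis using that by (simp add: powr_half_sqrt)
  qed
  hence "sqrt \<bar>v2 - v2'\<bar> = (\<bar>v2 - v2'\<bar>^3) powr (1 / 6)" by simp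
  also have "\<dots> \<le> psi6 \<eta> \<eta>' powr (1 / 6)"
    by (intro powr_mono2) (auto simp: psi6_def e)
  finally show ?thesis by (simp add: psi_loss_6 e)
qed

lemma psi_loss_borel [measurable]:
  "(\<lambda>\<eta>. psi_loss r \<eta> \<eta>') \<in> borel_measurable borel"
  unfolding psi_loss_def split_def borel_prod[symmetric] by measurable

text \<open>
  For \<open>d\<close> a small multiple of \<open>n\<^sup>-\<^sup>1\<^sup>/\<^sup>6\<close>, the chi-square divergence of the hard pair is at most \<open>1/n\<close>,
  both points satisfy \<open>\<psi>\<^sup>6 = O(d\<^sup>3) = O(n\<^sup>-\<^sup>1\<^sup>/\<^sup>2)\<close> relative to the centre, and their second variances
  differ by at least a multiple of \<open>d\<close>.
\<close>
lemma minimax_lower_bound: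
  assumes p: "0 < p" "p < 1" and O: "\<Omega> \<subseteq> {0<..}" and T0: "0 \<in> \<Theta>" and v0: "v0 \<in> interior \<Omega>"
  shows "\<exists>c1>0. \<exists>C>0. \<forall>n\<ge>1. \<forall>T\<in>estimators (param_space \<Theta> \<Omega>) n.
     ennreal (C * (1 / real n) powr (1 / 12)) \<le>
       (SUP \<eta>\<in>local_params (param_space \<Theta> \<Omega>) 6 (0, v0, v0) (c1 * real n powr (- 1 / 2)). risk p 6 n T \<eta>)"
proof -
  have v0p: "v0 > 0" using v0 O interior_subset by blast
  obtain e where e: "e > 0" "cball v0 e \<subseteq> \<Omega>" using v0 mem_interior_cball by blast
  define t0 where "t0 = 1 / sqrt v0"
  have t0: "t0 > 0" "1 / t0^2 = v0" using v0p by (auto simp: t0_def power_divide)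
  obtain K where K: "K > 0" "\<forall>d. 0 < d \<longrightarrow> d \<le> t0 / 10 \<longrightarrow>
    (\<integral>\<^sup>+ x. ennreal ((mix_density p x (hard_point p t0 (-d)))^2 / mix_density p x (hard_point p t0 d)) \<partial>lborel)
      \<le> ennreal (1 + K * d^6)"
    using hard_points_chi2[OF p t0(1)] by blast
  define k where "k = 3 / t0^3"
  have k: "k > 0" using t0 by (simp add: k_def)
  \<comment> \<open>The three bounds keep \<open>d\<close> in the range of the Taylor estimates, keep the variances in \<open>\<Omega>\<close>, and make the chi-square divergence at most \<open>1/n\<close>.\<close>
  define d0 where "d0 = min (min (t0 / 10) (e / k)) (1 / (1 + K))"
  have d0: "d0 > 0" "d0 \<le> t0 / 10" "k * d0 \<le> e" "d0 \<le> 1 / (1 + K)"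
  proof -
    show "d0 > 0" using t0 e k K by (simp add: d0_def)
    show "d0 \<le> t0 / 10" unfolding d0_def by (rule min.coboundedI1[OF min.cobounded1])
    show "d0 \<le> 1 / (1 + K)" unfolding d0_def by (rule min.cobounded2)
    have "d0 \<le> e / k" unfolding d0_def by (rule min.coboundedI1[OF min.cobounded2])
    thus "k * d0 \<le> e" using k by (simp add: field_simps)
  qed
  have d0K: "K * d0^6 \<le> 1"
  proof -
    have "1 / (1 + K) \<le> 1" using K by simp
    hence "d0 \<le> 1" using d0 by linarith
    hence "d0^6 \<le> d0^1" using d0 by (intro power_decreasing) auto
    hence "K * d0^6 \<le> K * (1 / (1 + K))" using d0 K by (intro mult_left_mono) auto
    also have "\<dots> \<le> 1" using K by simp
    finally show ?thesis .
  qed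
  define c1 where "c1 = 2 * (k * d0)^3"
  define C where "C = sqrt (4 * p * d0 / t0^3) / 8"
  have c1: "c1 > 0" using k d0 by (simp add: c1_def)
  have C: "C > 0" using p d0 t0 by (simp add: C_def)
  show ?thesis
  proof (rule exI[of _ c1], intro conjI c1, rule exI[of _ C], intro conjI allI impI ballI C)
    fix n :: nat and T assume n: "1 \<le> n" and T: "T \<in> estimators (param_space \<Theta> \<Omega>) n"
    define d where "d = d0 * (1 / real n) powr (1 / 6)"
    have n0: "real n > 0" using n by simp
    have w: "0 < (1 / real n) powr (1 / 6)" "(1 / real n) powr (1 / 6) \<le> 1"
      using n by (auto intro!: powr_le1)
    have d: "0 < d" "d \<le> d0" using d0 w by (auto simp: d_def mult_le_cancel_left1)
    have dt: "d \<le> t0 / 10" using d d0 by simp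
    have d6: "d^6 = d0^6 * (1 / real n)"
      using n0 by (simp add: d_def power_mult_distrib powr_realpow[symmetric] powr_powr powr_numeral[symmetric] del: powr_numeral)
    have d3: "d^3 = d0^3 * real n powr (- 1 / 2)"
    proof -
      have "((1 / real n) powr (1 / 6)) ^ 3 = (1 / real n) powr (1 / 2)"
        using n0 by (simp add: powr_power)
      also have "\<dots> = real n powr (- 1 / 2)" using n0 by (simp add: powr_divide powr_minus_divide)
      finally show ?thesis by (simp add: d_def power_mult_distrib)
    qed
    define h1 h2 where "h1 = hard_point p t0 d" and "h2 = hard_point p t0 (- d)"
    have pd: "\<bar>p * d\<bar> \<le> d" "\<bar>(1 - p) * d\<bar> \<le> d"
      using p d by (auto simp: abs_mult mult_le_cancel_right1)
    have near: "\<bar>1 / (t0 + h)^2 - v0\<bar> \<le> k * d" if "\<bar>h\<bar> \<le> d" for h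
    proof -
      have "\<bar>1 / (t0 + h)^2 - 1 / t0^2\<bar> \<le> k * \<bar>h\<bar>"
        unfolding k_def using that dt by (intro inverse_square_diff t0) auto
      also have "\<dots> \<le> k * d" using that k by (intro mult_left_mono) auto
      finally show ?thesis by (simp add: t0)
    qed
    have ne: "\<bar>1 / (t0 + p * d)^2 - v0\<bar> \<le> k * d" "\<bar>1 / (t0 - p * d)^2 - v0\<bar> \<le> k * d"
      "\<bar>1 / (t0 + (1 - p) * d)^2 - v0\<bar> \<le> k * d" "\<bar>1 / (t0 - (1 - p) * d)^2 - v0\<bar> \<le> k * d"
      using near[of "p * d"] near[of "- (p * d)"] near[of "(1 - p) * d"] near[of "- ((1 - p) * d)"] pd by auto
    have kd: "k * d \<le> e" using mult_left_mono[OF d(2), of k] k d0 by linarith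
    have inO: "v \<in> \<Omega>" if "\<bar>v - v0\<bar> \<le> k * d" for v
      using that kd e(2) by (auto simp: dist_real_def abs_minus_commute)
    have loc: "\<eta> \<in> local_params (param_space \<Theta> \<Omega>) 6 (0, v0, v0) (c1 * real n powr (- 1 / 2))"
      if \<eta>: "\<eta> = (0, v, v')" "\<bar>v - v0\<bar> \<le> k * d" "\<bar>v' - v0\<bar> \<le> k * d" for \<eta> v v'
    proof -
      have "\<bar>v - v0\<bar>^3 + \<bar>v' - v0\<bar>^3 \<le> (k * d)^3 + (k * d)^3"
        using \<eta> by (intro add_mono power_mono) auto
      also have "\<dots> = c1 * real n powr (- 1 / 2)"
        by (simp add: power_mult_distrib d3 c1_def)
      finally have "psi6 \<eta> (0, v0, v0) \<le> c1 * real n powr (- 1 / 2)" by (simp add: psi6_def \<eta>(1))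
      moreover have "psi_loss 6 \<eta> (0, v0, v0) ^ 6 = psi6 \<eta> (0, v0, v0)"
      proof (cases "psi6 \<eta> (0, v0, v0) = 0")
        case False
        hence "psi6 \<eta> (0, v0, v0) > 0" using psi6_nonneg[of \<eta> "(0, v0, v0)"] by simp
        thus ?thesis by (simp add: psi_loss_6 powr_power)
      qed (simp add: psi_loss_6)
      ultimately show ?thesis
        using \<eta> T0 inO by (auto simp: local_params_def param_space_def)
    qed
    have l1: "h1 \<in> local_params (param_space \<Theta> \<Omega>) 6 (0, v0, v0) (c1 * real n powr (- 1 / 2))"
      by (rule loc[OF _ ne(4) ne(1)]) (simp add: h1_def hard_point_def)
    have l2: "h2 \<in> local_params (param_space \<Theta> \<Omega>) 6 (0, v0, v0) (c1 * real n powr (- 1 / 2))"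
      by (rule loc[OF _ ne(3) ne(2)]) (simp add: h2_def hard_point_def)
    obtain m V where mV: "0 < m" "h1 \<in> param_box 0 m V" "h2 \<in> param_box 0 m V"
    proof -
      have pos: "snd (snd h1) > 0" "fst (snd h1) > 0" "snd (snd h2) > 0" "fst (snd h2) > 0"
        using l1 l2 O by (auto simp: local_params_def param_space_def)
      define m where "m = min (min (snd (snd h1)) (fst (snd h1))) (min (snd (snd h2)) (fst (snd h2)))"
      define V where "V = max (max (snd (snd h1)) (fst (snd h1))) (max (snd (snd h2)) (fst (snd h2)))"
      have z: "fst h1 = 0" "fst h2 = 0" by (simp_all add: h1_def h2_def hard_point_def)
      have "m > 0" using pos by (simp add: m_def)
      moreover have "h1 \<in> param_box 0 m V" "h2 \<in> param_box 0 m V"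
        using z by (auto simp: param_box_def mem_Times_iff m_def V_def)
      ultimately show ?thesis using that by blast
    qed
    have chi: "(\<integral>\<^sup>+ x. ennreal ((mix_density p x h2)^2 / mix_density p x h1) \<partial>lborel) \<le> ennreal (1 + 1 / real n)"
    proof -
      have "(\<integral>\<^sup>+ x. ennreal ((mix_density p x h2)^2 / mix_density p x h1) \<partial>lborel) \<le> ennreal (1 + K * d^6)"
        unfolding h1_def h2_def using K(2) d(1) dt by blast
      also have "K * d^6 \<le> 1 / real n"
        unfolding d6 using mult_right_mono[OF d0K, of "1 / real n"] by simp
      finally show ?thesis by (simp add: ennreal_leI)
    qed
    define s where "s = sqrt \<bar>snd (snd h1) - snd (snd h2)\<bar>"
    have Tm [measurable]: "T \<in> borel_measurable (sample_space n)"
      using T unfolding estimators_def by (rule measurable_restrict_space2_iff[THEN iffD1, THEN conjunct1])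
    have tri: "s \<le> psi_loss 6 (T y) h1 + psi_loss 6 (T y) h2" for y
    proof -
      have "s \<le> sqrt (\<bar>snd (snd (T y)) - snd (snd h1)\<bar> + \<bar>snd (snd (T y)) - snd (snd h2)\<bar>)"
        unfolding s_def by (intro real_sqrt_le_mono) linarith
      also have "\<dots> \<le> sqrt \<bar>snd (snd (T y)) - snd (snd h1)\<bar> + sqrt \<bar>snd (snd (T y)) - snd (snd h2)\<bar>"
        by (intro sqrt_add_le_add_sqrt) auto
      also have "\<dots> \<le> psi_loss 6 (T y) h1 + psi_loss 6 (T y) h2"
        by (intro add_mono psi_loss_6_ge_sqrt)
      finally show ?thesis .
    qed
    have two: "ennreal (s / 4) \<le> risk p 6 n T h1 + risk p 6 n T h2"
      unfolding risk_def
      by (rule two_point_bound[OF p mV n chi measurable_compose[OF Tm psi_loss_borel]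
            measurable_compose[OF Tm psi_loss_borel] _ _ tri]) (auto simp: psi_loss_6 s_def)
    have sep: "C * (1 / real n) powr (1 / 12) \<le> s / 8"
    proof -
      have x: "\<bar>p * d\<bar> < t0" using pd(1) dt t0 by linarith
      have "snd (snd h2) - snd (snd h1) = 4 * t0 * (p * d) / ((t0^2 - (p * d)^2)^2)"
      proof -
        have nz: "t0 + p * d \<noteq> 0" "t0 - p * d \<noteq> 0" using x by auto
        have "t0^2 - (p * d)^2 = (t0 + p * d) * (t0 - p * d)" by (simp add: power2_eq_square algebra_simps)
        moreover have "1 / (t0 - p * d)^2 - 1 / (t0 + p * d)^2 = ((t0 + p * d)^2 - (t0 - p * d)^2) / ((t0 + p * d) * (t0 - p * d))^2"
          using nz by (simp add: power_mult_distrib diff_divide_distrib)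
        moreover have "(t0 + p * d)^2 - (t0 - p * d)^2 = 4 * t0 * (p * d)" by (simp add: power2_eq_square algebra_simps)
        ultimately show ?thesis by (simp add: h1_def h2_def hard_point_def)
      qed
      also have "\<dots> \<ge> 4 * t0 * (p * d) / (t0^2)^2"
      proof (rule divide_left_mono)
        have "(p * d)^2 < t0^2" using x by (metis abs_of_pos abs_square_less_1 power2_strict_mono t0(1))
        thus "(t0^2 - (p * d)^2)^2 \<le> (t0^2)^2" by (intro power_mono) auto
        show "0 < (t0\<^sup>2)\<^sup>2 * (t0\<^sup>2 - (p * d)\<^sup>2)\<^sup>2" using \<open>(p * d)^2 < t0^2\<close> t0 by simp
      qed (use p d t0 in simp)
      also have "4 * t0 * (p * d) / (t0^2)^2 = 4 * p * d0 / t0^3 * (1 / real n) powr (1 / 6)"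
        using t0 by (simp add: d_def field_simps power_numeral_reduce)
      finally have "4 * p * d0 / t0^3 * (1 / real n) powr (1 / 6) \<le> \<bar>snd (snd h1) - snd (snd h2)\<bar>" by linarith
      hence "sqrt (4 * p * d0 / t0^3 * (1 / real n) powr (1 / 6)) \<le> s"
        unfolding s_def by (rule real_sqrt_le_mono)
      hence "sqrt (4 * p * d0 / t0^3) * sqrt ((1 / real n) powr (1 / 6)) \<le> s"
        by (simp only: real_sqrt_mult)
      moreover have "sqrt ((1 / real n) powr (1 / 6)) = (1 / real n) powr (1 / 12)"
        using n0 by (simp add: powr_half_sqrt[symmetric] powr_powr)
      ultimately show ?thesis by (simp add: C_def)
    qed
    define S where "S = (SUP \<eta>\<in>local_params (param_space \<Theta> \<Omega>) 6 (0, v0, v0) (c1 * real n powr (- 1 / 2)). risk p 6 n T \<eta>)"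
    have "risk p 6 n T h1 \<le> S" "risk p 6 n T h2 \<le> S"
      unfolding S_def using l1 l2 by (auto intro: SUP_upper)
    hence SS: "ennreal (s / 4) \<le> S + S" using two by (meson add_mono order_trans)
    have "ennreal (s / 8) \<le> S"
    proof (cases S)
      case (real w)
      have "s / 4 \<le> w + w" using SS real by (simp flip: ennreal_plus)
      thus ?thesis using real by (simp add: ennreal_leI)
    qed simp
    thus "ennreal (C * (1 / real n) powr (1 / 12)) \<le> (SUP \<eta>\<in>local_params (param_space \<Theta> \<Omega>) 6 (0, v0, v0) (c1 * real n powr (- 1 / 2)). risk p 6 n T \<eta>)"
      unfolding S_def[symmetric] using sep by (meson ennreal_leI order_trans)
  qed
qed

section \<open>Rates of estimation\<close>

theorem theorem2p1:
  fixes \<Theta> \<Omega> :: "real set" and p :: real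
  assumes "compact \<Theta>" and "compact \<Omega>" and "\<Omega> \<subseteq> {0<..}" and "0 \<in> interior \<Theta>"
    and "0 < p" and "p < 1 / 2"
  defines "H \<equiv> param_space \<Theta> \<Omega>" and "r \<equiv> r_asym p"
  shows "(\<exists>C::real. C > 0 \<and>
            (\<forall>n\<ge>2. \<forall>T. is_mle p H n T \<longrightarrow>
              (SUP \<eta>\<in>H. risk p (real r) n T \<eta>)
                \<le> ennreal (C * (ln (real n) / real n) powr (1 / (2 * real r)))))
       \<and> (\<forall>v0 \<in> interior \<Omega>. \<exists>c1 C'::real. c1 > 0 \<and> C' > 0 \<and>
            (\<forall>n\<ge>1.
              (INF T\<in>estimators H n.
                 SUP \<eta>\<in>local_params H r (0, v0, v0) (c1 * real n powr (- 1 / 2)).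
                   risk p (real r) n T \<eta>)
                \<ge> ennreal (C' * (1 / real n) powr (1 / (2 * real r)))))"
proof -
  have p1: "p < 1" using assms(6) by simp
  have r: "r = 6" unfolding r_def by (rule r_asym_eq_6[OF assms(5,6)])
  have r6: "real r = 6" and e12: "1 / (2 * 6) = (1 / 12 :: real)" by (simp_all add: r)
  obtain M where M: "M > 0" "\<forall>\<theta>\<in>\<Theta>. \<bar>\<theta>\<bar> \<le> M"
    using compact_imp_bounded[OF assms(1)] by (auto simp: bounded_pos)
  have "\<exists>m V. 0 < m \<and> m \<le> V \<and> \<Omega> \<subseteq> {m..V}"
  proof (cases "\<Omega> = {}")
    case True
    thus ?thesis by (intro exI[of _ 1]) auto
  next
    case False
    obtain m where m: "m \<in> \<Omega>" "\<And>v. v \<in> \<Omega> \<Longrightarrow> m \<le> v"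
      using compact_attains_inf[OF assms(2) False] by blast
    obtain V where V: "V \<in> \<Omega>" "\<And>v. v \<in> \<Omega> \<Longrightarrow> v \<le> V"
      using compact_attains_sup[OF assms(2) False] by blast
    show ?thesis
      using m V assms(3) by (intro exI[of _ m] exI[of _ V]) auto
  qed
  then obtain m V where mV: "0 < m" "m \<le> V" "\<Omega> \<subseteq> {m..V}" by blast
  have H: "H \<subseteq> param_box M m V"
    using M(2) mV(3) by (force simp: H_def param_space_def param_box_def abs_le_iff)
  have "\<exists>C>0. \<forall>n\<ge>2. \<forall>T. is_mle p H n T \<longrightarrow>
      (\<forall>\<eta>\<in>H. risk p 6 n T \<eta> \<le> ennreal (C * (ln (real n) / real n) powr (1 / 12)))"
    using assms(5,6) mV M(1) H by (intro mle_risk_bound) auto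
  hence upper: "\<exists>C::real. C > 0 \<and>
            (\<forall>n\<ge>2. \<forall>T. is_mle p H n T \<longrightarrow>
              (SUP \<eta>\<in>H. risk p (real r) n T \<eta>)
                \<le> ennreal (C * (ln (real n) / real n) powr (1 / (2 * real r))))"
    unfolding r6 e12 SUP_le_iff .
  have lower: "\<exists>c1 C'::real. c1 > 0 \<and> C' > 0 \<and>
            (\<forall>n\<ge>1.
              (INF T\<in>estimators H n.
                 SUP \<eta>\<in>local_params H r (0, v0, v0) (c1 * real n powr (- 1 / 2)).
                   risk p (real r) n T \<eta>)
                \<ge> ennreal (C' * (1 / real n) powr (1 / (2 * real r))))"
    if v0: "v0 \<in> interior \<Omega>" for v0
  proof -
    have "0 \<in> \<Theta>" using assms(4) interior_subset by blast
    from minimax_lower_bound[OF assms(5) p1 assms(3) this v0]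
    obtain c1 C where c: "c1 > 0" "C > 0" and lb: "\<forall>n\<ge>1. \<forall>T\<in>estimators H n.
        ennreal (C * (1 / real n) powr (1 / 12)) \<le>
          (SUP \<eta>\<in>local_params H 6 (0, v0, v0) (c1 * real n powr (- 1 / 2)). risk p 6 n T \<eta>)"
      unfolding H_def[symmetric] by (elim exE conjE)
    show ?thesis
      unfolding r6 e12 unfolding r le_INF_iff
      by (rule exI[of _ c1], rule exI[of _ C], intro conjI c lb)
  qed
  show ?thesis by (intro conjI ballI upper lower)
qed

end
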